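(* Let $n\ge 2$ and $1\le k<n$, and let $T\colon\mathbb{H}_n\to\mathbb{H}_n$ be a bijective real linear map. The following are equivalent. (a) $T$ preserves parallel pairs with respect to $w_k$ (i.e. $T(A)\parallel T(B)$ whenever $A\parallel B$). (b) $T$ preserves TEA pairs with respect to $w_k$. (c) There exist a nonzero $\mu\in\mathbb{R}$ and a unitary $U\in\mathbb{M}_n$ such that one of the following holds: (c.1) $\mu T$ has the form $A\mapsto U^*AU$ or $A\mapsto U^*A^tU$; (c.2) $n=2k>2$, $\mu T$ is unital (i.e. $\mu T(I)=I$), and there is $c\in\mathbb{R}\setminus\{0\}$ such that either $(\mu T)(A)=cU^*AU$ for all $A\in\mathbb{H}_n^0$, or $(\mu T)(A)=cU^*A^tU$ for all $A\in\mathbb{H}_n^0$; (c.3) $n=2$ and $\mu T$ is a bijective unital trace-preserving real linear map.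
   Context: $\mathbb{H}_n$ is the real vector space of $n\times n$ complex Hermitian matrices and $\mathbb{H}_n^0$ its subspace of trace-zero matrices. For $A\in\mathbb{M}_n$, $W_k(A)=\{\operatorname{tr}(AP): P=P^*=P^2,\ \operatorname{tr}P=k\}$ and $w_k(A)=\max\{|z|:z\in W_k(A)\}$. For $A,B\in\mathbb{H}_n$, $A\parallel B$ means $w_k(A+\mu B)=w_k(A)+w_k(B)$ for some $\mu\in\{1,-1\}$; $(A,B)$ is a TEA pair if $w_k(A+B)=w_k(A)+w_k(B)$. *)

theory Defs
  imports "HOL-Analysis.Analysis"
begin

definition cadj :: "complex^'n^'n \<Rightarrow> complex^'n^'n" where
  "cadj A = (\<chi> i j. cnj (A $ j $ i))"

definition herm :: "(complex^'n^'n) set" where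
  "herm = {A. cadj A = A}"

definition herm0 :: "(complex^'n^'n) set" where
  "herm0 = {A. A \<in> herm \<and> trace A = 0}"

definition unitary_mat :: "complex^'n^'n \<Rightarrow> bool" where
  "unitary_mat U \<longleftrightarrow> cadj U ** U = mat 1"

definition knr :: "nat \<Rightarrow> complex^'n^'n \<Rightarrow> complex set" where
  "knr k A = {trace (A ** P) | P. cadj P = P \<and> P ** P = P \<and> trace P = of_nat k}"

definition kradius :: "nat \<Rightarrow> complex^'n^'n \<Rightarrow> real" where
  "kradius k A = Sup (cmod ` knr k A)"

definition kparallel :: "nat \<Rightarrow> complex^'n^'n \<Rightarrow> complex^'n^'n \<Rightarrow> bool" where
  "kparallel k A B \<longleftrightarrow>
     (\<exists>\<mu>::real \<in> {1, -1}. kradius k (A + \<mu> *\<^sub>R B) = kradius k A + kradius k B)"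

definition TEA_pair :: "nat \<Rightarrow> complex^'n^'n \<Rightarrow> complex^'n^'n \<Rightarrow> bool" where
  "TEA_pair k A B \<longleftrightarrow> kradius k (A + B) = kradius k A + kradius k B"

definition real_linear_on_herm :: "(complex^'n^'n \<Rightarrow> complex^'n^'n) \<Rightarrow> bool" where
  "real_linear_on_herm T \<longleftrightarrow>
     (\<forall>A\<in>herm. \<forall>B\<in>herm. T (A + B) = T A + T B) \<and>
     (\<forall>A\<in>herm. \<forall>r::real. T (r *\<^sub>R A) = r *\<^sub>R T A)"

end

theory Submission
  imports Defs
begin

text \<open>
  Write \<open>A \<bullet> P = Re (tr (A P))\<close>, so that \<open>w\<^sub>k A\<close> is the maximum of \<open>\<bar>A \<bullet> P\<bar>\<close> over the rank-\<open>k\<close> projections, and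
  \<open>A\<close>, \<open>B\<close> are parallel iff some \<open>P\<close> attains both maxima. The identity is parallel to everything, hence
  so is its image, which must then be scalar; this normalises \<open>T I = I\<close>. Let \<open>D\<^sub>P\<close> be the cone of matrices
  for which \<open>P\<close> maximises \<open>A \<bullet> P\<close>; its elements are \<open>l I + X - Y\<close> with \<open>X\<close>, \<open>Y\<close> positive
  semidefinite on the range and the kernel of \<open>P\<close>. Choosing matrices whose images have a unique maximiser
  gives \<open>T D\<^sub>P \<subseteq> D\<^sub>Q\<close>, and comparing the dimensions of the commutants of \<open>P\<close> and \<open>Q\<close> gives equality. The
  extreme rays of \<open>D\<^sub>P\<close> modulo \<open>I\<close> contain the \<open>x x\<^sup>*\<close> with \<open>x\<close> in the range of \<open>P\<close> (for \<open>k \<ge> 2\<close>; replace \<open>k\<close> by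
  \<open>n - k\<close> otherwise), so \<open>T (x x\<^sup>*) = a y y\<^sup>* + b I\<close>. Summing over orthonormal bases shows that \<open>a\<close> is
  constant for \<open>n \<ge> 3\<close>, and \<open>T A = c \<psi> A + f A I\<close> with \<open>\<psi>\<close> a unitary similarity, possibly after transposition.
  Finally \<open>B\<close> is parallel to all \<open>B + \<alpha> I\<close> if the extreme values of \<open>B \<bullet> P\<close> are opposite, and \<open>T\<close> preserves
  this property; this forces \<open>f = 0\<close> on such \<open>B\<close>, and \<open>c = 1\<close> unless \<open>n = 2 k\<close>.
\<close>

section \<open>Hermitian inner product and rank-one matrices\<close>

text \<open>Nothing is assumed about the inverse of \<open>T\<close>, and parallelism sees absolute
  values rather than maximisers. Both obstacles are met by perturbation: a large multiple of
  \<open>I\<close> turns a signed maximiser into an absolute one, and a small multiple of a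
  projection \<open>Q\<close>, added with the right sign, makes \<open>Q\<close> the only maximiser.
  Commutants enter because the cone at \<open>P\<close> spans the commutant of \<open>P\<close>,
  whose dimension depends on \<open>k\<close> alone.

  Why \<open>k = 1\<close> must be avoided for extreme rays: if also n is at least 3, then
  \<open>outer x\<close> is \<open>I\<close> minus several \<open>outer y\<close> with
  \<open>y\<close> in the kernel, so modulo \<open>I\<close> it splits inside the cone. For n = 2
  neither \<open>k\<close> nor n - k reaches 2; there only the trace is controlled, and this
  suffices because two traceless matrices forming a TEA pair lie on a common ray, which every linear
  map respects. For n = 2k the radius of \<open>a I + X\<close> with \<open>X\<close> traceless is k
  |a| plus the radius of \<open>X\<close>, so the traceless part can be rescaled independently of
  \<open>I\<close>; this is the origin of the free constant \<open>c\<close>.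

  The equivalences are closed in the cycle (a), (c), (b), (a); the last step is a change of sign of
  one matrix.\<close>

definition cip :: "complex^'n \<Rightarrow> complex^'n \<Rightarrow> complex" where
  "cip x y = (\<Sum>i\<in>UNIV. cnj (x $ i) * y $ i)"

definition outer :: "complex^'n \<Rightarrow> complex^'n^'n" where
  "outer x = (\<chi> i j. x $ i * cnj (x $ j))"

definition qf :: "complex^'n^'n \<Rightarrow> complex^'n \<Rightarrow> real" where
  "qf A x = Re (cip x (A *v x))"

definition onb :: "('n \<Rightarrow> complex^'n) \<Rightarrow> bool" where
  "onb u \<longleftrightarrow> (\<forall>i j. cip (u i) (u j) = (if i = j then 1 else 0))"

definition colmat :: "('n \<Rightarrow> complex^'n) \<Rightarrow> complex^'n^'n" where
  "colmat u = (\<chi> i j. u j $ i)"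

lemma cip_add_left: "cip (x + y) z = cip x z + cip y z"
  by (simp add: cip_def sum.distrib algebra_simps)

lemma cip_add_right: "cip x (y + z) = cip x y + cip x z"
  by (simp add: cip_def sum.distrib algebra_simps)

lemma cip_diff_left: "cip (x - y) z = cip x z - cip y z"
  by (simp add: cip_def sum_subtractf algebra_simps)

lemma cip_diff_right: "cip x (y - z) = cip x y - cip x z"
  by (simp add: cip_def sum_subtractf algebra_simps)

lemma cip_smult_left: "cip (c *s x) y = cnj c * cip x y"
  by (simp add: cip_def sum_distrib_left algebra_simps)

lemma cip_smult_right: "cip x (c *s y) = c * cip x y"
  by (simp add: cip_def sum_distrib_left algebra_simps)

lemma scaleR_eq_smult: "r *\<^sub>R (x :: complex^'n) = complex_of_real r *s x"
  by (simp add: vec_eq_iff scaleR_conv_of_real[where 'a = complex])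

lemma cip_scaleR_left: "cip (r *\<^sub>R x) y = r * cip x y"
  by (simp add: scaleR_eq_smult cip_smult_left)

lemma cip_scaleR_right: "cip x (r *\<^sub>R y) = r * cip x y"
  by (simp add: scaleR_eq_smult cip_smult_right)

lemma cip_zero_left [simp]: "cip 0 x = 0" and cip_zero_right [simp]: "cip x 0 = 0"
  by (simp_all add: cip_def)

lemma cip_minus_right: "cip x (- y) = - cip x y"
  using cip_diff_right[of x 0 y] by simp

lemmas cip_simps = cip_add_left cip_add_right cip_diff_left cip_diff_right cip_smult_left
  cip_smult_right cip_scaleR_left cip_scaleR_right cip_minus_right

lemma cnj_cip: "cnj (cip x y) = cip y x"
  by (simp add: cip_def mult.commute)

lemma cip_eq_0_commute: "cip x y = 0 \<longleftrightarrow> cip y x = 0"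
  by (metis cnj_cip complex_cnj_zero_iff)

lemma Re_cip: "Re (cip x y) = x \<bullet> y"
  by (simp add: cip_def inner_vec_def inner_complex_def)

lemma cip_self: "cip x x = of_real ((norm x)\<^sup>2)"
proof -
  have "Im (cip x x) = 0"
    by (simp add: cip_def)
  moreover have "Re (cip x x) = (norm x)\<^sup>2"
    by (simp add: Re_cip power2_norm_eq_inner)
  ultimately show ?thesis
    by (simp add: complex_eq_iff)
qed

lemma cip_self_eq_0 [simp]: "cip x x = 0 \<longleftrightarrow> x = 0"
  by (simp add: cip_self)

lemma cip_self_unit: "norm x = 1 \<Longrightarrow> cip x x = 1"
  by (simp add: cip_self)

lemma norm_eq_1_cip: "norm x = 1 \<longleftrightarrow> cip x x = 1"
proof
  assume "cip x x = 1"
  then have "(norm x)\<^sup>2 = 1"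
    by (metis cip_self of_real_eq_1_iff)
  then show "norm x = 1"
    by (simp add: power2_eq_1_iff) (metis norm_ge_zero neg_0_le_iff_le not_one_le_zero)
qed (rule cip_self_unit)

lemma cip_zero_all: "(\<And>y. cip y x = 0) \<Longrightarrow> x = 0"
  using cip_self_eq_0 by blast

section \<open>Adjoints, Hermitian matrices and their quadratic forms\<close>

lemma cadj_nth [simp]: "cadj A $ i $ j = cnj (A $ j $ i)"
  by (simp add: cadj_def)

lemma cadj_cadj [simp]: "cadj (cadj A) = A"
  by (simp add: vec_eq_iff)

lemma cadj_add: "cadj (A + B) = cadj A + cadj B"
  and cadj_diff: "cadj (A - B) = cadj A - cadj B"
  and cadj_minus: "cadj (- A) = - cadj A"
  and cadj_scaleR: "cadj (r *\<^sub>R A) = r *\<^sub>R cadj A"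
  and cadj_zero: "cadj 0 = 0"
  by (simp_all add: vec_eq_iff)

lemma cadj_mat1: "cadj (mat 1) = mat 1"
  by (simp add: vec_eq_iff mat_def)

lemma cadj_mult: "cadj (A ** B) = cadj B ** cadj A"
  by (simp add: vec_eq_iff matrix_matrix_mult_def mult.commute)

lemma cip_mult_right: "cip x (A *v y) = cip (cadj A *v x) y"
  unfolding cip_def matrix_vector_mult_def
  by (simp add: sum_distrib_left sum_distrib_right, subst sum.swap, simp add: mult_ac)

lemma matrix_diff_ldistrib: "(A :: complex^'n^'n) ** (B - C) = A ** B - A ** C"
  and matrix_diff_rdistrib: "(B - C) ** (A :: complex^'n^'n) = B ** A - C ** A"
  and matrix_minus_left: "(- B) ** (A :: complex^'n^'n) = - (B ** A)"
  and matrix_minus_right: "B ** (- A :: complex^'n^'n) = - (B ** A)"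
  and matrix_scaleR_left: "(r *\<^sub>R B) ** (A :: complex^'n^'n) = r *\<^sub>R (B ** A)"
  and matrix_scaleR_right: "B ** (r *\<^sub>R A :: complex^'n^'n) = r *\<^sub>R (B ** A)"
  and matrix_zero_left: "0 ** (A :: complex^'n^'n) = 0"
  and matrix_zero_right: "(A :: complex^'n^'n) ** 0 = 0"
  by (simp_all add: vec_eq_iff matrix_matrix_mult_def sum_subtractf sum_negf scaleR_sum_right algebra_simps)

lemma matrix_add_rdistrib: "(B + C) ** (A :: complex^'n^'n) = B ** A + C ** A"
  by (simp add: vec_eq_iff matrix_matrix_mult_def sum.distrib algebra_simps)

lemma matrix_sum_left: "(\<Sum>i\<in>S. f i) ** (A :: complex^'n^'n) = (\<Sum>i\<in>S. f i ** A)"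
  by (induction S rule: infinite_finite_induct) (auto simp: matrix_add_rdistrib matrix_zero_left)

lemma matrix_sum_right: "(A :: complex^'n^'n) ** (\<Sum>i\<in>S. f i) = (\<Sum>i\<in>S. A ** f i)"
  by (induction S rule: infinite_finite_induct) (auto simp: matrix_add_ldistrib matrix_zero_right)

lemma matvec_sum_left: "(\<Sum>i\<in>S. f i) *v (x :: complex^'n) = (\<Sum>i\<in>S. f i *v x)"
  by (induction S rule: infinite_finite_induct) (auto simp: matrix_vector_mult_add_rdistrib)

lemma matvec_scaleR_left: "(r *\<^sub>R A) *v (x :: complex^'n) = r *\<^sub>R (A *v x)"
  and matvec_minus_left: "(- A) *v (x :: complex^'n) = - (A *v x)"
  and matvec_smult_right: "A *v (c *s (x :: complex^'n)) = c *s (A *v x)"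
  and matvec_scaleR_right: "A *v (r *\<^sub>R (x :: complex^'n)) = r *\<^sub>R (A *v x)"
  by (simp_all add: vec_eq_iff matrix_vector_mult_def sum_negf scaleR_sum_right sum_distrib_left algebra_simps)

lemmas mm_simps = matrix_add_ldistrib matrix_add_rdistrib matrix_diff_ldistrib matrix_diff_rdistrib
  matrix_minus_left matrix_minus_right matrix_scaleR_left matrix_scaleR_right
  matrix_zero_left matrix_zero_right

lemmas mv_simps = matrix_vector_right_distrib matrix_vector_mult_diff_distrib
  matrix_vector_mult_add_rdistrib matrix_vector_mult_diff_rdistrib
  matvec_scaleR_left matvec_minus_left matvec_smult_right matvec_scaleR_right

lemma matrix_eq_matvec: "(\<And>x. A *v x = B *v x) \<Longrightarrow> A = (B :: complex^'n^'n)"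
  by (simp add: matrix_eq)

lemma outer_nth: "outer x $ i $ j = x $ i * cnj (x $ j)"
  by (simp add: outer_def)

lemma outer_matvec: "outer x *v y = cip x y *s x"
  by (simp add: vec_eq_iff outer_def matrix_vector_mult_def cip_def sum_distrib_left sum_distrib_right mult_ac)

lemma cadj_outer [simp]: "cadj (outer x) = outer x"
  by (simp add: vec_eq_iff outer_def)

lemma conj_outer: "A ** outer x ** cadj A = outer (A *v x)"
proof (rule matrix_eq_matvec)
  fix y
  show "A ** outer x ** cadj A *v y = outer (A *v x) *v y"
    by (simp add: matrix_vector_mul_assoc[symmetric] outer_matvec matvec_smult_right cip_mult_right)
qed

lemma outer_smult: "outer (c *s x) = (cmod c)\<^sup>2 *\<^sub>R outer x"
proof -
  have "c * a * (cnj c * b) = (cmod c)\<^sup>2 *\<^sub>R (a * b)" for a b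
  proof -
    have "c * a * (cnj c * b) = (c * cnj c) * (a * b)" by (simp add: mult_ac)
    also have "c * cnj c = of_real ((cmod c)\<^sup>2)" by (rule complex_norm_square[symmetric])
    finally show ?thesis by (simp add: scaleR_conv_of_real)
  qed
  then show ?thesis
    by (simp add: vec_eq_iff outer_def)
qed

lemma outer_scaleR: "outer (r *\<^sub>R x) = r\<^sup>2 *\<^sub>R outer x"
  by (simp add: scaleR_eq_smult outer_smult)

lemma outer_0 [simp]: "outer 0 = 0"
  by (simp add: vec_eq_iff outer_def)

lemma trace_outer: "trace (outer x) = cip x x"
  by (simp add: trace_def outer_def cip_def mult.commute)

lemma trace_mult_outer: "trace (A ** outer x) = cip x (A *v x)"
  unfolding trace_def matrix_matrix_mult_def outer_def cip_def matrix_vector_mult_def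
  by (simp add: sum_distrib_left sum_distrib_right mult_ac)

lemma inner_eq_trace: "A \<bullet> B = Re (trace (cadj A ** B))"
proof -
  have "A \<bullet> B = (\<Sum>i\<in>UNIV. \<Sum>j\<in>UNIV. Re (cnj (A $ i $ j) * B $ i $ j))"
    by (simp add: inner_vec_def inner_complex_def)
  also have "\<dots> = (\<Sum>j\<in>UNIV. \<Sum>i\<in>UNIV. Re (cnj (A $ i $ j) * B $ i $ j))"
    by (rule sum.swap)
  also have "\<dots> = Re (trace (cadj A ** B))"
    by (simp add: trace_def matrix_matrix_mult_def)
  finally show ?thesis .
qed

lemma hermD: "A \<in> herm \<Longrightarrow> cadj A = A"
  by (simp add: herm_def)

lemma herm_nth: "A \<in> herm \<Longrightarrow> cnj (A $ i $ j) = A $ j $ i"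
  by (metis cadj_nth hermD)

lemma herm_inner: "A \<in> herm \<Longrightarrow> A \<bullet> B = Re (trace (A ** B))"
  by (simp add: inner_eq_trace hermD)

lemma herm_add: "A \<in> herm \<Longrightarrow> B \<in> herm \<Longrightarrow> A + B \<in> herm"
  and herm_diff: "A \<in> herm \<Longrightarrow> B \<in> herm \<Longrightarrow> A - B \<in> herm"
  and herm_minus: "A \<in> herm \<Longrightarrow> - A \<in> herm"
  and herm_scaleR: "A \<in> herm \<Longrightarrow> r *\<^sub>R A \<in> herm"
  and herm_0: "0 \<in> herm"
  and herm_mat1: "mat 1 \<in> herm"
  and herm_outer: "outer x \<in> herm"
  by (simp_all add: herm_def cadj_add cadj_diff cadj_minus cadj_scaleR cadj_zero cadj_mat1)

lemmas herm_intros = herm_add herm_diff herm_minus herm_scaleR herm_0 herm_mat1 herm_outer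

lemma herm_conj: "A \<in> herm \<Longrightarrow> B ** A ** cadj B \<in> herm"
  by (simp add: herm_def cadj_mult matrix_mul_assoc)

lemma herm_sandwich: "P \<in> herm \<Longrightarrow> A \<in> herm \<Longrightarrow> P ** A ** P \<in> herm"
  using herm_conj[of A P] by (simp add: hermD)

lemma herm_cip: "A \<in> herm \<Longrightarrow> cip x (A *v y) = cip (A *v x) y"
  by (simp add: cip_mult_right hermD)

lemma qf_of_real: "A \<in> herm \<Longrightarrow> cip x (A *v x) = of_real (qf A x)"
  unfolding qf_def
  by (metis Reals_cnj_iff cnj_cip herm_cip of_real_Re)

lemma qf_add: "qf (A + B) x = qf A x + qf B x"
  and qf_diff: "qf (A - B) x = qf A x - qf B x"
  and qf_minus: "qf (- A) x = - qf A x"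
  and qf_scaleR: "qf (r *\<^sub>R A) x = r * qf A x"
  and qf_scaleR_vec: "qf A (r *\<^sub>R x) = r\<^sup>2 * qf A x"
  and qf_mat1: "qf (mat 1) x = (norm x)\<^sup>2"
  by (simp_all add: qf_def mv_simps cip_simps cip_self power2_eq_square)

lemma qf_smult_vec: "qf A (c *s x) = (cmod c)\<^sup>2 * qf A x"
proof -
  have "cip (c *s x) (A *v (c *s x)) = (c * cnj c) * cip x (A *v x)"
    by (simp add: mv_simps cip_simps mult_ac)
  also have "c * cnj c = of_real ((cmod c)\<^sup>2)" by (rule complex_norm_square[symmetric])
  finally show ?thesis by (simp add: qf_def)
qed

lemma qf_outer: "qf (outer x) y = (cmod (cip x y))\<^sup>2"
proof -
  have "cip y (outer x *v y) = cip x y * cnj (cip x y)"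
    by (simp add: outer_matvec cip_simps cnj_cip)
  then show ?thesis
    by (simp add: qf_def flip: complex_norm_square)
qed

lemmas qf_simps = qf_add qf_diff qf_minus qf_scaleR qf_mat1 qf_outer

lemma qf_sum: "qf (\<Sum>i\<in>S. f i) x = (\<Sum>i\<in>S. qf (f i) x)"
  by (induction S rule: infinite_finite_induct) (auto simp: qf_add, auto simp: qf_def)

lemma inner_outer: "A \<in> herm \<Longrightarrow> A \<bullet> outer x = qf A x"
  by (simp add: herm_inner trace_mult_outer qf_def)

text \<open>Polarisation: testing the difference on \<open>x + y\<close> and on
  \<open>x + i y\<close> gives the sum and the difference of the two cross terms, so both
  vanish.\<close>

lemma herm_eqI:
  assumes "A \<in> herm" "B \<in> herm" "\<And>x. qf A x = qf B x"
  shows "A = B"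
proof -
  define M where "M = A - B"
  have M: "M \<in> herm" "\<And>x. cip x (M *v x) = 0"
    using assms qf_of_real[of M] by (auto simp: M_def herm_intros qf_diff)
  have "cip x (M *v y) = 0" for x y
  proof -
    have a: "cip x (M *v y) + cip y (M *v x) = 0"
      using M(2)[of "x + y"] M(2)[of x] M(2)[of y] by (simp add: mv_simps cip_simps add.commute)
    have "\<i> * cip x (M *v y) - \<i> * cip y (M *v x) = 0"
      using M(2)[of "x + \<i> *s y"] M(2)[of x] M(2)[of y] by (simp add: mv_simps cip_simps)
    then have "cip x (M *v y) = cip y (M *v x)" by simp
    with a show ?thesis by simp
  qed
  then have "M *v y = 0 *v y" for y
    using cip_zero_all by (metis matrix_vector_mult_0)
  then have "M = 0" by (intro matrix_eq_matvec) simp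
  then show ?thesis by (simp add: M_def)
qed

lemma trace_scaleR: "trace (r *\<^sub>R (A :: complex^'n^'n)) = of_real r * trace A"
  by (simp add: trace_def sum_distrib_left scaleR_conv_of_real[where 'a = complex])

lemma trace_mat1: "trace (mat 1 :: complex^'n^'n) = of_nat CARD('n)"
  by (simp add: trace_I)

lemma trace_sum: "trace (\<Sum>i\<in>S. f i) = (\<Sum>i\<in>S. trace (f i :: complex^'n^'n))"
  by (induction S rule: infinite_finite_induct) (auto simp: trace_add trace_0[unfolded mat_0])

lemma trace_herm_real: "A \<in> herm \<Longrightarrow> trace A = of_real (Re (trace A))"
proof -
  assume "A \<in> herm"
  then have "cnj (trace A) = trace A"
    by (simp add: trace_def herm_nth)
  then show ?thesis by (metis Reals_cnj_iff of_real_Re)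
qed

lemma inner_mat1: "A \<in> herm \<Longrightarrow> A \<bullet> mat 1 = Re (trace A)"
  by (simp add: herm_inner)

section \<open>Orthonormal bases and projections\<close>

lemma cip_nonzero_normalize:
  assumes "x \<noteq> (0 :: complex^'n)"
  obtains r where "norm (r *\<^sub>R x) = 1" "r > 0"
  using that[of "1 / norm x"] assms by simp

text \<open>A real dimension count: being orthogonal in the Euclidean sense to both
  \<open>v i\<close> and its multiple by the imaginary unit is complex orthogonality, and these
  vectors span at most 2 |S| < 2n real dimensions.\<close>

lemma exists_unit_orthogonal:
  fixes v :: "'i \<Rightarrow> complex^'n"
  assumes S: "finite S" "card S < CARD('n)"
  obtains w where "norm w = 1" "\<And>i. i \<in> S \<Longrightarrow> cip (v i) w = 0"
proof -
  define X where "X = v ` S \<union> (\<lambda>i. \<i> *s v i) ` S"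
  have "card X \<le> 2 * card S"
    unfolding X_def
    using card_Un_le[of "v ` S" "(\<lambda>i. \<i> *s v i) ` S"] card_image_le[OF S(1), of v]
      card_image_le[OF S(1), of "\<lambda>i. \<i> *s v i"] by linarith
  moreover have "dim X \<le> card X"
    using S(1) by (intro dim_le_card) (auto simp: X_def span_base)
  ultimately have "dim X < DIM(complex^'n)"
    using S(2) by simp
  then obtain w where w: "w \<noteq> 0" "\<And>y. y \<in> span X \<Longrightarrow> orthogonal w y"
    using orthogonal_to_subspace_exists by blast
  have "cip (v i) w = 0" if "i \<in> S" for i
  proof -
    have "Re (cip w (v i)) = 0" "Re (cip w (\<i> *s v i)) = 0"
      using w(2)[of "v i"] w(2)[of "\<i> *s v i"] that
      by (auto simp: X_def span_base orthogonal_def Re_cip)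
    then have "cip w (v i) = 0"
      by (simp add: cip_smult_right complex_eq_iff)
    then show ?thesis by (simp add: cip_eq_0_commute)
  qed
  moreover obtain r where "norm (r *\<^sub>R w) = 1" "r > 0"
    using cip_nonzero_normalize w(1) by blast
  ultimately show ?thesis
    by (intro that[of "r *\<^sub>R w"]) (simp_all add: cip_scaleR_right)
qed

text \<open>Partial families are indexed by subsets of the coordinate type, so that extending one to
  all indices yields an \<open>onb\<close> without reindexing.\<close>

definition ortho_on :: "'n set \<Rightarrow> ('n \<Rightarrow> complex^'n) \<Rightarrow> bool" where
  "ortho_on S u \<longleftrightarrow> (\<forall>i\<in>S. \<forall>j\<in>S. cip (u i) (u j) = (if i = j then 1 else 0))"

lemma onb_iff_ortho_on: "onb u \<longleftrightarrow> ortho_on UNIV u"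
  by (simp add: onb_def ortho_on_def)

lemma ortho_on_insert:
  assumes "ortho_on S u" "i \<notin> S" "norm w = 1" "\<And>j. j \<in> S \<Longrightarrow> cip (u j) w = 0"
  shows "ortho_on (insert i S) (u(i := w))"
proof -
  have "cip w (u j) = 0" if "j \<in> S" for j
    using assms(4)[OF that] by (simp add: cip_eq_0_commute[of w])
  with assms show ?thesis
    by (auto simp: ortho_on_def cip_self_unit)
qed

lemma ortho_on_extend:
  fixes u :: "'n \<Rightarrow> complex^'n"
  assumes "ortho_on S u"
  obtains u' where "onb u'" "\<And>i. i \<in> S \<Longrightarrow> u' i = u i"
proof -
  have "\<exists>u'. onb u' \<and> (\<forall>i\<in>S. u' i = u i)"
    using assms
  proof (induction "card (- S)" arbitrary: S u)
    case 0
    then have "S = UNIV" by (metis Compl_empty_eq card_eq_0_iff double_compl finite)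
    with 0 show ?case by (auto simp: onb_iff_ortho_on)
  next
    case (Suc m)
    then have "S \<noteq> UNIV" by auto
    then obtain i where i: "i \<notin> S" by auto
    then have "card S < CARD('n)"
      by (intro psubset_card_mono) auto
    then obtain w where w: "norm w = 1" "\<And>j. j \<in> S \<Longrightarrow> cip (u j) w = 0"
      using exists_unit_orthogonal[of S u] by auto
    have "- insert i S = - S - {i}" by auto
    then have "m = card (- insert i S)"
      using Suc.hyps(2) i by simp
    from Suc.hyps(1)[OF this ortho_on_insert[OF Suc.prems i w]]
    obtain u' where "onb u'" "\<forall>j\<in>insert i S. u' j = (u(i := w)) j" by auto
    with i show ?case by (intro exI[of _ u']) auto
  qed
  then show ?thesis using that by blast
qed

lemma onb_norm: "onb u \<Longrightarrow> norm (u i) = 1"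
  by (simp add: onb_def norm_eq_1_cip)

lemma onb_contains:
  assumes "norm x = 1"
  obtains u :: "'n \<Rightarrow> complex^'n" where "onb u" "u i = x"
proof -
  have "ortho_on {i} (\<lambda>_. x)" using assms by (simp add: ortho_on_def cip_self_unit)
  then show ?thesis by (rule ortho_on_extend) (use that in auto)
qed

lemma onb_contains2:
  assumes "norm x = 1" "norm y = 1" "cip x y = 0" "i \<noteq> j"
  obtains u :: "'n \<Rightarrow> complex^'n" where "onb u" "u i = x" "u j = y"
proof -
  have "ortho_on {i, j} (\<lambda>l. if l = i then x else y)"
    using assms cip_eq_0_commute[of x y] by (auto simp: ortho_on_def cip_self_unit)
  then show ?thesis by (rule ortho_on_extend) (use that assms in auto)
qed

lemma unitary_matD:
  assumes "unitary_mat U"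
  shows "cadj U ** U = mat 1" "U ** cadj U = mat 1"
  using assms by (simp_all add: unitary_mat_def matrix_left_right_inverse[of U])

lemma unitary_cadj: "unitary_mat U \<Longrightarrow> unitary_mat (cadj U)"
  using unitary_matD(2)[of U] by (simp add: unitary_mat_def)

lemma unitary_mult: "unitary_mat U \<Longrightarrow> unitary_mat V \<Longrightarrow> unitary_mat (U ** V)"
proof -
  assume "unitary_mat U" "unitary_mat V"
  then have "cadj (U ** V) ** (U ** V) = cadj V ** (cadj U ** U) ** V"
    by (simp add: cadj_mult matrix_mul_assoc)
  with \<open>unitary_mat U\<close> \<open>unitary_mat V\<close> show ?thesis
    by (simp add: unitary_mat_def)
qed

lemma colmat_unitary: "onb u \<Longrightarrow> unitary_mat (colmat u)"
  unfolding unitary_mat_def onb_def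
  by (simp add: vec_eq_iff matrix_matrix_mult_def colmat_def cip_def mat_def)

lemma cip_axis: "cip (axis i 1) x = x $ i"
proof -
  have "cip (axis i 1) x = (\<Sum>j\<in>UNIV. if j = i then x $ j else 0)"
    unfolding cip_def by (rule sum.cong) (auto simp: axis_def)
  then show ?thesis by simp
qed

lemma colmat_axis: "colmat u *v axis i 1 = u i"
proof -
  have "(\<Sum>j\<in>UNIV. u j $ l * axis i 1 $ j) = (\<Sum>j\<in>UNIV. if j = i then u j $ l else 0)" for l
    by (rule sum.cong) (auto simp: axis_def)
  then show ?thesis
    by (simp add: colmat_def matrix_vector_mult_def vec_eq_iff)
qed

lemma sum_outer_axis: "(\<Sum>i\<in>UNIV. outer (axis i 1)) = (mat 1 :: complex^'n^'n)"
  by (intro matrix_eq_matvec) (simp add: matvec_sum_left outer_matvec cip_axis basis_expansion)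

lemma sum_outer_onb: 
  assumes "onb u" shows "(\<Sum>i\<in>UNIV. outer (u i)) = mat 1"
proof -
  let ?U = "colmat u"
  have "(\<Sum>i\<in>UNIV. outer (u i)) = (\<Sum>i\<in>UNIV. ?U ** outer (axis i 1) ** cadj ?U)"
    by (simp add: conj_outer colmat_axis)
  also have "\<dots> = ?U ** (\<Sum>i\<in>UNIV. outer (axis i 1)) ** cadj ?U"
    by (simp add: matrix_sum_left matrix_sum_right)
  finally show ?thesis
    using unitary_matD(2)[OF colmat_unitary[OF assms]] by (simp add: sum_outer_axis)
qed

section \<open>Projections of rank \<open>k\<close>\<close>

definition proj :: "nat \<Rightarrow> (complex^'n^'n) set" where
  "proj k = {P. cadj P = P \<and> P ** P = P \<and> trace P = of_nat k}"

lemma projD: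
  assumes "P \<in> proj k"
  shows "P \<in> herm" "cadj P = P" "P ** P = P" "trace P = of_nat k"
  using assms by (simp_all add: proj_def herm_def)

lemma proj_inner_self: "P \<in> proj k \<Longrightarrow> P \<bullet> P = k"
  by (simp add: herm_inner projD)

lemma outer_idem: "norm x = 1 \<Longrightarrow> outer x ** outer x = outer x"
  by (intro matrix_eq_matvec)
    (simp add: outer_matvec cip_self_unit cip_smult_right flip: matrix_vector_mul_assoc)

lemma matrix_mult_outer_eq_0: "(A :: complex^'n^'n) *v x = 0 \<Longrightarrow> A ** outer x = 0"
  by (intro matrix_eq_matvec) (simp add: outer_matvec matvec_smult_right flip: matrix_vector_mul_assoc)

lemma matrix_mult_outer_fix: "(A :: complex^'n^'n) *v x = x \<Longrightarrow> A ** outer x = outer x"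
  by (intro matrix_eq_matvec) (simp add: outer_matvec matvec_smult_right flip: matrix_vector_mul_assoc)

lemma outer_mult_herm: "A \<in> herm \<Longrightarrow> outer x ** A = cadj (A ** outer x)"
  by (simp add: cadj_mult hermD)

lemma proj_add_outer:
  assumes P: "P \<in> proj k" and x: "norm x = 1" "P *v x = 0"
  shows "P + outer x \<in> proj (Suc k)"
proof -
  have "P ** outer x = 0" "outer x ** P = 0"
    using x P by (simp_all add: matrix_mult_outer_eq_0 outer_mult_herm projD cadj_zero)
  then show ?thesis
    using P x by (simp add: proj_def cadj_add mm_simps outer_idem trace_add trace_outer cip_self_unit)
qed

lemma proj_diff_outer:
  assumes P: "P \<in> proj (Suc k)" and x: "norm x = 1" "P *v x = x"
  shows "P - outer x \<in> proj k"
proof -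
  have "P ** outer x = outer x" "outer x ** P = outer x"
    using x P by (simp_all add: matrix_mult_outer_fix outer_mult_herm projD)
  then show ?thesis
    using P x by (simp add: proj_def cadj_diff mm_simps outer_idem trace_sub trace_outer cip_self_unit)
qed

lemma proj_zero: "0 \<in> proj 0"
  by (simp add: proj_def cadj_zero trace_0[unfolded mat_0])

lemma proj_sum_outer:
  assumes "ortho_on S u"
  shows "(\<Sum>i\<in>S. outer (u i)) \<in> proj (card S)"
proof -
  have "finite S" by simp
  then show ?thesis using assms
  proof (induction S rule: finite_induct)
    case empty
    then show ?case by (simp add: proj_zero)
  next
    case (insert i S)
    have o: "ortho_on S u" using insert.prems by (simp add: ortho_on_def)
    have "norm (u i) = 1" using insert.prems by (simp add: ortho_on_def norm_eq_1_cip)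
    moreover have "(\<Sum>j\<in>S. outer (u j)) *v u i = 0"
      using insert by (auto simp: matvec_sum_left outer_matvec ortho_on_def intro!: sum.neutral)
    ultimately show ?case
      using proj_add_outer[OF insert.IH[OF o]] insert.hyps by (simp add: add.commute)
  qed
qed

lemma onb_ortho_on: "onb u \<Longrightarrow> ortho_on S u"
  by (simp add: onb_def ortho_on_def)

lemma onb_sum_outer_matvec:
  assumes "onb u" shows "(\<Sum>i\<in>S. outer (u i)) *v u j = (if j \<in> S then u j else 0)"
proof -
  have "(\<Sum>i\<in>S. outer (u i)) *v u j = (\<Sum>i\<in>S. if i = j then u j else 0)"
    unfolding matvec_sum_left by (rule sum.cong) (use assms in \<open>auto simp: outer_matvec onb_def\<close>)
  then show ?thesis by simp
qed

text \<open>Take a maximal orthonormal family fixed by \<open>P\<close> and extend it to a basis. If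
  \<open>P\<close> did not kill one of the new vectors, its normalised image would be fixed by
  \<open>P\<close> and orthogonal to the family, contradicting maximality.\<close>

lemma proj_structure:
  fixes P :: "complex^'n^'n"
  assumes P: "P \<in> proj k"
  obtains u S where "onb u" "card S = k" "P = (\<Sum>i\<in>S. outer (u i))"
proof -
  define Q where "Q = (\<lambda>m. \<exists>S u. card S = m \<and> ortho_on S u \<and> (\<forall>i\<in>S. P *v u i = u i))"
  have "Q 0" unfolding Q_def by (rule exI[of _ "{}"]) (simp add: ortho_on_def)
  moreover have "\<forall>m. Q m \<longrightarrow> m \<le> CARD('n)"
    by (auto simp: Q_def intro: card_mono)
  ultimately obtain m where m: "Q m" "\<forall>m'. Q m' \<longrightarrow> m' \<le> m"
    using Nat.ex_has_greatest_nat[of Q 0 "CARD('n)"] by blast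
  obtain S u where S: "card S = m" "ortho_on S u" "\<And>i. i \<in> S \<Longrightarrow> P *v u i = u i"
    using m(1) unfolding Q_def by blast
  obtain u' where u': "onb u'" "\<And>i. i \<in> S \<Longrightarrow> u' i = u i"
    using ortho_on_extend[OF S(2)] by blast
  have fx: "P *v u' i = u' i" if "i \<in> S" for i using that S(3) u'(2) by simp
  have ker: "P *v u' i = 0" if i: "i \<notin> S" for i
  proof (rule ccontr)
    assume "P *v u' i \<noteq> 0"
    then obtain r where r: "norm (r *\<^sub>R (P *v u' i)) = 1" "r > 0"
      using cip_nonzero_normalize by blast
    let ?w = "r *\<^sub>R (P *v u' i)"
    have "cip (u' j) ?w = 0" if "j \<in> S" for j
      using fx[OF that] that i u'(1)
      by (auto simp: cip_scaleR_right herm_cip projD[OF P] onb_def)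
    from ortho_on_insert[OF onb_ortho_on[OF u'(1)] i r(1) this]
    have "ortho_on (insert i S) (u'(i := ?w))" .
    moreover have "P *v ?w = ?w"
      by (simp add: matvec_scaleR_right matrix_vector_mul_assoc projD[OF P])
    ultimately have "Q (Suc m)"
      unfolding Q_def using i S(1) fx
      by (intro exI[of _ "insert i S"] exI[of _ "u'(i := ?w)"]) auto
    with m(2) show False by fastforce
  qed
  have "P = P ** (\<Sum>i\<in>UNIV. outer (u' i))"
    by (simp add: sum_outer_onb[OF u'(1)])
  also have "\<dots> = (\<Sum>i\<in>UNIV. if i \<in> S then outer (u' i) else 0)"
    unfolding matrix_sum_right
    by (intro sum.cong) (simp_all add: fx ker matrix_mult_outer_fix matrix_mult_outer_eq_0)
  also have "\<dots> = (\<Sum>i\<in>S. outer (u' i))"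
    by (simp add: sum.If_cases)
  finally have Peq: "P = (\<Sum>i\<in>S. outer (u' i))" .
  have "trace P = of_nat (card S)"
    using proj_sum_outer[OF onb_ortho_on[OF u'(1)], of S] projD(4) Peq by blast
  then have "card S = k" using projD(4)[OF P] by simp
  with u' Peq that show ?thesis by blast
qed

lemma proj_compl:
  fixes P :: "complex^'n^'n"
  assumes "P \<in> proj k" "k \<le> CARD('n)"
  shows "mat 1 - P \<in> proj (CARD('n) - k)"
  using assms by (simp add: proj_def cadj_diff cadj_mat1 mm_simps trace_sub trace_mat1)

lemma proj_unitary:
  assumes "unitary_mat W" "P \<in> proj k"
  shows "W ** P ** cadj W \<in> proj k"
proof -
  have "W ** P ** cadj W ** (W ** P ** cadj W) = W ** P ** (cadj W ** W) ** P ** cadj W"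
    by (simp add: matrix_mul_assoc)
  also have "\<dots> = W ** (P ** P) ** cadj W"
    by (simp add: unitary_matD[OF assms(1)] matrix_mul_assoc)
  finally have "W ** P ** cadj W ** (W ** P ** cadj W) = W ** P ** cadj W"
    by (simp add: projD[OF assms(2)])
  moreover have "trace (W ** P ** cadj W) = trace P"
    using trace_mul_sym[of "W ** P" "cadj W"]
    by (simp add: matrix_mul_assoc unitary_matD[OF assms(1)])
  moreover have "cadj (W ** P ** cadj W) = W ** P ** cadj W"
    by (simp add: cadj_mult projD[OF assms(2)] matrix_mul_assoc)
  ultimately show ?thesis
    using projD[OF assms(2)] by (simp add: proj_def)
qed

text \<open>The index sets describing \<open>P\<close> and \<open>Q\<close> need not coincide, so
  one basis is first permuted to match them and their complements; then \<open>W\<close> sends one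
  basis to the other.\<close>

lemma proj_conj_exists:
  fixes P Q :: "complex^'n^'n"
  assumes P: "P \<in> proj k" and Q: "Q \<in> proj k"
  obtains W where "unitary_mat W" "Q = W ** P ** cadj W"
proof -
  obtain u S where u: "onb u" "card S = k" "P = (\<Sum>i\<in>S. outer (u i))"
    using proj_structure[OF P] by blast
  obtain v S' where v: "onb v" "card S' = k" "Q = (\<Sum>i\<in>S'. outer (v i))"
    using proj_structure[OF Q] by blast
  have "card (- S) = card (- S')"
    using u(2) v(2) by (simp add: card_Diff_subset Compl_eq_Diff_UNIV)
  then obtain f g where "bij_betw f S S'" "bij_betw g (- S) (- S')"
    using u(2) v(2) finite_same_card_bij[of S S'] finite_same_card_bij[of "- S" "- S'"] by auto
  moreover define p where "p = (\<lambda>i. if i \<in> S then f i else g i)"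
  ultimately have pS: "bij_betw p S S'" and pS': "bij_betw p (- S) (- S')"
    using bij_betw_cong[of S f p] bij_betw_cong[of "- S" g p] by auto
  have "bij_betw p (S \<union> - S) (S' \<union> - S')"
    by (rule bij_betw_combine[OF pS pS']) auto
  then have p: "bij p" by simp
  define w where "w = v \<circ> p"
  have w: "onb w"
    using v(1) bij_is_inj[OF p] by (auto simp: onb_def w_def inj_def)
  have Q': "Q = (\<Sum>i\<in>S. outer (w i))"
    unfolding v(3) w_def using sum.reindex_bij_betw[OF pS, of "\<lambda>i. outer (v i)"] by simp
  define W where "W = colmat w ** cadj (colmat u)"
  have "cadj (colmat u) *v (colmat u *v axis i 1) = axis i 1" for i
    by (simp only: matrix_vector_mul_assoc unitary_matD[OF colmat_unitary[OF u(1)]]) simp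
  then have "W *v u i = w i" for i
    by (simp add: W_def colmat_axis flip: matrix_vector_mul_assoc)
  then have "W ** P ** cadj W = Q"
    by (simp add: u(3) Q' matrix_sum_left matrix_sum_right conj_outer)
  then show ?thesis
    by (intro that[of W])
      (simp_all add: W_def unitary_mult unitary_cadj colmat_unitary u(1) w)
qed

lemma proj_contains:
  fixes x :: "complex^'n"
  assumes "norm x = 1" "1 \<le> k" "k \<le> CARD('n)"
  obtains P where "P \<in> proj k" "P *v x = x"
proof -
  obtain i :: 'n where True by simp
  obtain u where u: "onb u" "u i = x" using onb_contains[OF assms(1)] by blast
  obtain S where S: "{i} \<subseteq> S" "card S = k"
    using exists_subset_between[of "{i}" k "UNIV :: 'n set"] assms by auto
  show ?thesis
  proof (rule that)
    show "(\<Sum>i\<in>S. outer (u i)) \<in> proj k"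
      using proj_sum_outer[OF onb_ortho_on[OF u(1)], of S] S by simp
    show "(\<Sum>i\<in>S. outer (u i)) *v x = x"
      using onb_sum_outer_matvec[OF u(1), of S i] S u(2) by simp
  qed
qed

lemma proj_nonempty: "k \<le> CARD('n) \<Longrightarrow> proj k \<noteq> ({} :: (complex^'n^'n) set)"
proof -
  assume "k \<le> CARD('n)"
  then obtain S :: "'n set" where S: "card S = k"
    using exists_subset_between[of "{}" k "UNIV :: 'n set"] by auto
  obtain u :: "'n \<Rightarrow> complex^'n" where "onb u"
    by (rule ortho_on_extend[of "{}"]) (auto simp: ortho_on_def)
  then show ?thesis using proj_sum_outer[OF onb_ortho_on, of u S] S by auto
qed

lemma proj_ran_ker:
  fixes P :: "complex^'n^'n"
  assumes "P \<in> proj k" "1 \<le> k" "k < CARD('n)"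
  obtains x y where "norm x = 1" "P *v x = x" "norm y = 1" "P *v y = 0"
proof -
  obtain u S where u: "onb u" "card S = k" "P = (\<Sum>i\<in>S. outer (u i))"
    using proj_structure[OF assms(1)] by blast
  have "S \<noteq> {}" "S \<noteq> UNIV" using u(2) assms by auto
  then obtain i j where "i \<in> S" "j \<notin> S" by auto
  then show ?thesis
    using that[of "u i" "u j"] onb_sum_outer_matvec[OF u(1), of S] u onb_norm[OF u(1)] by simp
qed

lemma continuous_cadj: "continuous_on UNIV (cadj :: complex^'n^'n \<Rightarrow> complex^'n^'n)"
  unfolding cadj_def by (intro continuous_intros)

lemma continuous_matrix_mult:
  fixes f g :: "'a::topological_space \<Rightarrow> complex^'n^'n"
  assumes "continuous_on S f" "continuous_on S g"
  shows "continuous_on S (\<lambda>x. f x ** g x)"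
  unfolding matrix_matrix_mult_def by (intro continuous_intros assms)

lemma compact_proj: "compact (proj k :: (complex^'n^'n) set)"
proof -
  have "norm P = sqrt k" if "P \<in> proj k" for P :: "complex^'n^'n"
    using proj_inner_self[OF that] by (simp add: norm_eq_sqrt_inner)
  then have "bounded (proj k :: (complex^'n^'n) set)"
    by (intro boundedI[of _ "sqrt k"]) simp
  moreover have "closed (proj k :: (complex^'n^'n) set)"
  proof -
    have t: "continuous_on UNIV (trace :: complex^'n^'n \<Rightarrow> complex)"
      unfolding trace_def by (intro continuous_intros)
    show ?thesis
      unfolding proj_def
      by (intro closed_Collect_conj closed_Collect_eq continuous_matrix_mult continuous_cadj t
          continuous_on_id continuous_on_const)
  qed
  ultimately show ?thesis by (simp add: compact_eq_bounded_closed)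
qed

section \<open>The k-numerical radius and the cones of common maximisers\<close>

text \<open>The trace of \<open>A ** P\<close> equals that of the Hermitian matrix
  \<open>P ** A ** P\<close> and is therefore real. This replaces complex moduli by absolute values
  of the real inner product from here on.\<close>

lemma knr_herm:
  assumes "A \<in> herm"
  shows "cmod ` knr k A = (\<lambda>P. \<bar>A \<bullet> P\<bar>) ` proj k"
proof -
  have "cmod (trace (A ** P)) = \<bar>A \<bullet> P\<bar>" if "P \<in> proj k" for P
  proof -
    have "trace (P ** A ** P) = trace (A ** P)"
      using trace_mul_sym[of "P ** A" P] trace_mul_sym[of P A]
      by (simp add: matrix_mul_assoc projD[OF that])
    then have "trace (A ** P) = of_real (A \<bullet> P)"
      using trace_herm_real[OF herm_sandwich[OF projD(1)[OF that] assms]]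
      by (simp add: herm_inner assms)
    then show ?thesis by (simp del: of_real_Re)
  qed
  moreover have "knr k A = (\<lambda>P. trace (A ** P)) ` proj k"
    by (auto simp: knr_def proj_def)
  ultimately show ?thesis
    by (simp add: image_image)
qed

context
  fixes A :: "complex^'n^'n" and k :: nat
  assumes A: "A \<in> herm" and k: "k \<le> CARD('n)"
begin

lemma kradius_attained: "\<exists>P\<in>proj k. \<bar>A \<bullet> P\<bar> = kradius k A \<and> (\<forall>R\<in>proj k. \<bar>A \<bullet> R\<bar> \<le> kradius k A)"
proof -
  have "continuous_on (proj k) (\<lambda>P. \<bar>A \<bullet> P\<bar>)"
    by (intro continuous_intros)
  then obtain P where P: "P \<in> proj k" "\<forall>R\<in>proj k. \<bar>A \<bullet> R\<bar> \<le> \<bar>A \<bullet> P\<bar>"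
    using continuous_attains_sup[OF compact_proj proj_nonempty[OF k]] by blast
  have "kradius k A = \<bar>A \<bullet> P\<bar>"
    unfolding kradius_def knr_herm[OF A]
    by (rule cSup_eq_maximum) (use P in auto)
  with P show ?thesis by auto
qed

lemma kradius_ge: "P \<in> proj k \<Longrightarrow> \<bar>A \<bullet> P\<bar> \<le> kradius k A"
  using kradius_attained by blast

lemma kradius_eqI:
  assumes "P \<in> proj k" "\<bar>A \<bullet> P\<bar> = r" "\<And>R. R \<in> proj k \<Longrightarrow> \<bar>A \<bullet> R\<bar> \<le> r"
  shows "kradius k A = r"
  using kradius_attained kradius_ge[OF assms(1)] assms by force

lemma kradius_nonneg: "0 \<le> kradius k A"
  using kradius_attained by (metis abs_ge_zero)

end

text \<open>At a projection attaining the radius of \<open>A + B\<close>, the two summands are each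
  bounded by their own radius, so equality forces both bounds to be attained with a common sign
  \<open>s\<close>.\<close>

lemma TEA_pair_iff:
  fixes A B :: "complex^'n^'n"
  assumes A: "A \<in> herm" and B: "B \<in> herm" and k: "k \<le> CARD('n)"
  shows "TEA_pair k A B \<longleftrightarrow> (\<exists>P\<in>proj k. \<exists>s\<in>{1, -1}. s * (A \<bullet> P) = kradius k A \<and> s * (B \<bullet> P) = kradius k B)"
    (is "_ \<longleftrightarrow> ?R")
proof
  assume T: "TEA_pair k A B"
  obtain P where P: "P \<in> proj k" "\<bar>(A + B) \<bullet> P\<bar> = kradius k (A + B)"
    using kradius_attained[OF herm_add[OF A B] k] by blast
  have "A \<bullet> P + B \<bullet> P = kradius k A + kradius k B \<or> - (A \<bullet> P + B \<bullet> P) = kradius k A + kradius k B"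
    using T P(2) by (auto simp: TEA_pair_def inner_add_left abs_if split: if_splits)
  moreover have "\<bar>A \<bullet> P\<bar> \<le> kradius k A" "\<bar>B \<bullet> P\<bar> \<le> kradius k B"
    using kradius_ge A B k P(1) by blast+
  ultimately have "(A \<bullet> P = kradius k A \<and> B \<bullet> P = kradius k B) \<or>
      (- (A \<bullet> P) = kradius k A \<and> - (B \<bullet> P) = kradius k B)"
    by (auto simp: abs_le_iff)
  with P(1) show ?R by (intro bexI[of _ P]) auto
next
  assume ?R
  then obtain P s where P: "P \<in> proj k" "s \<in> {1, -1 :: real}"
    "s * (A \<bullet> P) = kradius k A" "s * (B \<bullet> P) = kradius k B" by blast
  show "TEA_pair k A B"
    unfolding TEA_pair_def
  proof (rule kradius_eqI[OF herm_add[OF A B] k P(1)])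
    show "\<bar>(A + B) \<bullet> P\<bar> = kradius k A + kradius k B"
      using P kradius_nonneg[OF A k] kradius_nonneg[OF B k] by (auto simp: inner_add_left)
    show "\<bar>(A + B) \<bullet> R\<bar> \<le> kradius k A + kradius k B" if "R \<in> proj k" for R
      using kradius_ge[OF A k that] kradius_ge[OF B k that] by (simp add: inner_add_left)
  qed
qed

lemma kradius_minus: "A \<in> herm \<Longrightarrow> kradius k (- A) = kradius k A"
  unfolding kradius_def by (simp add: knr_herm herm_minus)

lemma kparallel_TEA:
  assumes "B \<in> herm"
  shows "kparallel k A B \<longleftrightarrow> TEA_pair k A B \<or> TEA_pair k A (- B)"
  by (auto simp: kparallel_def TEA_pair_def kradius_minus[OF assms])

text \<open>Allowing \<open>B\<close> or \<open>-B\<close> in the TEA condition decouples the two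
  signs, so only absolute values at a common projection remain.\<close>

lemma kparallel_iff:
  fixes A B :: "complex^'n^'n"
  assumes A: "A \<in> herm" and B: "B \<in> herm" and k: "k \<le> CARD('n)"
  shows "kparallel k A B \<longleftrightarrow> (\<exists>P\<in>proj k. \<bar>A \<bullet> P\<bar> = kradius k A \<and> \<bar>B \<bullet> P\<bar> = kradius k B)"
proof
  assume "kparallel k A B"
  then show "\<exists>P\<in>proj k. \<bar>A \<bullet> P\<bar> = kradius k A \<and> \<bar>B \<bullet> P\<bar> = kradius k B"
    unfolding kparallel_TEA[OF B] TEA_pair_iff[OF A B k] TEA_pair_iff[OF A herm_minus[OF B] k] kradius_minus[OF B]
    using kradius_nonneg[OF A k] kradius_nonneg[OF B k]
    by (elim disjE bexE conjE) (rule_tac x = P in bexI; auto)+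
next
  assume "\<exists>P\<in>proj k. \<bar>A \<bullet> P\<bar> = kradius k A \<and> \<bar>B \<bullet> P\<bar> = kradius k B"
  then obtain P where P: "P \<in> proj k" "\<bar>A \<bullet> P\<bar> = kradius k A" "\<bar>B \<bullet> P\<bar> = kradius k B" by blast
  then show "kparallel k A B"
    unfolding kparallel_TEA[OF B] TEA_pair_iff[OF A B k] TEA_pair_iff[OF A herm_minus[OF B] k] kradius_minus[OF B]
    by (cases "A \<bullet> P \<ge> 0"; cases "B \<bullet> P \<ge> 0") (auto simp: abs_if split: if_splits)
qed

section \<open>Positive semidefinite matrices\<close>

definition psd :: "complex^'n^'n \<Rightarrow> bool" where
  "psd Z \<longleftrightarrow> Z \<in> herm \<and> (\<forall>x. 0 \<le> qf Z x)"

lemma qf_sandwich: "R \<in> herm \<Longrightarrow> qf (R ** Z ** R) x = qf Z (R *v x)"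
  by (simp add: qf_def herm_cip[of R x] flip: matrix_vector_mul_assoc)

lemma psd_sandwich: "psd Z \<Longrightarrow> P \<in> herm \<Longrightarrow> psd (P ** Z ** P)"
  by (simp add: psd_def herm_sandwich qf_sandwich)

lemma psd_outer: "psd (outer x)"
  by (simp add: psd_def herm_outer qf_outer)

lemma psd_scaleR: "0 \<le> r \<Longrightarrow> psd Z \<Longrightarrow> psd (r *\<^sub>R Z)"
  by (simp add: psd_def herm_intros qf_scaleR)

lemma psd_zero: "psd 0"
  by (simp add: psd_def herm_0 qf_def)

lemma qf_proj:
  assumes "P \<in> proj k" shows "qf P x = (norm (P *v x))\<^sup>2"
proof -
  have "cip x (P *v x) = cip (P *v x) (P *v x)"
    by (simp add: herm_cip projD[OF assms] matrix_vector_mul_assoc)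
  then show ?thesis by (simp add: qf_def cip_self)
qed

lemma psd_proj: "P \<in> proj k \<Longrightarrow> psd P"
  by (simp add: psd_def projD qf_proj)

lemma qf_add_vec:
  assumes "A \<in> herm"
  shows "qf A (x + y) = qf A x + qf A y + 2 * Re (cip x (A *v y))"
proof -
  have "cip y (A *v x) = cnj (cip x (A *v y))"
    by (simp add: cnj_cip herm_cip[OF assms, of y])
  then show ?thesis
    by (simp add: qf_def mv_simps cip_simps)
qed

text \<open>The first-order optimality test. The step \<open>t\<close> is chosen with
  \<open>t * c = b / 2\<close> and \<open>c > \<bar>a\<bar>\<close>, so the quadratic term cannot
  absorb more than half of a positive linear term.\<close>

lemma nonneg_quadratic_linear_part:
  fixes a b :: real
  assumes "\<And>t. 0 < t \<Longrightarrow> t\<^sup>2 * a + t * b \<le> 0"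
  shows "b \<le> 0"
proof (rule ccontr)
  assume b: "\<not> b \<le> 0"
  define c where "c = \<bar>a\<bar> + 1"
  have c: "c > 0" by (simp add: c_def)
  define t where "t = b / 2 / c"
  have t: "t > 0" using b c by (simp add: t_def)
  have "t * (t * a + b) \<le> 0"
    using assms[OF t] by (simp add: power2_eq_square algebra_simps)
  then have "t * a + b \<le> 0" using t by (simp add: mult_le_0_iff)
  moreover have "t * c = b / 2"
    using c by (simp add: t_def)
  moreover have "t * (a + c) \<ge> 0" using t by (intro mult_nonneg_nonneg) (auto simp: c_def)
  then have "t * a + t * c \<ge> 0" by (simp add: distrib_left)
  ultimately show False using b by linarith
qed

text \<open>Moving from \<open>x\<close> in the direction \<open>- (Z *v x)\<close> lowers the form
  to first order by twice the squared norm of \<open>Z *v x\<close>; since zero is already the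
  minimum, that norm must vanish.\<close>

lemma psd_eq_0:
  assumes Z: "psd Z" and x: "qf Z x = 0"
  shows "Z *v x = 0"
proof -
  have h: "Z \<in> herm" using Z by (simp add: psd_def)
  let ?y = "Z *v x"
  have "t\<^sup>2 * (- qf Z ?y) + t * (2 * (norm ?y)\<^sup>2) \<le> 0" for t :: real
  proof -
    have "Re (cip x (Z *v (- t *\<^sub>R ?y))) = - t * (norm ?y)\<^sup>2"
      by (simp add: mv_simps cip_simps herm_cip[OF h, of x] cip_self)
    then have "qf Z (x + (- t *\<^sub>R ?y)) = t\<^sup>2 * qf Z ?y - t * (2 * (norm ?y)\<^sup>2)"
      unfolding qf_add_vec[OF h] qf_scaleR_vec x by simp
    moreover have "0 \<le> qf Z (x + (- t *\<^sub>R ?y))" using Z by (simp add: psd_def)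
    ultimately show ?thesis by simp
  qed
  from nonneg_quadratic_linear_part[OF this] show ?thesis by simp
qed

text \<open>Completing the square: the form of the remainder at \<open>x\<close> is the form of
  \<open>Z\<close> at \<open>x\<close> plus the optimal multiple of \<open>v\<close>, hence
  nonnegative. It serves to split a rank-one summand off a nonzero positive part.\<close>

lemma psd_split_outer:
  assumes Z: "psd Z" and v: "qf Z v > 0"
  shows "psd (Z - (1 / qf Z v) *\<^sub>R outer (Z *v v))"
proof -
  have h: "Z \<in> herm" using Z by (simp add: psd_def)
  let ?q = "qf Z v"
  have "0 \<le> qf (Z - (1 / ?q) *\<^sub>R outer (Z *v v)) x" for x
  proof -
    define b where "b = cip (Z *v v) x"
    have b: "cip x (Z *v v) = cnj b" by (simp add: b_def cnj_cip)
    have "cip x (Z *v (- (b / ?q) *s v)) = - (b * cnj b / ?q)"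
      by (simp only: mv_simps cip_simps b) simp
    then have "Re (cip x (Z *v (- (b / ?q) *s v))) = - ((cmod b)\<^sup>2 / ?q)"
      by (simp flip: complex_norm_square)
    moreover have "(cmod (- (b / ?q)))\<^sup>2 * ?q = (cmod b)\<^sup>2 / ?q"
      using v by (simp add: norm_divide power_divide power2_eq_square)
    ultimately have "qf Z (x + (- (b / ?q)) *s v) = qf Z x - (cmod b)\<^sup>2 / ?q"
      unfolding qf_add_vec[OF h] qf_smult_vec by simp
    moreover have "0 \<le> qf Z (x + (- (b / ?q)) *s v)" using Z by (simp add: psd_def)
    ultimately show ?thesis by (simp add: qf_simps b_def)
  qed
  then show ?thesis by (simp add: psd_def herm_intros h)
qed

lemma inner_sum_outer: "A \<in> herm \<Longrightarrow> A \<bullet> (\<Sum>i\<in>S. outer (u i)) = (\<Sum>i\<in>S. qf A (u i))"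
  by (simp add: inner_sum_right inner_outer)

lemma psd_inner_proj: "psd Z \<Longrightarrow> R \<in> proj k \<Longrightarrow> 0 \<le> Z \<bullet> R"
  by (erule proj_structure) (auto simp: inner_sum_outer psd_def sum_nonneg)

lemma mat1_inner_proj: "R \<in> proj k \<Longrightarrow> mat 1 \<bullet> R = k"
  by (simp add: herm_inner herm_mat1 projD)

lemma proj_inner_nonneg: "P \<in> proj k \<Longrightarrow> R \<in> proj k \<Longrightarrow> 0 \<le> P \<bullet> R"
  by (simp add: psd_inner_proj psd_proj)

lemma proj_dist: "P \<in> proj k \<Longrightarrow> R \<in> proj k \<Longrightarrow> (norm (P - R))\<^sup>2 = 2 * (k - P \<bullet> R)"
  by (simp add: power2_norm_eq_inner inner_diff inner_commute proj_inner_self)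

lemma proj_inner_le: "P \<in> proj k \<Longrightarrow> R \<in> proj k \<Longrightarrow> P \<bullet> R \<le> k"
  using proj_dist[of P k R] zero_le_power2[of "norm (P - R)"] by simp

lemma proj_inner_eq: "P \<in> proj k \<Longrightarrow> R \<in> proj k \<Longrightarrow> P \<bullet> R = k \<Longrightarrow> P = R"
  using proj_dist[of P k R] by simp

text \<open>Within the Hermitian matrices, this is the normal cone at \<open>P\<close> of the convex
  hull of the rank-\<open>k\<close> projections. There is no absolute value here; adding multiples
  of the identity provides the link to the radius.\<close>

definition opt_cone :: "nat \<Rightarrow> complex^'n^'n \<Rightarrow> (complex^'n^'n) set" where
  "opt_cone k P = {A \<in> herm. \<forall>R\<in>proj k. A \<bullet> R \<le> A \<bullet> P}"

lemma opt_coneD: "A \<in> opt_cone k P \<Longrightarrow> A \<in> herm" "A \<in> opt_cone k P \<Longrightarrow> R \<in> proj k \<Longrightarrow> A \<bullet> R \<le> A \<bullet> P"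
  by (simp_all add: opt_cone_def)

text \<open>Exchanging \<open>x\<close> for the normalised \<open>x + y\<close> gives another
  rank-\<open>k\<close> projection to compare with \<open>P\<close>. The length of \<open>y\<close>
  is left free so that it can serve as a small parameter.\<close>

lemma opt_cone_variation_aux:
  assumes A: "A \<in> opt_cone k P" and P: "P \<in> proj k" and k: "1 \<le> k"
    and x: "norm x = 1" "P *v x = x" and y: "P *v y = 0"
  shows "qf A (x + y) \<le> (1 + (norm y)\<^sup>2) * qf A x"
proof -
  note h = opt_coneD(1)[OF A]
  obtain m where m: "k = Suc m" using k by (cases k) auto
  have P0: "P - outer x \<in> proj m" using proj_diff_outer P x m by blast
  have "cip x y = 0"
    using herm_cip[OF projD(1)[OF P], of x y] x y by simp
  then have "x \<bullet> y = 0"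
    by (simp flip: Re_cip)
  then have n: "(norm (x + y))\<^sup>2 = 1 + (norm y)\<^sup>2"
    using x by (simp add: power2_norm_eq_inner inner_add inner_commute norm_eq_1)
  then have ne: "norm (x + y) > 0"
    by (smt (verit, best) norm_ge_zero zero_le_power2 power_zero_numeral)
  define z where "z = (1 / norm (x + y)) *\<^sub>R (x + y)"
  have z: "norm z = 1" using ne by (simp add: z_def)
  have "(P - outer x) *v (x + y) = 0"
    using x y \<open>cip x y = 0\<close> by (simp add: mv_simps outer_matvec cip_self_unit)
  then have "(P - outer x) *v z = 0"
    by (simp add: z_def matvec_scaleR_right)
  then have "P - outer x + outer z \<in> proj k"
    using proj_add_outer[OF P0 z] m by simp
  then have "qf A z \<le> qf A x"
    using opt_coneD(2)[OF A] by (fastforce simp: inner_add_right inner_diff_right inner_outer h)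
  then have "(norm (x + y))\<^sup>2 * qf A z \<le> (norm (x + y))\<^sup>2 * qf A x"
    by (intro mult_left_mono) simp_all
  then show ?thesis
    using ne by (simp add: z_def qf_scaleR_vec power_divide n[symmetric])
qed

lemma opt_cone_variation:
  assumes A: "A \<in> opt_cone k P" and P: "P \<in> proj k" and k: "1 \<le> k"
    and x: "norm x = 1" "P *v x = x" and y: "norm y = 1" "P *v y = 0"
  shows "qf A y \<le> qf A x" "cip x (A *v y) = 0"
proof -
  note h = opt_coneD(1)[OF A]
  \<comment> \<open>Here \<open>y\<close> is replaced by \<open>t w y\<close>: the real
    \<open>t\<close> separates the orders, and the phase \<open>w\<close> rotates the cross term
    arbitrarily. Opposite displacements cancel the linear term; the phases 1, -1, i, -i kill the
    cross term.\<close>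
  have *: "t\<^sup>2 * (qf A y - qf A x) + t * (2 * Re (w * cip x (A *v y))) \<le> 0" if "cmod w = 1" for t w
  proof -
    have "(norm (of_real t * w *s y))\<^sup>2 = t\<^sup>2"
    proof -
      have "cip (of_real t * w *s y) (of_real t * w *s y) = of_real (t\<^sup>2) * (w * cnj w) * cip y y"
        by (simp add: cip_simps mult_ac power2_eq_square)
      also have "\<dots> = of_real (t\<^sup>2)"
        using that y by (simp add: cip_self_unit flip: complex_norm_square)
      finally show ?thesis
        unfolding cip_self of_real_eq_iff .
    qed
    moreover have "qf A (of_real t * w *s y) = t\<^sup>2 * qf A y"
      by (simp add: qf_smult_vec norm_mult that)
    moreover have "Re (cip x (A *v (of_real t * w *s y))) = t * Re (w * cip x (A *v y))"
      by (simp add: mv_simps cip_simps mult.assoc)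
    ultimately show ?thesis
      using opt_cone_variation_aux[OF A P k x, of "of_real t * w *s y"] y(2)
      by (simp add: matvec_smult_right qf_add_vec[OF h] algebra_simps)
  qed
  show "qf A y \<le> qf A x"
    using *[of 1 1] *[of 1 "-1"] by simp
  have le: "Re (w * cip x (A *v y)) \<le> 0" if "cmod w = 1" for w
    using nonneg_quadratic_linear_part[OF *[OF that]] by simp
  have "Re (cip x (A *v y)) = 0" "Im (cip x (A *v y)) = 0"
    using le[of 1] le[of "-1"] le[of \<i>] le[of "- \<i>"] by simp_all
  then show "cip x (A *v y) = 0" by (simp add: complex_eq_iff)
qed

text \<open>The cross terms between range and kernel vanish, so
  \<open>P ** A ** (mat 1 - P) = 0\<close>; taking adjoints turns this block statement into
  commutation.\<close>

lemma opt_cone_commute: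
  assumes A: "A \<in> opt_cone k P" and P: "P \<in> proj k" and k: "1 \<le> k"
  shows "A ** P = P ** A"
proof -
  note h = opt_coneD(1)[OF A]
  have orth: "cip x (A *v y) = 0" if x: "P *v x = x" and y: "P *v y = 0" for x y
  proof (cases "x = 0 \<or> y = 0")
    case False
    obtain r where r: "norm (r *\<^sub>R x) = 1" "r > 0" using False cip_nonzero_normalize by blast
    obtain s where s: "norm (s *\<^sub>R y) = 1" "s > 0" using False cip_nonzero_normalize by blast
    have "cip (r *\<^sub>R x) (A *v (s *\<^sub>R y)) = 0"
      by (rule opt_cone_variation(2)[OF A P k r(1) _ s(1)]) (simp_all add: matvec_scaleR_right x y)
    then show ?thesis using r s by (simp add: mv_simps cip_simps)
  qed auto
  have "P ** A ** (mat 1 - P) = 0"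
  proof (rule matrix_eq_matvec)
    fix v
    have "cip w (P *v (A *v ((mat 1 - P) *v v))) = 0" for w
    proof -
      have "P *v (P *v w) = P *v w" "P *v ((mat 1 - P) *v v) = 0"
        by (simp_all add: mv_simps matrix_vector_mul_assoc projD[OF P])
      then show ?thesis
        using orth[of "P *v w" "(mat 1 - P) *v v"] by (simp only: herm_cip[OF projD(1)[OF P], of w])
    qed
    then show "P ** A ** (mat 1 - P) *v v = 0 *v v"
      using cip_zero_all by (simp flip: matrix_vector_mul_assoc) blast
  qed
  then have 1: "P ** A = P ** A ** P" by (simp add: mm_simps)
  have "A ** P = cadj (P ** A)" by (simp add: cadj_mult hermD h projD[OF P])
  also have "\<dots> = cadj (P ** A ** P)" using 1 by simp
  also have "\<dots> = P ** A ** P" by (simp add: cadj_mult hermD h projD[OF P] matrix_mul_assoc)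
  finally show ?thesis using 1 by simp
qed

lemma matvec_compl: "(mat 1 - P) *v x = x - P *v (x :: complex^'n)"
  by (simp add: mv_simps)

lemma proj_compl_herm: "P \<in> proj k \<Longrightarrow> mat 1 - P \<in> herm"
  by (simp add: herm_intros projD)

lemma opt_cone_decomp:
  fixes P :: "complex^'n^'n"
  assumes A: "A \<in> opt_cone k P" and P: "P \<in> proj k" and k: "1 \<le> k" "k < CARD('n)"
  obtains l X Y where "psd X" "psd Y" "P ** X ** P = X" "(mat 1 - P) ** Y ** (mat 1 - P) = Y"
    "A = l *\<^sub>R mat 1 + X - Y"
proof -
  note h = opt_coneD(1)[OF A]
  let ?N = "{qf A y |y. norm y = 1 \<and> P *v y = 0}"
  \<comment> \<open>On unit vectors the form is at least as large on the range as on the kernel. The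
    largest kernel value is a level separating the two, and subtracting it leaves a positive block
    on the range and a negative one on the kernel.\<close>
  define l where "l = Sup ?N"
  obtain x0 y0 where 0: "norm x0 = 1" "P *v x0 = x0" "norm y0 = 1" "P *v y0 = 0"
    using proj_ran_ker[OF P k] by blast
  have lx: "l \<le> qf A x" if "norm x = 1" "P *v x = x" for x
    unfolding l_def by (rule cSup_least) (use opt_cone_variation(1)[OF A P k(1) that] 0 in auto)
  have ly: "qf A y \<le> l" if "norm y = 1" "P *v y = 0" for y
    unfolding l_def by (rule cSup_upper)
      (use that opt_cone_variation(1)[OF A P k(1) 0(1,2)] in \<open>auto simp: bdd_above_def\<close>)
  define M where "M = A - l *\<^sub>R mat 1"
  have Mh: "M \<in> herm" by (simp add: M_def herm_intros h)
  have Mx: "0 \<le> qf M x" if "P *v x = x" for x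
  proof (cases "x = 0")
    case False
    then obtain r where r: "norm (r *\<^sub>R x) = 1" "r > 0" using cip_nonzero_normalize by blast
    have "0 \<le> qf M (r *\<^sub>R x)"
      using lx[OF r(1)] that r(1) by (simp add: M_def qf_simps matvec_scaleR_right)
    then show ?thesis using r by (simp add: qf_scaleR_vec zero_le_mult_iff)
  qed (simp add: qf_def)
  have My: "qf M y \<le> 0" if "P *v y = 0" for y
  proof (cases "y = 0")
    case False
    then obtain r where r: "norm (r *\<^sub>R y) = 1" "r > 0" using cip_nonzero_normalize by blast
    have "qf M (r *\<^sub>R y) \<le> 0"
      using ly[OF r(1)] that r(1) by (simp add: M_def qf_simps matvec_scaleR_right)
    then show ?thesis using r by (simp add: qf_scaleR_vec mult_le_0_iff)
  qed (simp add: qf_def)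
  let ?C = "mat 1 - P"
  have C: "?C ** ?C = ?C" by (simp add: mm_simps projD[OF P])
  have PC: "P *v (?C *v x) = 0" for x
    by (simp add: mv_simps matrix_vector_mul_assoc projD[OF P])
  have X: "psd (P ** M ** P)"
    by (simp add: psd_def herm_sandwich projD[OF P] Mh qf_sandwich Mx matrix_vector_mul_assoc)
  have Y: "psd (- (?C ** M ** ?C))"
    using My[OF PC] by (simp add: psd_def herm_minus herm_sandwich proj_compl_herm[OF P] Mh qf_sandwich qf_minus)
  have "A = l *\<^sub>R mat 1 + P ** M ** P - (- (?C ** M ** ?C))"
  proof -
    have "P ** M = M ** P"
      by (simp add: M_def mm_simps opt_cone_commute[OF A P k(1)])
    then have "P ** M ** P = M ** P" "?C ** M ** ?C = M - M ** P"
      by (simp_all add: mm_simps) (simp_all add: projD[OF P] flip: matrix_mul_assoc)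
    then show ?thesis by (simp add: M_def)
  qed
  moreover have "P ** (P ** M ** P) ** P = P ** M ** P"
    by (metis matrix_mul_assoc projD(3)[OF P])
  moreover have "?C ** (- (?C ** M ** ?C)) ** ?C = - (?C ** M ** ?C)"
    unfolding matrix_minus_left matrix_minus_right by (metis matrix_mul_assoc C)
  ultimately show ?thesis using X Y that by blast
qed

text \<open>\<open>P\<close> captures the whole trace of the range block and none of the kernel
  block, which is the best possible for both. Compressing arbitrary \<open>X\<close> and
  \<open>Y\<close> lets the same pair be used for nearby projections in a limit argument.\<close>

lemma opt_coneI:
  fixes P :: "complex^'n^'n"
  assumes X: "psd X" and Y: "psd Y" and P: "P \<in> proj k" and k: "k \<le> CARD('n)"
  shows "l *\<^sub>R mat 1 + P ** X ** P - (mat 1 - P) ** Y ** (mat 1 - P) \<in> opt_cone k P"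
proof -
  let ?C = "mat 1 - P" let ?X = "P ** X ** P" and ?Y = "?C ** Y ** ?C"
  have X': "psd ?X" using psd_sandwich X projD(1)[OF P] by blast
  have Y': "psd ?Y" using psd_sandwich Y proj_compl_herm[OF P] by blast
  have hX: "?X \<in> herm" and hY: "?Y \<in> herm" using X' Y' by (simp_all add: psd_def)
  have "?X ** P = ?X"
    by (simp add: projD(3)[OF P] flip: matrix_mul_assoc)
  then have XP: "?X \<bullet> P = ?X \<bullet> mat 1"
    by (simp add: herm_inner[OF hX])
  have "?C ** P = 0" by (simp add: mm_simps projD[OF P])
  then have "?Y ** P = 0"
    by (simp add: matrix_zero_right flip: matrix_mul_assoc)
  then have YP: "?Y \<bullet> P = 0"
    by (simp add: herm_inner[OF hY] trace_0[unfolded mat_0])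
  show ?thesis
    unfolding opt_cone_def
  proof (intro CollectI conjI ballI)
    show "l *\<^sub>R mat 1 + ?X - ?Y \<in> herm" by (simp add: herm_intros hX hY)
    fix R :: "complex^'n^'n" assume R: "R \<in> proj k"
    have "0 \<le> ?X \<bullet> (mat 1 - R)"
      using psd_inner_proj[OF X' proj_compl[OF R k]] .
    moreover have "0 \<le> ?Y \<bullet> R"
      using psd_inner_proj[OF Y' R] .
    ultimately show "(l *\<^sub>R mat 1 + ?X - ?Y) \<bullet> R \<le> (l *\<^sub>R mat 1 + ?X - ?Y) \<bullet> P"
      by (simp add: inner_add_left inner_diff_left inner_diff_right mat1_inner_proj[OF R] mat1_inner_proj[OF P] XP YP)
  qed
qed

lemma proj_swap:
  assumes P: "P \<in> proj k" and x: "norm x = 1" "P *v x = x" and z: "norm z = 1" "(P - outer x) *v z = 0"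
  shows "P - outer x + outer z \<in> proj k"
proof (cases k)
  case 0
  then have "P \<bullet> P = 0" using proj_inner_self[OF P] by simp
  then have "P = 0" by simp
  then show ?thesis using x by simp
next
  case (Suc m)
  then show ?thesis
    using proj_add_outer[OF proj_diff_outer[OF _ x] z] P by simp
qed

lemma qf_ran_ker:
  assumes M: "M \<in> herm" and P: "P \<in> proj k" and c: "M ** P = P ** M"
  shows "qf M v = qf M (P *v v) + qf M (v - P *v v)"
proof -
  have "cip (P *v v) (M *v (v - P *v v)) = cip v (P ** M *v (v - P *v v))"
    by (simp add: herm_cip[OF projD(1)[OF P], of v] flip: matrix_vector_mul_assoc)
  also have "\<dots> = cip v (M *v (P *v (v - P *v v)))"
    by (simp add: c[symmetric] flip: matrix_vector_mul_assoc)
  also have "\<dots> = 0"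
    by (simp add: mv_simps matrix_vector_mul_assoc projD[OF P])
  finally show ?thesis
    using qf_add_vec[OF M, of "P *v v" "v - P *v v"] by simp
qed

text \<open>Used with \<open>e = 1\<close> on the range and \<open>e = 0\<close> on the kernel of
  \<open>P\<close>.\<close>

lemma qf_scaled_unit:
  assumes "\<And>u. norm u = 1 \<Longrightarrow> P *v u = e *s u \<Longrightarrow> qf A u = q" "P *v v = e *s v"
  shows "qf A v = q * (norm v)\<^sup>2"
proof (cases "v = 0")
  case False
  then obtain r where r: "norm (r *\<^sub>R v) = 1" "r > 0" using cip_nonzero_normalize by blast
  have "qf A (r *\<^sub>R v) = q"
  proof (rule assms(1)[OF r(1)])
    show "P *v (r *\<^sub>R v) = e *s (r *\<^sub>R v)"
      by (simp add: matvec_scaleR_right assms(2)) (simp add: scaleR_eq_smult vector_smult_assoc mult.commute)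
  qed
  moreover have "r\<^sup>2 * (norm v)\<^sup>2 = 1" using r by (simp flip: power_mult_distrib)
  ultimately have "r\<^sup>2 * qf A v = r\<^sup>2 * (q * (norm v)\<^sup>2)"
    by (simp add: qf_scaleR_vec mult_ac)
  then show ?thesis using r by simp
qed (simp add: qf_def)

lemma opt_cone_both_scalar_aux:
  fixes X :: "complex^'n^'n"
  assumes X: "X \<in> opt_cone k P" and P: "P \<in> proj k" and k: "1 \<le> k" "k < CARD('n)"
    and eq: "\<And>x y. norm x = 1 \<Longrightarrow> P *v x = x \<Longrightarrow> norm y = 1 \<Longrightarrow> P *v y = 0 \<Longrightarrow> qf X x = qf X y"
  obtains c where "X = c *\<^sub>R mat 1"
proof -
  obtain x0 y0 where 0: "norm x0 = 1" "P *v x0 = x0" "norm y0 = 1" "P *v y0 = 0"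
    using proj_ran_ker[OF P k] by blast
  let ?q = "qf X x0"
  have x: "qf X v = ?q * (norm v)\<^sup>2" if "P *v v = v" for v
    by (rule qf_scaled_unit[of P 1]) (use eq 0 that in auto)
  have y: "qf X v = ?q * (norm v)\<^sup>2" if "P *v v = 0" for v
    by (rule qf_scaled_unit[of P 0]) (use eq 0 that in auto)
  have "X = ?q *\<^sub>R mat 1"
  proof (rule herm_eqI)
    show "X \<in> herm" "?q *\<^sub>R mat 1 \<in> herm" using opt_coneD(1)[OF X] by (simp_all add: herm_intros)
    fix v
    have a: "P *v (P *v v) = P *v v" "P *v (v - P *v v) = 0"
      by (simp_all add: mv_simps matrix_vector_mul_assoc projD[OF P])
    have "qf (mat 1) v = qf (mat 1) (P *v v) + qf (mat 1) (v - P *v v)"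
      by (rule qf_ran_ker[OF herm_mat1 P]) simp
    then show "qf X v = qf (?q *\<^sub>R mat 1) v"
      using qf_ran_ker[OF opt_coneD(1)[OF X] P opt_cone_commute[OF X P k(1)], of v] x[OF a(1)] y[OF a(2)]
      by (simp add: qf_simps algebra_simps)
  qed
  then show ?thesis using that by blast
qed

text \<open>This identifies the lineality space of the cone. With both signs present, the
  range-kernel comparison holds in both directions, so the form is constant on unit vectors of the
  two blocks.\<close>

lemma opt_cone_both_scalar:
  fixes X :: "complex^'n^'n"
  assumes "X \<in> opt_cone k P" "- X \<in> opt_cone k P" "P \<in> proj k" "1 \<le> k" "k < CARD('n)"
  obtains c where "X = c *\<^sub>R mat 1"
proof (rule opt_cone_both_scalar_aux[OF assms(1,3-5)])
  fix x y assume "norm x = 1" "P *v x = x" "norm y = 1" "P *v y = 0"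
  then show "qf X x = qf X y"
    using opt_cone_variation(1)[OF assms(1) assms(3,4)] opt_cone_variation(1)[OF assms(2) assms(3,4)]
    by (fastforce simp: qf_minus)
qed (rule that)

lemma abs_half_jump:
  fixes w d :: real
  assumes "\<bar>w - d / 2\<bar> = w" "\<bar>w - d\<bar> = w"
  shows "d = 0"
  using assms by linarith

text \<open>Along the path of projections obtained by rotating \<open>x\<close> into \<open>y\<close>, the half way point excludes
  a jump from \<open>w\<close> to \<open>-w\<close>.\<close>

lemma abs_const_scalar:
  fixes X :: "complex^'n^'n"
  assumes X: "X \<in> herm" and k: "1 \<le> k" "k < CARD('n)"
    and const: "\<And>R. R \<in> proj k \<Longrightarrow> \<bar>X \<bullet> R\<bar> = w"
  obtains c where "X = c *\<^sub>R mat 1"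
proof -
  obtain P :: "complex^'n^'n" where P: "P \<in> proj k" using proj_nonempty[of k, where 'n = 'n] k by fastforce
  have main: "\<exists>c. Z = c *\<^sub>R mat 1"
    if Z: "Z \<in> herm" and ZR: "\<And>R. R \<in> proj k \<Longrightarrow> \<bar>Z \<bullet> R\<bar> = w" and ZP: "Z \<bullet> P = w" for Z :: "complex^'n^'n"
  proof -
    have C: "Z \<in> opt_cone k P"
      using Z ZR ZP by (force simp: opt_cone_def)
    have eq: "qf Z x = qf Z y" if x: "norm x = 1" "P *v x = x" and y: "norm y = 1" "P *v y = 0" for x y
    proof -
      note v = opt_cone_variation[OF C P k(1) x y]
      have xy: "cip x y = 0" using herm_cip[OF projD(1)[OF P], of x y] x y by simp
      have inner: "Z \<bullet> (P - outer x + outer z) = w - qf Z x + qf Z z" for z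
        by (simp add: inner_add_right inner_diff_right inner_outer Z ZP)
      have ker: "(P - outer x) *v (r *\<^sub>R (x + y)) = 0" "(P - outer x) *v y = 0" for r
        using x y xy by (simp_all add: mv_simps outer_matvec cip_self_unit)
      define z where "z = (1 / sqrt 2) *\<^sub>R (x + y)"
      have "(norm (x + y))\<^sup>2 = 2"
        using x y Re_cip[of x y]
        by (simp add: xy power2_norm_eq_inner inner_add inner_commute[of y x] norm_eq_1)
      then have "norm (x + y) = sqrt 2" by (simp add: real_sqrt_unique)
      then have z: "norm z = 1" by (simp add: z_def)
      have "(P - outer x) *v z = 0" unfolding z_def by (rule ker)
      from ZR[OF proj_swap[OF P x z this]] have "\<bar>w - qf Z x + qf Z z\<bar> = w"
        by (simp only: inner)
      moreover have "qf Z z = (qf Z x + qf Z y) / 2"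
        unfolding z_def qf_scaleR_vec qf_add_vec[OF Z] by (simp add: v power_divide)
      moreover have "\<bar>w - qf Z x + qf Z y\<bar> = w"
        using ZR[OF proj_swap[OF P x y(1)]] ker(2) by (simp add: inner)
      ultimately have "\<bar>w - (qf Z x - qf Z y) / 2\<bar> = w" "\<bar>w - (qf Z x - qf Z y)\<bar> = w"
        by (simp_all add: field_simps)
      then have "qf Z x - qf Z y = 0" by (rule abs_half_jump)
      then show ?thesis by simp
    qed
    show ?thesis using opt_cone_both_scalar_aux[OF C P k eq] by blast
  qed
  show ?thesis
  proof (cases "X \<bullet> P \<ge> 0")
    case True
    then show ?thesis using main[OF X const] const[OF P] that by auto
  next
    case False
    then have "\<exists>c. - X = c *\<^sub>R mat 1"
      using const const[OF P] by (intro main) (auto simp: herm_intros X)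
    then obtain c where "- X = c *\<^sub>R mat 1" by blast
    then have "- (- X) = (- c) *\<^sub>R mat 1" by (simp only: scaleR_minus_left)
    then show ?thesis unfolding minus_minus by (rule that)
  qed
qed

section \<open>The image of the identity, shifts, and perturbations with a unique maximiser\<close>

lemma kradius_mat1: "k \<le> CARD('n) \<Longrightarrow> kradius k (mat 1 :: complex^'n^'n) = k"
  using proj_nonempty[of k, where 'n = 'n]
  by (auto simp: mat1_inner_proj intro!: kradius_eqI herm_mat1)

lemma kradius_proj:
  fixes P :: "complex^'n^'n"
  shows "P \<in> proj k \<Longrightarrow> k \<le> CARD('n) \<Longrightarrow> kradius k P = k"
  by (rule kradius_eqI) (auto simp: projD proj_inner_self proj_inner_le proj_inner_nonneg)

text \<open>Test against a preimage \<open>B\<close> of an arbitrary projection \<open>R\<close>: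
  the only projection attaining the radius of \<open>R\<close> is \<open>R\<close> itself, so
  \<open>T (mat 1)\<close> must attain its radius there. A constant absolute value over all
  \<open>R\<close> forces a scalar.\<close>

lemma parallel_preserver_mat1:
  fixes T :: "complex^'n^'n \<Rightarrow> complex^'n^'n"
  assumes bij: "bij_betw T herm herm" and k: "1 \<le> k" "k < CARD('n)"
    and par: "\<And>A B. A \<in> herm \<Longrightarrow> B \<in> herm \<Longrightarrow> kparallel k A B \<Longrightarrow> kparallel k (T A) (T B)"
  obtains c where "T (mat 1) = c *\<^sub>R mat 1"
proof -
  have k': "k \<le> CARD('n)" using k by simp
  have T: "T A \<in> herm" if "A \<in> herm" for A using bij that by (auto simp: bij_betw_def)
  have 1: "\<bar>T (mat 1) \<bullet> R\<bar> = kradius k (T (mat 1))" if R: "R \<in> proj k" for R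
  proof -
    obtain B where B: "B \<in> herm" "T B = R"
      using bij projD(1)[OF R] unfolding bij_betw_def by (metis imageE)
    obtain P where P: "P \<in> proj k" "\<bar>B \<bullet> P\<bar> = kradius k B"
      using kradius_attained[OF B(1) k'] by blast
    have "kparallel k (mat 1) B"
      unfolding kparallel_iff[OF herm_mat1 B(1) k']
      using P by (auto simp: mat1_inner_proj kradius_mat1[OF k'])
    then have "kparallel k (T (mat 1)) R"
      using par[OF herm_mat1 B(1)] B(2) by simp
    then obtain S where S: "S \<in> proj k" "\<bar>T (mat 1) \<bullet> S\<bar> = kradius k (T (mat 1))" "\<bar>R \<bullet> S\<bar> = kradius k R"
      unfolding kparallel_iff[OF T[OF herm_mat1] projD(1)[OF R] k'] by blast
    then have "R \<bullet> S = k"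
      using proj_inner_nonneg[OF R] by (simp add: kradius_proj[OF R k'])
    then show ?thesis using proj_inner_eq[OF R S(1)] S(2) by simp
  qed
  show ?thesis using abs_const_scalar[OF T[OF herm_mat1] k 1] that by blast
qed

text \<open>Since \<open>k \<ge> 1\<close>, the shift adds at least the radius of \<open>B\<close>
  to every value. All values become nonnegative, and the signed maximiser \<open>P\<close> is also
  an absolute one.\<close>

lemma opt_cone_shift:
  fixes B :: "complex^'n^'n"
  assumes B: "B \<in> opt_cone k P" and P: "P \<in> proj k" and k: "1 \<le> k" "k \<le> CARD('n)" and t: "kradius k B \<le> t"
  shows "(B + t *\<^sub>R mat 1) \<bullet> P = kradius k (B + t *\<^sub>R mat 1)"
proof -
  note h = opt_coneD(1)[OF B]
  have "t * 1 \<le> t * k" using t kradius_nonneg[OF h k(2)] k(1) by (intro mult_left_mono) auto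
  then have tk: "kradius k B \<le> t * k" using t by simp
  have "kradius k (B + t *\<^sub>R mat 1) = (B + t *\<^sub>R mat 1) \<bullet> P"
  proof (rule kradius_eqI[OF _ k(2) P])
    show "B + t *\<^sub>R mat 1 \<in> herm" by (simp add: herm_intros h)
    show "\<bar>(B + t *\<^sub>R mat 1) \<bullet> P\<bar> = (B + t *\<^sub>R mat 1) \<bullet> P"
      using kradius_ge[OF h k(2) P] tk by (simp add: inner_add_left mat1_inner_proj[OF P])
    fix R :: "complex^'n^'n" assume R: "R \<in> proj k"
    show "\<bar>(B + t *\<^sub>R mat 1) \<bullet> R\<bar> \<le> (B + t *\<^sub>R mat 1) \<bullet> P"
      using kradius_ge[OF h k(2) P] kradius_ge[OF h k(2) R] opt_coneD(2)[OF B R] tk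
      by (simp add: inner_add_left mat1_inner_proj[OF P] mat1_inner_proj[OF R])
  qed
  then show ?thesis by simp
qed

text \<open>The added term gains the full amount \<open>e * k\<close> only at \<open>Q\<close>,
  because \<open>Q \<bullet> R \<le> k\<close> with equality only for \<open>R = Q\<close>, while
  \<open>A\<close> itself already attains its radius at \<open>Q\<close> with the matching sign
  \<open>s\<close>.\<close>

lemma smooth_perturbation:
  fixes A :: "complex^'n^'n"
  assumes A: "A \<in> herm" and Q: "Q \<in> proj k" and k: "k \<le> CARD('n)" and s: "s \<in> {1, -1 :: real}"
    and sA: "s * (A \<bullet> Q) = kradius k A" and e: "0 < e"
    and R: "R \<in> proj k" "\<bar>(A + (e * s) *\<^sub>R Q) \<bullet> R\<bar> = kradius k (A + (e * s) *\<^sub>R Q)"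
  shows "R = Q"
proof -
  have "kradius k A + e * k \<le> kradius k (A + (e * s) *\<^sub>R Q)"
    using kradius_ge[of "A + (e * s) *\<^sub>R Q" k, OF _ k Q] s sA e
    by (auto simp: inner_add_left proj_inner_self[OF Q] herm_intros A projD[OF Q])
  also have "\<dots> = \<bar>A \<bullet> R + e * s * (Q \<bullet> R)\<bar>"
    using R(2) by (simp add: inner_add_left)
  also have "\<dots> \<le> kradius k A + e * (Q \<bullet> R)"
  proof -
    have "\<bar>e * s * (Q \<bullet> R)\<bar> = e * (Q \<bullet> R)"
      using s e proj_inner_nonneg[OF Q R(1)] by (auto simp: abs_mult)
    then show ?thesis
      using kradius_ge[OF A k R(1)] abs_triangle_ineq[of "A \<bullet> R" "e * s * (Q \<bullet> R)"] by linarith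
  qed
  finally have "k \<le> Q \<bullet> R" using e by simp
  then show ?thesis
    using proj_inner_le[OF Q R(1)] proj_inner_eq[OF Q R(1)] by simp
qed

lemma bounded_bilinear_matrix_mult: "bounded_bilinear ((**) :: complex^'n^'n \<Rightarrow> complex^'n^'n \<Rightarrow> _)"
  by (rule bilinear_conv_bounded_bilinear[THEN iffD1])
    (auto simp: bilinear_def linear_iff mm_simps)

lemmas tendsto_matrix_mult = bounded_bilinear.tendsto[OF bounded_bilinear_matrix_mult]

lemma closed_opt_cone: "closed (opt_cone k P)"
proof -
  have "opt_cone k P = {A. cadj A = A} \<inter> (\<Inter>R\<in>proj k. {A. A \<bullet> R \<le> A \<bullet> P})"
    by (auto simp: opt_cone_def herm_def)
  then show ?thesis
    by (auto intro!: closed_Int closed_INT closed_Collect_eq closed_Collect_le continuous_cadj continuous_intros)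
qed

lemma proj_mem_opt_cone: "P \<in> proj k \<Longrightarrow> P \<in> opt_cone k P"
  by (simp add: opt_cone_def projD proj_inner_self proj_inner_le)

lemma herm_bound:
  fixes A :: "complex^'n^'n"
  assumes "A \<in> herm"
  obtains c where "psd (c *\<^sub>R mat 1 + A)" "psd (c *\<^sub>R mat 1 - A)"
proof -
  have bl: "bounded_linear (\<lambda>x. A *v x)"
    using matrix_vector_mul_linear linear_conv_bounded_linear by blast
  have b: "\<bar>qf A x\<bar> \<le> onorm ((*v) A) * (norm x)\<^sup>2" for x
  proof -
    have "\<bar>qf A x\<bar> \<le> norm x * norm (A *v x)"
      unfolding qf_def Re_cip by (rule Cauchy_Schwarz_ineq2)
    also have "\<dots> \<le> norm x * (onorm ((*v) A) * norm x)"
      by (intro mult_left_mono onorm[OF bl]) simp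
    finally show ?thesis by (simp add: power2_eq_square mult_ac)
  qed
  then have "psd (onorm ((*v) A) *\<^sub>R mat 1 + A)" "psd (onorm ((*v) A) *\<^sub>R mat 1 - A)"
  proof -
    have "0 \<le> onorm ((*v) A) * (norm x)\<^sup>2 + qf A x" "0 \<le> onorm ((*v) A) * (norm x)\<^sup>2 - qf A x" for x
      using b[of x] by linarith+
    then show "psd (onorm ((*v) A) *\<^sub>R mat 1 + A)" "psd (onorm ((*v) A) *\<^sub>R mat 1 - A)"
      using assms by (simp_all add: psd_def herm_intros qf_simps)
  qed
  with that show ?thesis by blast
qed

section \<open>Commutants of projections\<close>

definition commutant :: "complex^'n^'n \<Rightarrow> (complex^'n^'n) set" where
  "commutant P = {A \<in> herm. A ** P = P ** A}"

lemma subspace_commutant: "subspace (commutant P)"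
  by (auto simp: subspace_def commutant_def herm_intros mm_simps)

text \<open>Take \<open>c\<close> with both \<open>c I + A\<close> and \<open>c I - A\<close>
  positive: using them as range and kernel parts at level \<open>c\<close> gives exactly
  \<open>A + 2 c P\<close>. As \<open>P\<close> lies in its own cone, the commutant is the linear
  span of the cone.\<close>

lemma commutant_decomp:
  fixes A :: "complex^'n^'n"
  assumes A: "A \<in> commutant P" and P: "P \<in> proj k" and k: "k \<le> CARD('n)"
  obtains c where "A + c *\<^sub>R P \<in> opt_cone k P"
proof -
  have h: "A \<in> herm" and AP: "A ** P = P ** A" using A by (auto simp: commutant_def)
  obtain c where c: "psd (c *\<^sub>R mat 1 + A)" "psd (c *\<^sub>R mat 1 - A)"
    using herm_bound[OF h] by blast
  have PAP: "P ** A ** P = P ** A"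
    by (metis AP matrix_mul_assoc projD(3)[OF P])
  have "c *\<^sub>R mat 1 + P ** (c *\<^sub>R mat 1 + A) ** P - (mat 1 - P) ** (c *\<^sub>R mat 1 - A) ** (mat 1 - P)
    = A + (c + c) *\<^sub>R P"
    by (simp add: mm_simps PAP AP projD[OF P]) (simp add: scaleR_diff_right scaleR_add_left[of c c, unfolded mult_2[symmetric]] del: mult_2)
  then have "A + (c + c) *\<^sub>R P \<in> opt_cone k P"
    using opt_coneI[OF c P k, of c] by simp
  then show ?thesis using that by blast
qed

text \<open>Conjugation by a unitary taking \<open>P\<close> to \<open>Q\<close> embeds one
  commutant into the other; by symmetry the dimension depends only on \<open>k\<close>.\<close>

lemma dim_commutant_le:
  fixes P Q :: "complex^'n^'n"
  assumes P: "P \<in> proj k" and Q: "Q \<in> proj k"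
  shows "dim (commutant P) \<le> dim (commutant Q)"
proof -
  obtain W where W: "unitary_mat W" "Q = W ** P ** cadj W"
    using proj_conj_exists[OF P Q] by blast
  let ?f = "\<lambda>A. W ** A ** cadj W"
  have lin: "linear ?f" by (auto simp: linear_iff mm_simps)
  have prod: "?f A ** ?f B = ?f (A ** B)" for A B
  proof -
    have "?f A ** ?f B = W ** A ** (cadj W ** W) ** B ** cadj W" by (simp add: matrix_mul_assoc)
    then show ?thesis by (simp add: unitary_matD[OF W(1)] matrix_mul_assoc)
  qed
  have "cadj W ** ?f A ** W = A" for A
  proof -
    have "cadj W ** ?f A ** W = (cadj W ** W) ** A ** (cadj W ** W)" by (simp add: matrix_mul_assoc)
    then show ?thesis by (simp add: unitary_matD[OF W(1)])
  qed
  then have "inj_on ?f (span (commutant P))" by (rule inj_on_inverseI)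
  then have "dim (commutant P) = dim (?f ` commutant P)"
    using dim_image_eq[OF lin] by simp
  also have "?f ` commutant P \<subseteq> commutant Q"
    by (auto simp: commutant_def herm_conj W(2) prod)
  then have "dim (?f ` commutant P) \<le> dim (commutant Q)" by (rule dim_subset)
  finally show ?thesis .
qed

lemma proj_commute_outer:
  assumes P: "P \<in> proj m" and com: "P ** outer x = outer x ** P"
  shows "P *v x = x \<or> P *v x = 0"
proof (cases "x = 0")
  case False
  have "P ** outer x *v x = outer x ** P *v x" using com by simp
  then have "cip x x *s (P *v x) = cip x (P *v x) *s x"
    by (simp add: outer_matvec matvec_smult_right flip: matrix_vector_mul_assoc)
  then have "(1 / cip x x) *s (cip x x *s (P *v x)) = (1 / cip x x) *s (cip x (P *v x) *s x)" by simp
  then have "P *v x = (cip x (P *v x) / cip x x) *s x"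
    using False by (simp add: vector_smult_assoc)
  then obtain a where a: "P *v x = a *s x" by blast
  have "P *v (P *v x) = P *v x" by (simp add: matrix_vector_mul_assoc projD[OF P])
  then have "(a * a - a) *s x = 0"
    by (simp add: a matvec_smult_right vector_smult_assoc vector_sub_rdistrib)
  then have "a * a - a = 0" using False by (metis vector_mul_eq_0)
  then have "a = 1 \<or> a = 0" by (auto simp: algebra_simps)
  then show ?thesis using a by auto
qed simp

text \<open>Every vector in the range of \<open>R\<close> is an eigenvector of \<open>P\<close> for
  1 or 0. Both eigenvalues cannot occur, since the sum of two such vectors would not be an
  eigenvector.\<close>

lemma commuting_projection_dichotomy:
  assumes P: "P \<in> proj m" and com: "\<And>x. R *v x = x \<Longrightarrow> P ** outer x = outer x ** P"
  shows "(\<forall>x. R *v x = x \<longrightarrow> P *v x = x) \<or> (\<forall>x. R *v x = x \<longrightarrow> P *v x = 0)"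
proof -
  have eig: "P *v x = x \<or> P *v x = 0" if "R *v x = x" for x
    by (rule proj_commute_outer[OF P com[OF that]])
  show ?thesis
  proof (rule ccontr)
    assume "\<not> ?thesis"
    then obtain x y where x: "R *v x = x" "P *v x \<noteq> x" and y: "R *v y = y" "P *v y \<noteq> 0" by blast
    then have "P *v x = 0" "P *v y = y" using eig by blast+
    moreover have "P *v (x + y) = x + y \<or> P *v (x + y) = 0"
      using x y by (intro eig) (simp add: mv_simps)
    ultimately have "x = 0 \<or> y = 0" by (auto simp: mv_simps)
    with x y show False by auto
  qed
qed

text \<open>Rank-one matrices over the range or the kernel of \<open>P\<close> lie in the commutant,
  so \<open>Q\<close> is 0 or 1 on each block. The trace excludes the two cases
  \<open>Q = mat 1\<close> and \<open>Q = 0\<close>.\<close>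

lemma commutant_eq_imp:
  fixes P Q :: "complex^'n^'n"
  assumes P: "P \<in> proj k" and Q: "Q \<in> proj k" and k: "1 \<le> k" "k < CARD('n)"
    and eq: "commutant P = commutant Q"
  shows "Q = P \<or> Q = mat 1 - P"
proof -
  have com: "Q ** outer x = outer x ** Q" if "P *v x = x \<or> (mat 1 - P) *v x = x" for x
  proof -
    have "P *v x = x \<or> P *v x = 0" using that by (simp add: mv_simps)
    then have "P ** outer x = outer x ** P"
      using matrix_mult_outer_fix[of P x] matrix_mult_outer_eq_0[of P x] outer_mult_herm[OF projD(1)[OF P], of x]
      by (auto simp: cadj_zero)
    then have "outer x \<in> commutant P" by (simp add: commutant_def herm_outer)
    then have "outer x \<in> commutant Q" using eq by simp
    then show ?thesis by (simp add: commutant_def)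
  qed
  have split: "Q *v v = Q *v (P *v v) + Q *v ((mat 1 - P) *v v)" for v
    by (simp add: mv_simps)
  have r: "P *v (P *v v) = P *v v" "(mat 1 - P) *v ((mat 1 - P) *v v) = (mat 1 - P) *v v" for v
  proof -
    have "(mat 1 - P) ** (mat 1 - P) = mat 1 - P" by (simp add: mm_simps projD[OF P])
    then show "P *v (P *v v) = P *v v" "(mat 1 - P) *v ((mat 1 - P) *v v) = (mat 1 - P) *v v"
      by (simp_all only: matrix_vector_mul_assoc projD(3)[OF P])
  qed
  consider "\<forall>x. P *v x = x \<longrightarrow> Q *v x = x" "\<forall>x. (mat 1 - P) *v x = x \<longrightarrow> Q *v x = x"
    | "\<forall>x. P *v x = x \<longrightarrow> Q *v x = x" "\<forall>x. (mat 1 - P) *v x = x \<longrightarrow> Q *v x = 0"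
    | "\<forall>x. P *v x = x \<longrightarrow> Q *v x = 0" "\<forall>x. (mat 1 - P) *v x = x \<longrightarrow> Q *v x = x"
    | "\<forall>x. P *v x = x \<longrightarrow> Q *v x = 0" "\<forall>x. (mat 1 - P) *v x = x \<longrightarrow> Q *v x = 0"
    using commuting_projection_dichotomy[OF Q, of P] commuting_projection_dichotomy[OF Q, of "mat 1 - P"] com
    by blast
  then show ?thesis
  proof cases
    case 1
    have "Q = mat 1"
    proof (rule matrix_eq_matvec)
      fix v
      have "Q *v v = P *v v + (mat 1 - P) *v v"
        using split[of v] 1 r by simp
      then show "Q *v v = mat 1 *v v" by (simp add: mv_simps)
    qed
    then show ?thesis using projD(4)[OF Q] k by (simp add: trace_mat1)
  next
    case 2
    have "Q = P"
      by (rule matrix_eq_matvec) (subst split, use 2 r in simp)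
    then show ?thesis by simp
  next
    case 3
    have "Q = mat 1 - P"
      by (rule matrix_eq_matvec) (subst split, use 3 r in simp)
    then show ?thesis by simp
  next
    case 4
    have "Q = 0"
      by (rule matrix_eq_matvec) (subst split, use 4 r in simp)
    then show ?thesis using projD(4)[OF Q] k by (simp add: trace_0[unfolded mat_0])
  qed
qed

section \<open>Unital preservers permute the cones\<close>

lemma nonpos_by_epsilon:
  fixes a c :: real
  assumes "\<And>e. 0 < e \<Longrightarrow> a \<le> e * c"
  shows "a \<le> 0"
proof (rule nonneg_quadratic_linear_part)
  fix t :: real assume "0 < t"
  then have "t * a \<le> t * (t * c)" using assms by (intro mult_left_mono) auto
  then show "t\<^sup>2 * (- c) + t * a \<le> 0" by (simp add: power2_eq_square)
qed

text \<open>\<open>L\<close> is linear on all matrices, so that general facts on linear maps,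
  dimension and continuity apply; a map given on \<open>herm\<close> is later extended through the
  Hermitian part.\<close>

locale unital_parallel_preserver =
  fixes L :: "complex^'n^'n \<Rightarrow> complex^'n^'n" and k :: nat
  assumes lin: "linear L" and bij: "bij_betw L herm herm"
    and k: "1 \<le> k" "k < CARD('n)"
    and unital: "L (mat 1) = mat 1"
    and par: "\<And>A B. A \<in> herm \<Longrightarrow> B \<in> herm \<Longrightarrow> kparallel k A B \<Longrightarrow> kparallel k (L A) (L B)"
begin

lemma k': "k \<le> CARD('n)" using k by simp

lemma L_herm: "A \<in> herm \<Longrightarrow> L A \<in> herm"
  using bij by (auto simp: bij_betw_def)

lemma L_surj: "B \<in> herm \<Longrightarrow> \<exists>A\<in>herm. L A = B"
  using bij unfolding bij_betw_def by (metis imageE)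

lemma L_inj: "A \<in> herm \<Longrightarrow> B \<in> herm \<Longrightarrow> L A = L B \<Longrightarrow> A = B"
  using bij unfolding bij_betw_def by (metis inj_onD)

lemmas L_add = linear_add[OF lin] and L_diff = linear_diff[OF lin] and L_scaleR = linear_scale[OF lin]
  and L_minus = linear_neg[OF lin]

lemma L_inner_shift: "R \<in> proj k \<Longrightarrow> L (B + t *\<^sub>R mat 1) \<bullet> R = L B \<bullet> R + t * k"
  by (simp add: L_add L_scaleR unital inner_add_left mat1_inner_proj)

text \<open>After a shift by \<open>t\<close>, \<open>B\<close> attains its radius at
  \<open>P\<close>, as \<open>A\<close> does, so the two are parallel. Their images share a
  maximiser, which can only be \<open>Q\<close>. The number \<open>t\<close> also dominates the
  radius of \<open>L B\<close>, so the absolute value can be removed after undoing the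
  shift.\<close>

lemma smooth_image_cone:
  assumes A: "A \<in> herm" and P: "P \<in> proj k" "\<bar>A \<bullet> P\<bar> = kradius k A"
    and smooth: "\<And>R. R \<in> proj k \<Longrightarrow> \<bar>L A \<bullet> R\<bar> = kradius k (L A) \<Longrightarrow> R = Q"
    and B: "B \<in> opt_cone k P"
  shows "L B \<in> opt_cone k Q"
proof -
  note Bh = opt_coneD(1)[OF B]
  define t where "t = kradius k B + kradius k (L B) + 1"
  have nn: "0 \<le> kradius k B" "0 \<le> kradius k (L B)"
    using kradius_nonneg[OF _ k'] Bh L_herm by blast+
  have "kradius k B \<le> t" using nn by (simp add: t_def)
  from opt_cone_shift[OF B P(1) k(1) k' this]
  have "\<bar>(B + t *\<^sub>R mat 1) \<bullet> P\<bar> = kradius k (B + t *\<^sub>R mat 1)"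
    using kradius_nonneg[OF _ k', of "B + t *\<^sub>R mat 1"] Bh by (simp add: herm_intros)
  then have "kparallel k A (B + t *\<^sub>R mat 1)"
    using kparallel_iff[OF A _ k', of "B + t *\<^sub>R mat 1"] P Bh by (auto simp: herm_intros)
  then have "kparallel k (L A) (L (B + t *\<^sub>R mat 1))"
    using par A Bh by (simp add: herm_intros)
  then obtain R where R: "R \<in> proj k" "\<bar>L A \<bullet> R\<bar> = kradius k (L A)"
      "\<bar>L (B + t *\<^sub>R mat 1) \<bullet> R\<bar> = kradius k (L (B + t *\<^sub>R mat 1))"
    using kparallel_iff[OF L_herm[OF A] L_herm k', of "B + t *\<^sub>R mat 1"] Bh by (auto simp: herm_intros)
  have "R = Q" using smooth R by blast
  note Q = R(1)[unfolded this]
  have t: "t * k \<ge> t * 1" using nn k(1) by (intro mult_left_mono) (auto simp: t_def)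
  have pos: "0 \<le> L B \<bullet> Q + t * k"
    using kradius_ge[OF L_herm[OF Bh] k' Q] t nn t_def by linarith
  have "L B \<bullet> S \<le> L B \<bullet> Q" if S: "S \<in> proj k" for S
  proof -
    have "\<bar>L (B + t *\<^sub>R mat 1) \<bullet> S\<bar> \<le> \<bar>L (B + t *\<^sub>R mat 1) \<bullet> Q\<bar>"
      using kradius_ge[OF L_herm k' S, of "B + t *\<^sub>R mat 1"] R(3) \<open>R = Q\<close> Bh by (simp add: herm_intros)
    then show ?thesis
      using pos by (simp add: L_inner_shift[OF S] L_inner_shift[OF Q])
  qed
  then show ?thesis by (simp add: opt_cone_def L_herm Bh)
qed

text \<open>\<open>L P\<close> may have several maximisers. Adding \<open>e n *\<^sub>R Z\<close> to
  \<open>P\<close>, where \<open>L Z\<close> is the signed projection \<open>s Q\<close>, makes the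
  image maximiser unique at the price of moving the source maximiser to some \<open>R n\<close>.
  These converge to \<open>P\<close>, and closedness of the target cone transfers the inclusion to
  \<open>P\<close>.\<close>

lemma cone_image_subset:
  assumes P: "P \<in> proj k"
  obtains Q where "Q \<in> proj k" "L ` opt_cone k P \<subseteq> opt_cone k Q"
proof -
  have hP: "P \<in> herm" and hLP: "L P \<in> herm" using projD(1)[OF P] L_herm by blast+
  obtain Q where Q: "Q \<in> proj k" "\<bar>L P \<bullet> Q\<bar> = kradius k (L P)"
    using kradius_attained[OF hLP k'] by blast
  obtain s :: real where s: "s \<in> {1, -1}" "s * (L P \<bullet> Q) = kradius k (L P)"
    using that[of 1] that[of "-1"] Q(2) by (auto simp: abs_if split: if_splits)
  obtain Z where Z: "Z \<in> herm" "L Z = s *\<^sub>R Q"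
    using L_surj[of "s *\<^sub>R Q"] projD(1)[OF Q(1)] by (auto simp: herm_intros)
  define e where "e n = 1 / real (Suc n)" for n
  have e: "e n > 0" for n by (simp add: e_def)
  have e0: "e \<longlonglongrightarrow> 0" unfolding e_def by (rule LIMSEQ_Suc[OF lim_1_over_n])
  define A where "A n = P + e n *\<^sub>R Z" for n
  have hA: "A n \<in> herm" for n by (simp add: A_def herm_intros hP Z)
  have "\<exists>R\<in>proj k. \<bar>A n \<bullet> R\<bar> = kradius k (A n)" for n
    using kradius_attained[OF hA k'] by blast
  then obtain R where R: "\<And>n. R n \<in> proj k" "\<And>n. \<bar>A n \<bullet> R n\<bar> = kradius k (A n)"
    by metis
  have "L (A n) = L P + (e n * s) *\<^sub>R Q" for n
    by (simp add: A_def L_add L_scaleR Z)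
  then have img: "L B \<in> opt_cone k Q" if "B \<in> opt_cone k (R n)" for B n
    using smooth_image_cone[OF hA R(1,2) _ that] smooth_perturbation[OF hLP Q(1) k' s e] by metis
  \<comment> \<open>\<open>P\<close> is a sharp maximiser of itself: the squared distance to
    \<open>R n\<close> is twice the loss \<open>k - P \<bullet> R n\<close>, and the perturbation
    can compensate a loss of at most twice \<open>e n\<close> times the radius of
    \<open>Z\<close>.\<close>
  have bound: "(norm (P - R n))\<^sup>2 \<le> e n * (4 * kradius k Z)" for n
  proof -
    have a: "\<bar>e n * (Z \<bullet> S)\<bar> \<le> e n * kradius k Z" if "S \<in> proj k" for S
      using kradius_ge[OF Z(1) k' that] e[of n] by (simp add: abs_mult)
    have "k - e n * kradius k Z \<le> \<bar>A n \<bullet> P\<bar>"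
      using a[OF P] by (simp add: A_def inner_add_left proj_inner_self[OF P] abs_if split: if_splits)
    also have "\<dots> \<le> \<bar>A n \<bullet> R n\<bar>" using kradius_ge[OF hA k' P] R(2) by simp
    also have "\<dots> \<le> P \<bullet> R n + e n * kradius k Z"
      using a[OF R(1)[of n]] proj_inner_nonneg[OF P R(1)[of n]] abs_triangle_ineq[of "P \<bullet> R n" "e n * (Z \<bullet> R n)"]
      by (simp add: A_def inner_add_left)
    finally show ?thesis by (simp add: proj_dist[OF P R(1)] algebra_simps)
  qed
  have lim: "(\<lambda>n. e n * (4 * kradius k Z)) \<longlonglongrightarrow> 0"
    using tendsto_mult_right[OF e0, of "4 * kradius k Z"] by simp
  have "eventually (\<lambda>n. norm ((norm (P - R n))\<^sup>2) \<le> e n * (4 * kradius k Z)) sequentially"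
    using bound by simp
  then have "(\<lambda>n. (norm (P - R n))\<^sup>2) \<longlonglongrightarrow> 0"
    using lim by (rule Lim_null_comparison)
  then have "(\<lambda>n. sqrt ((norm (P - R n))\<^sup>2)) \<longlonglongrightarrow> sqrt 0" by (rule tendsto_real_sqrt)
  then have "(\<lambda>n. P - R n) \<longlonglongrightarrow> 0"
    by (simp add: tendsto_norm_zero_iff)
  from tendsto_diff[OF tendsto_const[of P] this] have "R \<longlonglongrightarrow> P"
    by simp
  have "L B \<in> opt_cone k Q" if B: "B \<in> opt_cone k P" for B
  proof -
    obtain l X Y where d: "psd X" "psd Y" "P ** X ** P = X" "(mat 1 - P) ** Y ** (mat 1 - P) = Y"
        "B = l *\<^sub>R mat 1 + X - Y"
      using opt_cone_decomp[OF B P k] by blast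
    \<comment> \<open>The blocks \<open>X\<close> and \<open>Y\<close> of \<open>B\<close> are kept
      and only the compressing projections vary, so \<open>C n\<close> lies in the cone of
      \<open>R n\<close> and tends to \<open>B\<close>.\<close>
    define C where "C n = l *\<^sub>R mat 1 + R n ** X ** R n - (mat 1 - R n) ** Y ** (mat 1 - R n)" for n
    have "C \<longlonglongrightarrow> l *\<^sub>R mat 1 + P ** X ** P - (mat 1 - P) ** Y ** (mat 1 - P)"
      unfolding C_def by (intro tendsto_intros tendsto_matrix_mult \<open>R \<longlonglongrightarrow> P\<close>)
    then have "(\<lambda>n. L (C n)) \<longlonglongrightarrow> L B"
      using d lin by (auto simp: linear_conv_bounded_linear intro: bounded_linear.tendsto)
    moreover have "L (C n) \<in> opt_cone k Q" for n
      unfolding C_def by (rule img[OF opt_coneI[OF d(1,2) R(1) k']])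
    ultimately show ?thesis
      using closed_sequentially[OF closed_opt_cone, of "\<lambda>n. L (C n)"] by blast
  qed
  then show ?thesis using that Q(1) by blast
qed

text \<open>An inclusion of cones passes to their spans, which are the commutants. Injectivity of
  \<open>L\<close> and equality of dimensions then make it an equality.\<close>

lemma commutant_image:
  assumes P: "P \<in> proj k" and Q: "Q \<in> proj k" and sub: "L ` opt_cone k P \<subseteq> opt_cone k Q"
  shows "L ` commutant P = commutant Q"
proof -
  have com: "opt_cone k Q \<subseteq> commutant Q"
    using opt_cone_commute[OF _ Q k(1)] opt_coneD(1) by (auto simp: commutant_def)
  have "L A \<in> commutant Q" if A: "A \<in> commutant P" for A
  proof -
    obtain c where c: "A + c *\<^sub>R P \<in> opt_cone k P"
      using commutant_decomp[OF A P k'] by blast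
    have "L (A + c *\<^sub>R P) \<in> commutant Q" "L P \<in> commutant Q"
      using c proj_mem_opt_cone[OF P] sub com by blast+
    moreover have "L A = L (A + c *\<^sub>R P) - c *\<^sub>R L P" by (simp add: L_add L_scaleR)
    ultimately show ?thesis
      by (simp only: subspace_commutant subspace_diff subspace_scale)
  qed
  then have s: "L ` commutant P \<subseteq> commutant Q" by blast
  have "inj_on L (span (commutant P))"
    using L_inj unfolding span_eq_iff[THEN iffD2, OF subspace_commutant] by (auto simp: commutant_def inj_on_def)
  then have "dim (L ` commutant P) = dim (commutant P)"
    using dim_image_eq[OF lin] by blast
  then have "dim (L ` commutant P) \<ge> dim (commutant Q)"
    using dim_commutant_le[OF Q P] by simp
  then show ?thesis
    using subspace_dim_equal[OF linear_subspace_image[OF lin subspace_commutant] subspace_commutant s] by blast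
qed

text \<open>Equal images give equal commutants, leaving \<open>P' = mat 1 - P\<close> as the only
  alternative. Then \<open>L P\<close> and \<open>mat 1 - L P\<close> lie in one cone, hence so does
  \<open>- L P\<close>, and \<open>L P\<close> is scalar; by injectivity so is \<open>P\<close>, a
  contradiction.\<close>

lemma cone_source_unique:
  assumes P: "P \<in> proj k" "P' \<in> proj k" and Q: "Q \<in> proj k"
    and sub: "L ` opt_cone k P \<subseteq> opt_cone k Q" "L ` opt_cone k P' \<subseteq> opt_cone k Q"
  shows "P' = P"
proof -
  have "L ` commutant P = L ` commutant P'"
    using commutant_image[OF _ Q] P sub by simp
  moreover have "inj_on L herm" "commutant P \<subseteq> herm" "commutant P' \<subseteq> herm"
    using bij by (auto simp: bij_betw_def commutant_def)
  ultimately have "commutant P = commutant P'"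
    by (metis inj_on_image_eq_iff)
  then have "P' = P \<or> P' = mat 1 - P" by (rule commutant_eq_imp[OF P k])
  moreover have "P' \<noteq> mat 1 - P"
  proof
    assume eq: "P' = mat 1 - P"
    have 1: "L P \<in> opt_cone k Q" using proj_mem_opt_cone[OF P(1)] sub by blast
    have "mat 1 - L P \<in> opt_cone k Q"
      using proj_mem_opt_cone[OF P(2)] sub(2) by (auto simp: eq L_diff unital)
    then have "- L P \<in> opt_cone k Q"
      by (auto simp: opt_cone_def inner_diff_left mat1_inner_proj mat1_inner_proj[OF Q] L_herm herm_minus projD(1)[OF P(1)])
    from opt_cone_both_scalar[OF 1 this Q k] obtain c where "L P = c *\<^sub>R mat 1" by blast
    then have "L P = L (c *\<^sub>R mat 1)" by (simp add: L_scaleR unital)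
    then have Pc: "P = c *\<^sub>R mat 1"
      by (rule L_inj[OF projD(1)[OF P(1)] herm_scaleR[OF herm_mat1]])
    obtain x y where xy: "norm x = 1" "P *v x = x" "norm y = 1" "P *v y = 0"
      using proj_ran_ker[OF P(1) k] by blast
    then have "c *\<^sub>R x = x" "c *\<^sub>R y = 0" by (simp_all add: Pc matvec_scaleR_left)
    with xy show False by auto
  qed
  ultimately show ?thesis by blast
qed

text \<open>Perturb the preimage \<open>A\<close> of \<open>B\<close> by a small multiple of a
  preimage of \<open>Q\<close>. The image then has \<open>Q\<close> as unique maximiser, so any
  maximiser in the source has its cone mapped into that of \<open>Q\<close> and must be
  \<open>P\<close>. Letting the perturbation tend to 0 puts \<open>A\<close> in the cone of
  \<open>P\<close>.\<close>

lemma cone_image_eq: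
  assumes P: "P \<in> proj k"
  obtains Q where "Q \<in> proj k" "L ` opt_cone k P = opt_cone k Q"
proof -
  obtain Q where Q: "Q \<in> proj k" and sub: "L ` opt_cone k P \<subseteq> opt_cone k Q"
    using cone_image_subset[OF P] by blast
  have "B \<in> L ` opt_cone k P" if B: "B \<in> opt_cone k Q" for B
  proof -
    note hB = opt_coneD(1)[OF B]
    obtain A where A: "A \<in> herm" "L A = B" using L_surj[OF hB] by blast
    obtain Z where Z: "Z \<in> herm" "L Z = Q" using L_surj projD(1)[OF Q] by blast
    have opt: "(A + e *\<^sub>R Z) \<bullet> R \<le> (A + e *\<^sub>R Z) \<bullet> P" if e: "0 < e" and R: "R \<in> proj k" for e R
    proof -
      have hAe: "A + e *\<^sub>R Z \<in> herm" by (simp add: herm_intros A Z)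
      define t where "t = kradius k B + kradius k (A + e *\<^sub>R Z) + 1"
      define C where "C = A + e *\<^sub>R Z + t *\<^sub>R mat 1"
      have hC: "C \<in> herm" by (simp add: C_def herm_intros A Z)
      have nn: "0 \<le> kradius k B" "0 \<le> kradius k (A + e *\<^sub>R Z)"
        using kradius_nonneg[OF _ k'] hB hAe by blast+
      have LC: "L C = B + t *\<^sub>R mat 1 + (e * 1) *\<^sub>R Q"
        by (simp add: C_def L_add L_scaleR A Z unital)
      have "1 * ((B + t *\<^sub>R mat 1) \<bullet> Q) = kradius k (B + t *\<^sub>R mat 1)"
        using opt_cone_shift[OF B Q k(1) k'] nn by (simp add: t_def)
      from smooth_perturbation[OF _ Q k' _ this e]
      have sm: "S = Q" if "S \<in> proj k" "\<bar>L C \<bullet> S\<bar> = kradius k (L C)" for S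
        using that by (simp add: LC herm_intros hB)
      obtain P' where P': "P' \<in> proj k" "\<bar>C \<bullet> P'\<bar> = kradius k C"
        using kradius_attained[OF hC k'] by blast
      have "L ` opt_cone k P' \<subseteq> opt_cone k Q"
        using smooth_image_cone[OF hC P' sm] by blast
      then have "P' = P" using cone_source_unique[OF P P'(1) Q sub] by blast
      then have "\<bar>C \<bullet> R\<bar> \<le> \<bar>C \<bullet> P\<bar>"
        using kradius_ge[OF hC k' R] P'(2) by simp
      moreover have "t * k \<ge> t * 1" using nn k(1) by (intro mult_left_mono) (auto simp: t_def)
      then have "0 \<le> (A + e *\<^sub>R Z) \<bullet> P + t * k"
        using kradius_ge[OF hAe k' P] nn t_def by linarith
      ultimately show ?thesis
        by (simp add: C_def inner_add_left[of "A + e *\<^sub>R Z"] mat1_inner_proj[OF P] mat1_inner_proj[OF R])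
    qed
    have "A \<bullet> R \<le> A \<bullet> P" if R: "R \<in> proj k" for R
    proof -
      have "A \<bullet> R - A \<bullet> P \<le> e * (Z \<bullet> P - Z \<bullet> R)" if "0 < e" for e
        using opt[OF that R] by (simp add: inner_add_left algebra_simps)
      from nonpos_by_epsilon[OF this] show ?thesis by simp
    qed
    then have "A \<in> opt_cone k P" by (simp add: opt_cone_def A)
    then show ?thesis using A(2) by blast
  qed
  then show ?thesis using that Q sub by blast
qed

end

section \<open>Rank-one matrices modulo scalars\<close>

text \<open>Complementation exchanges ranks \<open>k\<close> and n - k and reverses the order of
  values. It transports cone statements from \<open>k = 1\<close> to n - 1.\<close>

lemma opt_cone_compl:
  fixes P :: "complex^'n^'n"
  assumes P: "P \<in> proj k" and k: "k \<le> CARD('n)"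
  shows "opt_cone (CARD('n) - k) (mat 1 - P) = uminus ` opt_cone k P"
proof -
  have "- A \<in> opt_cone (CARD('n) - k) (mat 1 - P) \<longleftrightarrow> A \<in> opt_cone k P" for A
  proof -
    have 1: "mat 1 - R \<in> proj (CARD('n) - k)" if "R \<in> proj k" for R :: "complex^'n^'n"
      by (rule proj_compl[OF that k])
    have 2: "mat 1 - R \<in> proj k" if "R \<in> proj (CARD('n) - k)" for R :: "complex^'n^'n"
      using proj_compl[OF that] k by simp
    have "(\<forall>R\<in>proj (CARD('n) - k). - A \<bullet> R \<le> - A \<bullet> (mat 1 - P)) \<longleftrightarrow> (\<forall>R\<in>proj k. A \<bullet> R \<le> A \<bullet> P)"
      (is "?l \<longleftrightarrow> ?r")
    proof
      assume l: ?l
      show ?r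
      proof
        fix R :: "complex^'n^'n" assume "R \<in> proj k"
        from l[rule_format, OF 1[OF this]] show "A \<bullet> R \<le> A \<bullet> P" by (simp add: inner_diff_right)
      qed
    next
      assume r: ?r
      show ?l
      proof
        fix R :: "complex^'n^'n" assume "R \<in> proj (CARD('n) - k)"
        from r[rule_format, OF 2[OF this]] show "- A \<bullet> R \<le> - A \<bullet> (mat 1 - P)" by (simp add: inner_diff_right)
      qed
    qed
    moreover have "- A \<in> herm \<longleftrightarrow> A \<in> herm" using herm_minus[of A] herm_minus[of "- A"] by auto
    ultimately show ?thesis by (simp add: opt_cone_def)
  qed
  then show ?thesis
    by (auto simp: image_iff) (metis minus_minus)
qed

text \<open>The component \<open>w\<close> of \<open>M *v x\<close> orthogonal to \<open>x\<close>
  is killed by \<open>M\<close>; self-adjointness then makes \<open>w\<close> orthogonal to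
  \<open>M *v x\<close>, hence to itself.\<close>

lemma herm_rank_one:
  assumes M: "M \<in> herm" and x: "norm x = 1" and 0: "\<And>w. cip x w = 0 \<Longrightarrow> M *v w = 0"
  shows "M = qf M x *\<^sub>R outer x"
proof (rule matrix_eq_matvec)
  fix v
  have dec: "M *v v = cip x v *s (M *v x)" for v
  proof -
    have "cip x (v - cip x v *s x) = 0" by (simp add: cip_simps cip_self_unit x)
    from 0[OF this] show ?thesis by (simp add: mv_simps)
  qed
  define w where "w = M *v x - cip x (M *v x) *s x"
  have xw: "cip x w = 0" by (simp add: w_def cip_simps cip_self_unit x)
  have "cip w (M *v x) = 0" using 0[OF xw] by (simp add: herm_cip[OF M, of w])
  moreover have "cip w x = 0" using xw by (simp add: cip_eq_0_commute[of w])
  ultimately have "cip w w = 0" by (subst (2) w_def) (simp add: cip_simps)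
  then have "M *v x = of_real (qf M x) *s x" by (simp add: w_def qf_of_real[OF M])
  then show "M *v v = (qf M x *\<^sub>R outer x) *v v"
    by (subst dec) (simp add: matvec_scaleR_left outer_matvec scaleR_eq_smult vector_smult_assoc mult.commute)
qed

lemma outer_not_scalar:
  fixes y :: "complex^'n"
  assumes "2 \<le> CARD('n)" "outer y = c *\<^sub>R mat 1"
  shows "y = 0"
proof -
  obtain w where w: "norm w = 1" "\<And>i. i \<in> {()} \<Longrightarrow> cip ((\<lambda>_. y) i) w = 0"
    using exists_unit_orthogonal[of "{()}" "\<lambda>_. y"] assms(1) by auto
  have "outer y *v w = c *\<^sub>R w" by (simp add: assms(2) matvec_scaleR_left)
  then have "c *\<^sub>R w = 0" using w(2) by (simp add: outer_matvec)
  then have "c = 0" using w(1) by auto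
  then have "cip y y *s y = 0" using assms(2) outer_matvec[of y y] by simp
  then show ?thesis by (simp add: vector_mul_eq_0)
qed

lemma outer_mem_opt_cone:
  fixes P :: "complex^'n^'n"
  assumes P: "P \<in> proj k" "P *v x = x" and k: "k \<le> CARD('n)"
  shows "outer x \<in> opt_cone k P"
proof -
  have "P ** outer x ** P = outer x"
    using conj_outer[of P x] P(2) by (simp add: projD[OF P(1)])
  then show ?thesis
    using opt_coneI[OF psd_outer[of x] psd_zero P(1) k, of 0] by (simp add: mm_simps)
qed

lemma proj_minus_outer_ran:
  assumes P: "P \<in> proj k" and x: "norm x = 1" "P *v x = x" and u: "(P - outer x) *v u = u"
  shows "P *v u = u" "cip x u = 0"
proof -
  have "P *v ((P - outer x) *v u) = (P - outer x) *v u"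
    by (simp add: mv_simps outer_matvec matrix_vector_mul_assoc projD[OF P]) (simp add: x flip: matrix_vector_mul_assoc)
  then show "P *v u = u" using u by simp
  then have "cip x u *s x = 0" using u by (simp add: mv_simps outer_matvec)
  then show "cip x u = 0" using x by (auto simp: vector_mul_eq_0)
qed

text \<open>Since \<open>k \<ge> 2\<close>, the range contains a unit \<open>u\<close> orthogonal to
  \<open>x\<close>. Evaluating the decomposition at \<open>u\<close> gives
  \<open>l + l' \<le> 0\<close>, and at a kernel vector \<open>z\<close> the reverse. With the
  scalar parts cancelling, positivity kills \<open>X\<close> on the range vectors orthogonal to
  \<open>x\<close> and \<open>Y\<close> on the whole kernel.\<close>

lemma opt_cone_extreme:
  fixes P :: "complex^'n^'n"
  assumes P: "P \<in> proj k" and k: "2 \<le> k" "k < CARD('n)" and x: "norm x = 1" "P *v x = x"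
    and G: "G \<in> opt_cone k P" and H: "H \<in> opt_cone k P" and GH: "G + H = outer x"
  obtains a b where "G = a *\<^sub>R outer x + b *\<^sub>R mat 1"
proof -
  have k1: "1 \<le> k" using k by simp
  obtain l X Y where d: "psd X" "psd Y" "P ** X ** P = X" "(mat 1 - P) ** Y ** (mat 1 - P) = Y"
      "G = l *\<^sub>R mat 1 + X - Y"
    using opt_cone_decomp[OF G P k1 k(2)] by blast
  obtain l' X' Y' where d': "psd X'" "psd Y'" "P ** X' ** P = X'" "(mat 1 - P) ** Y' ** (mat 1 - P) = Y'"
      "H = l' *\<^sub>R mat 1 + X' - Y'"
    using opt_cone_decomp[OF H P k1 k(2)] by blast
  have hC: "mat 1 - P \<in> herm" by (rule proj_compl_herm[OF P])
  have Yu: "qf Y u = 0" "qf Y' u = 0" if "P *v u = u" for u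
    using qf_sandwich[OF hC, of Y u] qf_sandwich[OF hC, of Y' u] that d(4) d'(4)
    by (simp_all add: matvec_compl) (simp_all add: qf_def)
  have Xz: "qf X z = 0" "qf X' z = 0" if "P *v z = 0" for z
    using qf_sandwich[OF projD(1)[OF P], of X z] qf_sandwich[OF projD(1)[OF P], of X' z] that d(3) d'(3)
    by (simp_all) (simp_all add: qf_def)
  have q: "(cmod (cip x v))\<^sup>2 = (l + l') * (norm v)\<^sup>2 + qf X v + qf X' v - qf Y v - qf Y' v" for v
  proof -
    have "qf (outer x) v = qf G v + qf H v" by (simp flip: GH qf_add)
    then show ?thesis by (simp add: d(5) d'(5) qf_simps algebra_simps)
  qed
  have pos: "0 \<le> qf X v" "0 \<le> qf X' v" "0 \<le> qf Y v" "0 \<le> qf Y' v" for v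
    using d d' by (simp_all add: psd_def)
  obtain m where m: "k = Suc m" "1 \<le> m" using k by (cases k) auto
  have "P - outer x \<in> proj m" using proj_diff_outer P m x by blast
  then obtain u where u: "norm u = 1" "(P - outer x) *v u = u"
    using proj_ran_ker[of "P - outer x" m] m k by auto
  note u' = proj_minus_outer_ran[OF P x u(2)]
  obtain z where z: "norm z = 1" "P *v z = 0" using proj_ran_ker[OF P k1 k(2)] by blast
  have xz: "cip x v = 0" if "P *v v = 0" for v
    using herm_cip[OF projD(1)[OF P], of x v] x that by simp
  have "l + l' \<le> 0" using q[of u] u u' Yu[OF u'(1)] pos[of u] by simp
  moreover have "l + l' \<ge> 0" using q[of z] z xz[OF z(2)] Xz[OF z(2)] pos[of z] by simp
  ultimately have ll: "l + l' = 0" by simp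
  have X0: "X *v v = 0" if "P *v v = v" "cip x v = 0" for v
    using q[of v] ll that Yu[OF that(1)] pos[of v] by (intro psd_eq_0[OF d(1)]) simp
  have Y0: "Y *v v = 0" if "P *v v = 0" for v
    using q[of v] ll that xz[OF that] Xz[OF that] pos[of v] by (intro psd_eq_0[OF d(2)]) simp
  have kill: "(G - l *\<^sub>R mat 1) *v w = 0" if w: "cip x w = 0" for w
  proof -
    have "cip x (P *v w) = 0" by (simp add: herm_cip[OF projD(1)[OF P]] x w)
    then have "X *v (P *v w) = 0" by (intro X0) (simp_all add: matrix_vector_mul_assoc projD[OF P])
    then have "P *v (X *v (P *v w)) = 0" by simp
    then have 1: "X *v w = 0" using d(3) by (simp add: matrix_vector_mul_assoc matrix_mul_assoc)
    have "Y *v ((mat 1 - P) *v w) = 0"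
      by (intro Y0) (simp add: mv_simps matrix_vector_mul_assoc projD[OF P])
    then have "(mat 1 - P) *v (Y *v ((mat 1 - P) *v w)) = 0" by simp
    then have 2: "Y *v w = 0" using d(4) by (simp add: matrix_vector_mul_assoc matrix_mul_assoc)
    show ?thesis by (simp add: d(5) mv_simps 1 2)
  qed
  have "G - l *\<^sub>R mat 1 \<in> herm" using opt_coneD(1)[OF G] by (simp add: herm_intros)
  from herm_rank_one[OF this x(1) kill]
  have "G = qf (G - l *\<^sub>R mat 1) x *\<^sub>R outer x + l *\<^sub>R mat 1" by (simp add: algebra_simps)
  then show ?thesis by (rule that)
qed

text \<open>Evaluating the quadratic form at \<open>y i\<close> shows \<open>l \<ge> a i\<close> when \<open>a i > 0\<close>; comparing traces turns
  these inequalities into equalities.\<close>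

lemma weighted_frame_pos:
  fixes y :: "'n \<Rightarrow> complex^'n"
  assumes sum: "(\<Sum>i\<in>UNIV. a i *\<^sub>R outer (y i)) = l *\<^sub>R mat 1" and y: "\<And>i. norm (y i) = 1"
    and nz: "\<And>i. a i \<noteq> 0" and cross: "\<And>i j. 0 < a i \<Longrightarrow> a j < 0 \<Longrightarrow> cip (y i) (y j) = 0"
    and i0: "0 < a i0"
  shows "(\<forall>i. a i = l) \<and> onb y"
proof -
  have cross': "cip (y j) (y i) = 0" if "0 < a i" "a j < 0" for i j
    using cross[OF that] by (simp add: cip_eq_0_commute[of "y j"])
  have q: "(\<Sum>j\<in>UNIV. a j * (cmod (cip (y j) (y i)))\<^sup>2) = l" for i
    using arg_cong[OF sum, of "\<lambda>A. qf A (y i)"] by (simp add: qf_sum qf_simps y)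
  have split: "l = a i + (\<Sum>j\<in>UNIV - {i}. a j * (cmod (cip (y j) (y i)))\<^sup>2)" for i
    using q[of i] sum.remove[of UNIV i "\<lambda>j. a j * (cmod (cip (y j) (y i)))\<^sup>2"] by (simp add: cip_self_unit y)
  have le: "a i \<le> l" if "0 < a i" for i
  proof -
    have "0 \<le> (\<Sum>j\<in>UNIV - {i}. a j * (cmod (cip (y j) (y i)))\<^sup>2)"
    proof (rule sum_nonneg)
      fix j show "0 \<le> a j * (cmod (cip (y j) (y i)))\<^sup>2"
        using cross'[OF that, of j] by (cases "0 \<le> a j") auto
    qed
    with split[of i] show ?thesis by simp
  qed
  have ge: "l \<le> a i" if "a i < 0" for i
  proof -
    have "(\<Sum>j\<in>UNIV - {i}. a j * (cmod (cip (y j) (y i)))\<^sup>2) \<le> 0"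
    proof (rule sum_nonpos)
      fix j show "a j * (cmod (cip (y j) (y i)))\<^sup>2 \<le> 0"
        using cross[OF _ that, of j] by (cases "a j \<le> 0") (auto simp: mult_nonpos_nonneg)
    qed
    with split[of i] show ?thesis by simp
  qed
  have l: "l > 0" using le[OF i0] i0 by simp
  have pos: "0 < a i" for i using ge[of i] nz[of i] l by force
  have "(\<Sum>i\<in>UNIV. a i) = (\<Sum>i\<in>(UNIV :: 'n set). l)"
  proof -
    have "(\<Sum>i\<in>UNIV. complex_of_real (a i)) = of_real l * of_nat CARD('n)"
      using arg_cong[OF sum, of trace] by (simp add: trace_sum trace_scaleR trace_outer cip_self_unit y trace_mat1)
    then have "complex_of_real (\<Sum>i\<in>UNIV. a i) = of_real (l * real CARD('n))" by simp
    then have "(\<Sum>i\<in>UNIV. a i) = l * real CARD('n)" by (simp only: of_real_eq_iff)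
    then show ?thesis by simp
  qed
  then have "(\<Sum>i\<in>(UNIV :: 'n set). l - a i) = 0" by (simp only: sum_subtractf)
  then have al: "a i = l" for i
    using le[OF pos] by (subst (asm) sum_nonneg_eq_0_iff) auto
  have "cip (y j) (y i) = 0" if "j \<noteq> i" for i j
  proof -
    have "(\<Sum>j\<in>UNIV - {i}. l * (cmod (cip (y j) (y i)))\<^sup>2) = 0" using split[of i] by (simp add: al)
    then have "\<forall>j\<in>UNIV - {i}. l * (cmod (cip (y j) (y i)))\<^sup>2 = 0"
      using l by (subst (asm) sum_nonneg_eq_0_iff) auto
    then show ?thesis using that l by auto
  qed
  then show ?thesis using al by (auto simp: onb_def cip_self_unit y)
qed

text \<open>Without a positive weight all weights are negative, and flipping every sign reduces to
  the previous case.\<close>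

lemma weighted_frame:
  fixes y :: "'n \<Rightarrow> complex^'n"
  assumes sum: "(\<Sum>i\<in>UNIV. a i *\<^sub>R outer (y i)) = l *\<^sub>R mat 1" and y: "\<And>i. norm (y i) = 1"
    and nz: "\<And>i. a i \<noteq> 0" and cross: "\<And>i j. 0 < a i \<Longrightarrow> a j < 0 \<Longrightarrow> cip (y i) (y j) = 0"
  shows "(\<forall>i. a i = l) \<and> onb y"
proof (cases "\<exists>i. 0 < a i")
  case True
  then show ?thesis using weighted_frame_pos[OF assms] by blast
next
  case False
  obtain i :: 'n where True by simp
  have "(\<Sum>i\<in>UNIV. (- a i) *\<^sub>R outer (y i)) = (- l) *\<^sub>R mat 1"
    using sum by (simp add: sum_negf)
  from weighted_frame_pos[OF this y, of i] show ?thesis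
    using False nz cross by (force simp: cip_eq_0_commute not_less le_less)
qed

text \<open>Only the permutation of cones is retained from parallelism, because it survives the
  exchange of \<open>k\<close> for n - k. The bounds on \<open>k\<close> imply that n is at least
  3.\<close>

locale cone_preserver =
  fixes L :: "complex^'n^'n \<Rightarrow> complex^'n^'n" and k :: nat
  assumes lin: "linear L" and bij: "bij_betw L herm herm"
    and k: "2 \<le> k" "k < CARD('n)"
    and unital: "L (mat 1) = mat 1"
    and cones: "P \<in> proj k \<Longrightarrow> \<exists>Q\<in>proj k. L ` opt_cone k P = opt_cone k Q"
begin

lemma k': "k \<le> CARD('n)" and k1: "1 \<le> k" and n2: "2 \<le> CARD('n)" using k by simp_all

lemma L_inj: "A \<in> herm \<Longrightarrow> B \<in> herm \<Longrightarrow> L A = L B \<Longrightarrow> A = B"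
  using bij unfolding bij_betw_def by (metis inj_onD)

lemmas L_add = linear_add[OF lin] and L_scaleR = linear_scale[OF lin] and L_sum = linear_sum[OF lin]

text \<open>The coefficient \<open>a\<close> may be negative: the image of a rank-one matrix may lie
  in the negative kernel block of the target cone.\<close>

definition ray :: "complex^'n \<Rightarrow> real \<Rightarrow> complex^'n \<Rightarrow> real \<Rightarrow> bool" where
  "ray x a y b \<longleftrightarrow> norm y = 1 \<and> a \<noteq> 0 \<and> L (outer x) = a *\<^sub>R outer y + b *\<^sub>R mat 1"

text \<open>Pulling the two summands of \<open>L (outer x)\<close> back to the cone of
  \<open>P\<close> splits \<open>outer x\<close> itself. Extremality makes the preimage of the
  rank-one summand a combination of \<open>outer x\<close> and the identity, which is then solved
  for \<open>L (outer x)\<close>.\<close>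

lemma ray_exists_aux:
  assumes P: "P \<in> proj k" and x: "norm x = 1" "P *v x = x" and im: "L ` opt_cone k P = opt_cone k Q"
    and y: "y \<noteq> 0" and s: "s \<noteq> 0"
    and G: "s *\<^sub>R outer y \<in> opt_cone k Q" and H: "L (outer x) - s *\<^sub>R outer y \<in> opt_cone k Q"
  shows "\<exists>a y b. ray x a y b"
proof -
  obtain G' where G': "G' \<in> opt_cone k P" "L G' = s *\<^sub>R outer y" using G im by (metis imageE)
  obtain H' where H': "H' \<in> opt_cone k P" "L H' = L (outer x) - s *\<^sub>R outer y" using H im by (metis imageE)
  have "L (G' + H') = L (outer x)" by (simp add: L_add G' H')
  then have "G' + H' = outer x"
    by (rule L_inj[OF herm_add[OF opt_coneD(1)[OF G'(1)] opt_coneD(1)[OF H'(1)]] herm_outer])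
  from opt_cone_extreme[OF P k x G'(1) H'(1) this]
  obtain a b where ab: "G' = a *\<^sub>R outer x + b *\<^sub>R mat 1" by blast
  have eq: "s *\<^sub>R outer y = a *\<^sub>R L (outer x) + b *\<^sub>R mat 1"
    using G'(2) by (simp add: ab L_add L_scaleR unital)
  have "a \<noteq> 0"
  proof
    assume "a = 0"
    then have "(1 / s) *\<^sub>R (s *\<^sub>R outer y) = (1 / s) *\<^sub>R (b *\<^sub>R mat 1)" using eq by simp
    then have "outer y = (b / s) *\<^sub>R mat 1" using s by simp
    then show False using outer_not_scalar[OF n2] y by blast
  qed
  have "L (outer x) = (1 / a) *\<^sub>R (a *\<^sub>R L (outer x))" using \<open>a \<noteq> 0\<close> by simp
  also have "a *\<^sub>R L (outer x) = s *\<^sub>R outer y - b *\<^sub>R mat 1" using eq by simp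
  finally have 1: "L (outer x) = (s / a) *\<^sub>R outer y + (- b / a) *\<^sub>R mat 1"
    using s by (simp add: scaleR_diff_right)
  obtain r where r: "norm (r *\<^sub>R y) = 1" "r > 0" using cip_nonzero_normalize y by blast
  have "ray x (s / a / r\<^sup>2) (r *\<^sub>R y) (- b / a)"
    unfolding ray_def 1 outer_scaleR using r s \<open>a \<noteq> 0\<close> by simp
  then show ?thesis by blast
qed

text \<open>Of the two blocks of \<open>L (outer x)\<close> at least one is nonzero, as otherwise
  \<open>outer x\<close> would be scalar by injectivity. A rank-one piece split off that block stays
  in the cone, as does the remainder; for the kernel block its sign is negative.\<close>

lemma ray_exists:
  assumes x: "norm x = 1"
  shows "\<exists>a y b. ray x a y b"
proof -
  obtain P where P: "P \<in> proj k" "P *v x = x" using proj_contains[OF x k1 k'] by blast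
  obtain Q where Q: "Q \<in> proj k" "L ` opt_cone k P = opt_cone k Q" using cones P(1) by blast
  have LC: "L (outer x) \<in> opt_cone k Q" using Q(2) outer_mem_opt_cone[OF P k'] by blast
  obtain l X Y where d: "psd X" "psd Y" "Q ** X ** Q = X" "(mat 1 - Q) ** Y ** (mat 1 - Q) = Y"
      "L (outer x) = l *\<^sub>R mat 1 + X - Y"
    using opt_cone_decomp[OF LC Q(1) k1 k(2)] by blast
  have QX: "Q *v (X *v v) = X *v v" for v
    using d(3) projD(3)[OF Q(1)] by (metis matrix_mul_assoc matrix_vector_mul_assoc)
  have CC: "(mat 1 - Q) ** (mat 1 - Q) = mat 1 - Q" by (simp add: mm_simps projD[OF Q(1)])
  have CY: "(mat 1 - Q) *v (Y *v v) = Y *v v" for v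
    using d(4) CC by (metis matrix_mul_assoc matrix_vector_mul_assoc)
  have sQ: "Q ** outer (X *v v) ** Q = outer (X *v v)" for v
    using conj_outer[of Q "X *v v"] by (simp add: projD[OF Q(1)] QX)
  have sC: "(mat 1 - Q) ** outer (Y *v v) ** (mat 1 - Q) = outer (Y *v v)" for v
    using conj_outer[of "mat 1 - Q" "Y *v v"] by (simp only: hermD[OF proj_compl_herm[OF Q(1)]] CY)
  consider v where "0 < qf X v" | v where "0 < qf Y v" | "\<forall>v. qf X v \<le> 0" "\<forall>v. qf Y v \<le> 0"
    by (meson not_le)
  then show ?thesis
  proof cases
    case 1
    let ?c = "1 / qf X v" and ?y = "X *v v"
    have "?y \<noteq> 0" using 1 by (auto simp: qf_def)
    moreover have "?c *\<^sub>R outer ?y \<in> opt_cone k Q"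
      using opt_coneI[OF psd_scaleR[OF _ psd_outer[of ?y], of ?c] psd_zero Q(1) k', of 0] 1
      by (simp add: mm_simps sQ)
    moreover have "l *\<^sub>R mat 1 + (X - ?c *\<^sub>R outer ?y) - Y \<in> opt_cone k Q"
      using opt_coneI[OF psd_split_outer[OF d(1) 1] d(2) Q(1) k', of l]
      by (simp only: d(3,4) matrix_diff_ldistrib[of Q] matrix_diff_rdistrib[of _ _ Q] matrix_scaleR_left matrix_scaleR_right sQ)
    then have "L (outer x) - ?c *\<^sub>R outer ?y \<in> opt_cone k Q"
      by (simp add: d(5) algebra_simps)
    ultimately show ?thesis
      using ray_exists_aux[OF P(1) x P(2) Q(2), of ?y ?c] 1 by simp
  next
    case 2
    let ?c = "1 / qf Y v" and ?y = "Y *v v"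
    have "?y \<noteq> 0" using 2 by (auto simp: qf_def)
    moreover have "(- ?c) *\<^sub>R outer ?y \<in> opt_cone k Q"
      using opt_coneI[OF psd_zero psd_scaleR[OF _ psd_outer[of ?y], of ?c] Q(1) k', of 0] 2
      by (simp add: matrix_scaleR_left matrix_scaleR_right sC)
    moreover have "l *\<^sub>R mat 1 + X - (Y - ?c *\<^sub>R outer ?y) \<in> opt_cone k Q"
      using opt_coneI[OF d(1) psd_split_outer[OF d(2) 2] Q(1) k', of l]
      by (simp only: d(3,4) matrix_diff_ldistrib[of "mat 1 - Q" Y] matrix_diff_rdistrib[of _ _ "mat 1 - Q"]
          matrix_scaleR_left matrix_scaleR_right sC)
    then have "L (outer x) - (- ?c) *\<^sub>R outer ?y \<in> opt_cone k Q"
      by (simp add: d(5) algebra_simps)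
    ultimately show ?thesis
      using ray_exists_aux[OF P(1) x P(2) Q(2), of ?y "- ?c"] 2 by simp
  next
    case 3
    have "X = 0" "Y = 0"
      using 3 d(1,2) by (auto intro!: herm_eqI simp: psd_def herm_0 qf_def[of 0] intro: antisym)
    then have "L (outer x) = L (l *\<^sub>R mat 1)" by (simp add: d(5) L_scaleR unital)
    then have "outer x = l *\<^sub>R mat 1" by (rule L_inj[OF herm_outer herm_scaleR[OF herm_mat1]])
    then show ?thesis using outer_not_scalar[OF n2] x by fastforce
  qed
qed

text \<open>Cone elements commute with \<open>Q\<close>, so \<open>y\<close> lies in the range or
  the kernel of \<open>Q\<close>. The sign of \<open>a\<close> decides which, because form values on
  the range dominate those on the kernel.\<close>

lemma ray_sign:
  assumes r: "ray x a y b" and P: "P \<in> proj k" "P *v x = x" and x: "norm x = 1"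
    and Q: "Q \<in> proj k" "L ` opt_cone k P = opt_cone k Q"
  shows "0 < a \<Longrightarrow> Q *v y = y" "a < 0 \<Longrightarrow> Q *v y = 0"
proof -
  have y: "norm y = 1" and a: "a \<noteq> 0" and Lx: "L (outer x) = a *\<^sub>R outer y + b *\<^sub>R mat 1"
    using r by (auto simp: ray_def)
  have C: "a *\<^sub>R outer y + b *\<^sub>R mat 1 \<in> opt_cone k Q"
    using Q(2) Lx outer_mem_opt_cone[OF P k'] by (metis image_eqI)
  have "a *\<^sub>R (Q ** outer y) = a *\<^sub>R (outer y ** Q)"
    using opt_cone_commute[OF C Q(1) k1, symmetric] by (simp add: mm_simps)
  then have "Q ** outer y = outer y ** Q" using a by simp
  then have e: "Q *v y = y \<or> Q *v y = 0" by (rule proj_commute_outer[OF Q(1)])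
  obtain u v where uv: "norm u = 1" "Q *v u = u" "norm v = 1" "Q *v v = 0"
    using proj_ran_ker[OF Q(1) k1 k(2)] by blast
  note var = opt_cone_variation(1)[OF C Q(1) k1]
  have orth: "cip s t = 0" "cip t s = 0" if "Q *v s = s" "Q *v t = 0" for s t
  proof -
    show "cip s t = 0" using herm_cip[OF projD(1)[OF Q(1)], of s t] that by simp
    then show "cip t s = 0" by (simp add: cip_eq_0_commute[of t])
  qed
  show "Q *v y = y" if "0 < a"
  proof (rule ccontr)
    assume "Q *v y \<noteq> y"
    with e have "Q *v y = 0" by simp
    then show False
      using var[OF uv(1,2) y] that orth(2)[OF uv(2)] by (simp add: qf_simps cip_self_unit y uv)
  qed
  show "Q *v y = 0" if "a < 0"
  proof (rule ccontr)
    assume "Q *v y \<noteq> 0"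
    with e have "Q *v y = y" by simp
    then show False
      using var[OF y _ uv(3,4)] that orth(1)[OF _ uv(4)] by (simp add: qf_simps cip_self_unit y uv)
  qed
qed

text \<open>Applying \<open>L\<close> to the resolution of the identity gives a weighted one. Since
  \<open>k \<ge> 2\<close>, any two basis vectors lie in the range of one rank-\<open>k\<close>
  projection, so images with weights of opposite sign lie in the range and the kernel of a common
  \<open>Q\<close> and are orthogonal.\<close>

lemma ray_onb:
  assumes u: "onb u" and r: "\<And>i. ray (u i) (a i) (y i) (b i)"
  shows "(\<forall>i j. a i = a j) \<and> onb y"
proof -
  have "L (\<Sum>i\<in>UNIV. outer (u i)) = (\<Sum>i\<in>UNIV. a i *\<^sub>R outer (y i)) + (\<Sum>i\<in>UNIV. b i) *\<^sub>R mat 1"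
    using r by (simp add: L_sum ray_def sum.distrib scaleR_sum_left)
  then have sum: "(\<Sum>i\<in>UNIV. a i *\<^sub>R outer (y i)) = (1 - (\<Sum>i\<in>UNIV. b i)) *\<^sub>R mat 1"
    by (simp add: sum_outer_onb[OF u] unital algebra_simps)
  have cross: "cip (y i) (y j) = 0" if a: "0 < a i" "a j < 0" for i j
  proof -
    have "i \<noteq> j" using a by auto
    then have "card {i, j} = 2" by simp
    then obtain S where S: "{i, j} \<subseteq> S" "card S = k"
      using exists_subset_between[of "{i, j}" k UNIV] k k' by auto
    let ?P = "\<Sum>i\<in>S. outer (u i)"
    have P: "?P \<in> proj k" using proj_sum_outer[OF onb_ortho_on[OF u], of S] S by simp
    have Pi: "?P *v u i = u i" "?P *v u j = u j" using S by (auto simp: onb_sum_outer_matvec[OF u])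
    obtain Q where Q: "Q \<in> proj k" "L ` opt_cone k ?P = opt_cone k Q" using cones P by blast
    have "Q *v y i = y i" by (rule ray_sign(1)[OF r P Pi(1) onb_norm[OF u] Q a(1)])
    moreover have "Q *v y j = 0" by (rule ray_sign(2)[OF r P Pi(2) onb_norm[OF u] Q a(2)])
    ultimately show ?thesis using herm_cip[OF projD(1)[OF Q(1)], of "y i" "y j"] by simp
  qed
  have "norm (y i) = 1" "a i \<noteq> 0" for i using r by (auto simp: ray_def)
  from weighted_frame[OF sum this cross] show ?thesis by auto
qed

text \<open>In dimension at least 3 some unit \<open>w\<close> is orthogonal to both
  \<open>x\<close> and \<open>x'\<close>. Completing \<open>x\<close>, \<open>w\<close> and
  \<open>x'\<close>, \<open>w\<close> to bases makes both coefficients equal to that of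
  \<open>w\<close>.\<close>

lemma ray_const:
  assumes x: "norm x = 1" "norm x' = 1" and r: "ray x a y b" "ray x' a' y' b'"
  shows "a = a'"
proof -
  obtain w where w: "norm w = 1" "\<And>i. i \<in> {True, False} \<Longrightarrow> cip (if i then x else x') w = 0"
    using exists_unit_orthogonal[of "{True, False}" "\<lambda>i. if i then x else x'"] k by auto
  obtain c z d where rw: "ray w c z d" using ray_exists[OF w(1)] by blast
  obtain i j :: 'n where ij: "i \<noteq> j" using n2 by (metis UNIV_I card_2_iff' card_le_Suc_iff ex_card)
  have *: "a = c" if xx: "norm x = 1" "cip x w = 0" "ray x a y b" for x a y b
  proof -
    obtain u where u: "onb u" "u i = x" "u j = w" using onb_contains2[OF xx(1) w(1) xx(2) ij] by blast
    have "\<forall>l. \<exists>a' y' b'. ray (u l) a' y' b' \<and> (l = i \<longrightarrow> a' = a) \<and> (l = j \<longrightarrow> a' = c)"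
      using u ij xx(3) rw ray_exists[OF onb_norm[OF u(1)]] by metis
    then obtain A Y B where "\<And>l. ray (u l) (A l) (Y l) (B l)" "A i = a" "A j = c" by metis
    with ray_onb[OF u(1)] show ?thesis by metis
  qed
  from *[OF x(1) _ r(1)] *[OF x(2) _ r(2)] w(2)[of True] w(2)[of False] show ?thesis by simp
qed

lemma rank_one_form:
  obtains c f \<psi> where "c \<noteq> (0 :: real)" "linear f" "linear \<psi>" "\<And>A. L A = c *\<^sub>R \<psi> A + f A *\<^sub>R mat 1"
    "\<And>x. norm x = 1 \<Longrightarrow> \<exists>y. norm y = 1 \<and> \<psi> (outer x) = outer y"
    "\<And>u y. onb u \<Longrightarrow> \<forall>i. norm (y i) = 1 \<and> \<psi> (outer (u i)) = outer (y i) \<Longrightarrow> onb y"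
proof -
  obtain x0 :: "complex^'n" where x0: "norm x0 = 1" using vector_choose_size[of 1] by auto
  obtain c y0 b0 where r0: "ray x0 c y0 b0" using ray_exists[OF x0] by blast
  have c: "c \<noteq> 0" using r0 by (simp add: ray_def)
  \<comment> \<open>This is the linear choice that makes the real trace of \<open>\<psi> A\<close>
    equal to that of \<open>A\<close>; on \<open>outer x\<close> it recovers the coefficient
    \<open>b\<close>.\<close>
  define f where "f A = (Re (trace (L A)) - c * Re (trace A)) / CARD('n)" for A
  define \<psi> where "\<psi> A = (1 / c) *\<^sub>R (L A - f A *\<^sub>R mat 1)" for A
  have f: "linear f"
    by (rule linearI) (simp_all add: f_def L_add L_scaleR trace_add trace_scaleR add_divide_distrib diff_divide_distrib algebra_simps)
  have \<psi>: "linear \<psi>"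
    by (rule linearI) (simp_all add: \<psi>_def L_add L_scaleR linear_add[OF f] linear_scale[OF f] algebra_simps)
  have form: "L A = c *\<^sub>R \<psi> A + f A *\<^sub>R mat 1" for A
    using c by (simp add: \<psi>_def)
  show ?thesis
  proof (rule that[OF c f \<psi> form])
    fix x :: "complex^'n" assume x: "norm x = 1"
    obtain a y b where r: "ray x a y b" using ray_exists[OF x] by blast
    have "a = c" by (rule ray_const[OF x x0 r r0])
    then have y: "norm y = 1" and Lx: "L (outer x) = c *\<^sub>R outer y + b *\<^sub>R mat 1"
      using r by (auto simp: ray_def)
    have "f (outer x) = b"
      by (simp add: f_def Lx trace_add trace_scaleR trace_outer cip_self_unit x y trace_mat1)
    then have "\<psi> (outer x) = outer y" using c by (simp add: \<psi>_def Lx)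
    with y show "\<exists>y. norm y = 1 \<and> \<psi> (outer x) = outer y" by blast
  next
    fix u y assume u: "onb u" and y: "\<forall>i. norm (y i) = 1 \<and> \<psi> (outer (u i)) = outer (y i)"
    have "ray (u i) c (y i) (f (outer (u i)))" for i
      using y c form[of "outer (u i)"] by (simp add: ray_def)
    from ray_onb[OF u this] show "onb y" by blast
  qed
qed

end

section \<open>Rank-one preserving maps\<close>

text \<open>In matrix units, this is \<open>w E_ij + cnj w E_ji\<close>. These matrices span the
  Hermitian ones over the reals, including the diagonal: for \<open>i = j\<close> the two terms add
  up to \<open>2 Re w E_ii\<close>.\<close>

definition off_unit :: "'n \<Rightarrow> 'n \<Rightarrow> complex \<Rightarrow> complex^'n^'n" where
  "off_unit i j w = (\<chi> a b. of_bool (a = i) * of_bool (b = j) * w + of_bool (a = j) * of_bool (b = i) * cnj w)"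

lemma off_unit_nth:
  "off_unit i j w $ a $ b = of_bool (a = i) * of_bool (b = j) * w + of_bool (a = j) * of_bool (b = i) * cnj w"
  by (simp add: off_unit_def)

lemma off_unit_add: "off_unit i j (v + w) = off_unit i j v + off_unit i j w"
  by (simp add: vec_eq_iff off_unit_nth algebra_simps)

lemma off_unit_scaleR: "off_unit i j (r *\<^sub>R w) = r *\<^sub>R off_unit i j w"
  by (simp add: vec_eq_iff off_unit_nth scaleR_add_right)

lemma off_unit_0: "off_unit i j 0 = 0"
  by (simp add: vec_eq_iff off_unit_nth)

lemma off_unit_commute: "off_unit j i (cnj w) = off_unit i j w"
  by (simp add: vec_eq_iff off_unit_nth mult_ac add.commute)

lemma transpose_off_unit: "transpose (off_unit i j w) = off_unit i j (cnj w)"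
  by (simp add: vec_eq_iff off_unit_nth transpose_def mult_ac add.commute)

lemma axis_nth: "axis i (1 :: complex) $ a = of_bool (a = i)"
  by (simp add: axis_def)

lemma outer_axis_nth: "outer (axis i 1) $ a $ b = of_bool (a = i) * of_bool (b = i)"
  by (simp add: outer_nth axis_nth)

lemma off_unit_diag: "off_unit i i w = (2 * Re w) *\<^sub>R outer (axis i 1)"
proof -
  have "off_unit i i w $ a $ b = ((2 * Re w) *\<^sub>R outer (axis i 1)) $ a $ b" for a b
    by (cases "a = i"; cases "b = i")
      (simp_all add: off_unit_nth outer_axis_nth complex_add_cnj scaleR_conv_of_real[where 'a = complex])
  then show ?thesis by (simp add: vec_eq_iff)
qed

text \<open>The sum over ordered pairs meets every entry twice, once directly and once as the
  conjugate of its mirror entry; hence the factor one half.\<close>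

lemma herm_off_unit_expansion:
  fixes A :: "complex^'n^'n"
  assumes "A \<in> herm"
  shows "A = (1 / 2) *\<^sub>R (\<Sum>i\<in>UNIV. \<Sum>j\<in>UNIV. off_unit i j (A $ i $ j))"
proof -
  have "(\<Sum>i\<in>UNIV. \<Sum>j\<in>UNIV. off_unit i j (A $ i $ j)) $ a $ b = 2 * A $ a $ b" for a b
  proof -
    have "(\<Sum>i\<in>UNIV. \<Sum>j\<in>UNIV. off_unit i j (A $ i $ j)) $ a $ b
        = (\<Sum>i\<in>UNIV. \<Sum>j\<in>UNIV. (if i = a then if j = b then A $ i $ j else 0 else 0)
          + (if j = a then if i = b then cnj (A $ i $ j) else 0 else 0))"
    proof -
      have "of_bool (a = i) * of_bool (b = j) * x = (if i = a then if j = b then x else 0 else 0)" for i j and x :: complex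
        by (cases "a = i"; cases "b = j") auto
      then have "off_unit i j (A $ i $ j) $ a $ b = (if i = a then if j = b then A $ i $ j else 0 else 0)
          + (if j = a then if i = b then cnj (A $ i $ j) else 0 else 0)" for i j
        by (simp only: off_unit_nth)
      then show ?thesis by (simp only: sum_component)
    qed
    also have "\<dots> = (\<Sum>i\<in>UNIV. \<Sum>j\<in>UNIV. (if i = a then if j = b then A $ i $ j else 0 else 0))
        + (\<Sum>i\<in>UNIV. \<Sum>j\<in>UNIV. (if j = a then if i = b then cnj (A $ i $ j) else 0 else 0))"
      by (simp only: sum.distrib)
    also have "(\<Sum>i\<in>UNIV. \<Sum>j\<in>UNIV. (if i = a then if j = b then A $ i $ j else 0 else 0)) = A $ a $ b"
      by (subst sum.swap) simp
    also have "(\<Sum>i\<in>UNIV. \<Sum>j\<in>UNIV. (if j = a then if i = b then cnj (A $ i $ j) else 0 else 0)) = cnj (A $ b $ a)"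
      by simp
    finally show ?thesis by (simp add: herm_nth[OF assms])
  qed
  then show ?thesis by (simp add: vec_eq_iff)
qed

lemma linear_eq_on_off_unit:
  fixes f g :: "complex^'n^'n \<Rightarrow> complex^'n^'n"
  assumes f: "linear f" and g: "linear g" and eq: "\<And>i j w. f (off_unit i j w) = g (off_unit i j w)"
    and A: "A \<in> herm"
  shows "f A = g A"
  by (subst (1 2) herm_off_unit_expansion[OF A])
    (simp add: linear_scale[OF f] linear_scale[OF g] linear_sum[OF f] linear_sum[OF g] eq)

lemma outer_add: "outer (x + y) = outer x + outer y + (\<chi> a b. x $ a * cnj (y $ b) + y $ a * cnj (x $ b))"
  by (simp add: vec_eq_iff outer_nth algebra_simps)

lemma outer_two:
  "outer (w *s axis i 1 + axis j 1) = (cmod w)\<^sup>2 *\<^sub>R outer (axis i 1) + outer (axis j 1) + off_unit i j w"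
  unfolding outer_add outer_smult
  by (simp add: vec_eq_iff off_unit_nth axis_nth mult_ac)

lemma outer_three:
  "outer (w *s axis i 1 + axis j 1 + axis l 1) = (cmod w)\<^sup>2 *\<^sub>R outer (axis i 1) + outer (axis j 1)
    + outer (axis l 1) + off_unit i j w + off_unit i l w + off_unit j l 1"
  unfolding outer_add outer_smult
  by (simp add: vec_eq_iff off_unit_nth axis_nth algebra_simps)

text \<open>Real linear isometries of the plane are rotations or reflections. The ratio
  \<open>z\<close> of \<open>q i\<close> to \<open>q 1\<close> has modulus 1, and the norm at
  \<open>1 + i\<close> forces its real part to vanish. The value at \<open>i\<close> is recorded
  because it tells the two cases apart.\<close>

lemma real_isometry_complex:
  fixes q :: "complex \<Rightarrow> complex"
  assumes q: "linear q" and n: "\<And>w. cmod (q w) = cmod w"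
  shows "(q \<i> = \<i> * q 1 \<and> (\<forall>w. q w = q 1 * w)) \<or> (q \<i> = - \<i> * q 1 \<and> (\<forall>w. q w = q 1 * cnj w))"
proof -
  have form: "q w = Re w * q 1 + Im w * q \<i>" for w
  proof -
    have "q w = q (Re w *\<^sub>R 1 + Im w *\<^sub>R \<i>)"
      by (rule arg_cong[of _ _ q]) (simp add: complex_eq_iff)
    then show ?thesis
      unfolding linear_add[OF q] linear_scale[OF q] by (simp add: scaleR_conv_of_real)
  qed
  define z where "z = q \<i> * cnj (q 1)"
  have n1: "q 1 * cnj (q 1) = 1" using n[of 1] by (simp flip: complex_norm_square)
  then have qi: "q \<i> = z * q 1" by (simp add: z_def mult_ac)
  have "cmod z = 1" by (simp add: z_def norm_mult n)
  then have 1: "(Re z)\<^sup>2 + (Im z)\<^sup>2 = 1" by (simp add: cmod_power2[symmetric])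
  have "q (1 + \<i>) = (1 + z) * q 1" using form[of "1 + \<i>"] by (simp add: qi algebra_simps)
  then have "cmod (1 + z) = cmod (1 + \<i>)" using n[of "1 + \<i>"] n[of 1] by (simp add: norm_mult)
  then have "(cmod (1 + z))\<^sup>2 = (cmod (1 + \<i>))\<^sup>2" by simp
  then have "(1 + Re z)\<^sup>2 + (Im z)\<^sup>2 = 2" by (simp add: cmod_power2)
  with 1 have "Re z = 0" by (simp add: power2_eq_square algebra_simps)
  with 1 have "Im z = 1 \<or> Im z = -1" by (simp add: power2_eq_1_iff)
  with \<open>Re z = 0\<close> have "z = \<i> \<or> z = - \<i>" by (auto simp: complex_eq_iff)
  then show ?thesis
  proof
    assume z: "z = \<i>"
    have "q w = q 1 * w" for w
    proof -
      have "q w = (Re w + Im w * \<i>) * q 1" by (subst form) (simp add: qi z algebra_simps)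
      also have "Re w + Im w * \<i> = w" by (simp add: complex_eq_iff)
      finally show ?thesis by (simp add: mult.commute)
    qed
    then show ?thesis using qi z by blast
  next
    assume z: "z = - \<i>"
    have "q w = q 1 * cnj w" for w
    proof -
      have "q w = (Re w - Im w * \<i>) * q 1" by (subst form) (simp add: qi z algebra_simps)
      also have "Re w - Im w * \<i> = cnj w" by (simp add: complex_eq_iff)
      finally show ?thesis by (simp add: mult.commute)
    qed
    then show ?thesis using qi z by blast
  qed
qed

locale rank_one_preserver =
  fixes \<psi> :: "complex^'n^'n \<Rightarrow> complex^'n^'n"
  assumes lin: "linear \<psi>"
    and rank_one: "\<exists>y. \<psi> (outer x) = outer y"
    and fixed: "\<psi> (outer (axis i 1)) = outer (axis i 1)"
begin

lemmas psi_simps = linear_add[OF lin] linear_scale[OF lin] fixed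

definition q :: "'n \<Rightarrow> 'n \<Rightarrow> complex \<Rightarrow> complex" where
  "q i j w = \<psi> (off_unit i j w) $ i $ j"

text \<open>The images of \<open>outer\<close> at \<open>t w e_i + e_j\<close> are rank one for
  every real \<open>t\<close>, and their entries are polynomials in \<open>t\<close>. A diagonal
  entry outside \<open>i\<close>, \<open>j\<close> is linear in \<open>t\<close> and nonnegative at
  1 and -1, hence 0, which clears its row and column.\<close>

lemma psi_off_unit_aux:
  assumes ij: "i \<noteq> j"
  shows "\<psi> (off_unit i j w) = off_unit i j (q i j w) \<and> cmod (q i j w) = cmod w"
proof (cases "w = 0")
  case True
  then show ?thesis
    by (simp add: q_def off_unit_0 linear_0[OF lin])
next
  case False
  define N where "N = \<psi> (off_unit i j w)"
  have "\<exists>y. outer y = (t\<^sup>2 * (cmod w)\<^sup>2) *\<^sub>R outer (axis i 1) + outer (axis j 1) + t *\<^sub>R N" for t :: real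
  proof -
    obtain z where "\<psi> (outer ((t *\<^sub>R w) *s axis i 1 + axis j 1)) = outer z" using rank_one by blast
    then have "outer z = (t\<^sup>2 * (cmod w)\<^sup>2) *\<^sub>R outer (axis i 1) + outer (axis j 1) + t *\<^sub>R N"
      unfolding outer_two psi_simps off_unit_scaleR N_def by (simp add: power_mult_distrib)
    then show ?thesis by blast
  qed
  then obtain y where y: "\<And>t :: real. outer (y t) = (t\<^sup>2 * (cmod w)\<^sup>2) *\<^sub>R outer (axis i 1) + outer (axis j 1) + t *\<^sub>R N"
    by metis
  have ent: "y t $ a * cnj (y t $ b) = of_bool (a = i) * of_bool (b = i) * of_real (t\<^sup>2 * (cmod w)\<^sup>2)
      + of_bool (a = j) * of_bool (b = j) + of_real t * N $ a $ b" for t a b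
    using arg_cong[OF y[of t], of "\<lambda>A. A $ a $ b"]
    by (simp add: outer_nth[of "y t"] outer_axis_nth scaleR_conv_of_real[where 'a = complex] mult_ac)
  have N1: "N $ a $ b = y 1 $ a * cnj (y 1 $ b) - of_bool (a = i) * of_bool (b = i) * of_real ((cmod w)\<^sup>2)
      - of_bool (a = j) * of_bool (b = j)" for a b
    using ent[of 1 a b] by simp
  have Nh: "N $ b $ a = cnj (N $ a $ b)" for a b
    unfolding N1 by (simp add: mult_ac)
  define d where "d a = Re (N $ a $ a)" for a
  have Nd: "N $ a $ a = of_real (d a)" for a
    using Nh[of a a] by (simp add: complex_eq_iff d_def)
  have off: "N $ a $ b = 0" if a: "a \<noteq> i" "a \<noteq> j" for a b
  proof -
    have e': "(cmod (y t $ a))\<^sup>2 = t * d a" for t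
    proof -
      have "complex_of_real ((cmod (y t $ a))\<^sup>2) = of_real (t * d a)"
        unfolding complex_norm_square ent using a by (simp add: Nd)
      then show ?thesis by (simp only: of_real_eq_iff)
    qed
    have "d a = 0"
      using e'[of 1] e'[of "-1"] zero_le_power2[of "cmod (y 1 $ a)"] zero_le_power2[of "cmod (y (-1) $ a)"] by linarith
    then have "y 1 $ a = 0" using e'[of 1] by simp
    then show ?thesis using ent[of 1 a b] a by simp
  qed
  have off': "N $ b $ a = 0" if a: "a \<noteq> i" "a \<noteq> j" for a b
    using off[OF a, of b] Nh[of b a] by simp
  define Q where "Q = (cmod (N $ i $ j))\<^sup>2"
  \<comment> \<open>The vanishing of the 2 by 2 minor of a rank-one matrix on the indices
    \<open>i\<close>, \<open>j\<close>.\<close>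
  have rel: "(t\<^sup>2 * (cmod w)\<^sup>2 + t * d i) * (1 + t * d j) = t\<^sup>2 * Q" for t :: real
  proof -
    have 1: "(cmod (y t $ i))\<^sup>2 = t\<^sup>2 * (cmod w)\<^sup>2 + t * d i"
    proof -
      have "complex_of_real ((cmod (y t $ i))\<^sup>2) = of_real (t\<^sup>2 * (cmod w)\<^sup>2 + t * d i)"
        unfolding complex_norm_square ent using ij by (simp add: Nd)
      then show ?thesis by (simp only: of_real_eq_iff)
    qed
    have 2: "(cmod (y t $ j))\<^sup>2 = 1 + t * d j"
    proof -
      have "complex_of_real ((cmod (y t $ j))\<^sup>2) = of_real (1 + t * d j)"
        unfolding complex_norm_square ent using ij by (simp add: Nd)
      then show ?thesis by (simp only: of_real_eq_iff)
    qed
    have "(cmod (y t $ i * cnj (y t $ j)))\<^sup>2 = t\<^sup>2 * Q"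
      using ent[of t i j] ij by (simp add: norm_mult power_mult_distrib Q_def)
    then show ?thesis by (simp add: norm_mult power_mult_distrib flip: 1 2)
  qed
  let ?W = "(cmod w)\<^sup>2"
  have W: "?W \<noteq> 0" using False by simp
  \<comment> \<open>The identity is sampled at 1, -1 and 2: the first two separate odd from even
    powers, and 2 separates the linear from the cubic term.\<close>
  have "d i + ?W * d j = 0" "?W + d i * d j = Q" "2 * d i + 8 * (?W * d j) = 0"
    using rel[of 1] rel[of "-1"] rel[of 2] by (simp_all add: algebra_simps)
  then have "d i = 0" "?W * d j = 0" "?W + d i * d j = Q" by linarith+
  then have p: "d i = 0" and r: "d j = 0" and Q: "Q = ?W" using W by auto
  have N0: "N $ i $ i = 0" "N $ j $ j = 0" by (simp_all add: Nd p r)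
  have "N = off_unit i j (N $ i $ j)"
    unfolding vec_eq_iff
  proof (intro allI)
    fix a b
    show "N $ a $ b = off_unit i j (N $ i $ j) $ a $ b"
      using off[of a b] off'[of b a] N0 ij Nh[of j i]
      by (cases "a = i"; cases "a = j"; cases "b = i"; cases "b = j") (simp_all add: off_unit_nth)
  qed
  moreover have "cmod (N $ i $ j) = cmod w" using Q by (simp add: Q_def)
  ultimately show ?thesis by (simp add: q_def N_def)
qed

lemma psi_off_unit: "i \<noteq> j \<Longrightarrow> \<psi> (off_unit i j w) = off_unit i j (q i j w)"
  and norm_q: "i \<noteq> j \<Longrightarrow> cmod (q i j w) = cmod w"
  using psi_off_unit_aux by blast+

lemma linear_q: "linear (q i j)"
  by (rule linearI) (simp_all add: q_def off_unit_add off_unit_scaleR psi_simps)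

lemma q_commute:
  assumes "i \<noteq> j" shows "q j i (cnj w) = cnj (q i j w)"
proof -
  have "off_unit j i (q j i (cnj w)) = off_unit i j (q i j w)"
    using psi_off_unit[OF assms] psi_off_unit[of j i] assms by (metis off_unit_commute)
  from arg_cong[OF this, of "\<lambda>A. A $ j $ i"] show ?thesis
    using assms by (simp add: off_unit_nth)
qed

text \<open>A cocycle relation, read off from three entries of a single rank-one matrix whose
  \<open>j\<close>-th diagonal entry is 1.\<close>

lemma q_triple:
  assumes ij: "i \<noteq> j" "i \<noteq> l" "j \<noteq> l"
  shows "q i j w * q j l 1 = q i l w"
proof -
  obtain y where "\<psi> (outer (w *s axis i 1 + axis j 1 + axis l 1)) = outer y" using rank_one by blast
  then have y: "outer y = (cmod w)\<^sup>2 *\<^sub>R outer (axis i 1) + outer (axis j 1)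
    + outer (axis l 1) + off_unit i j (q i j w) + off_unit i l (q i l w) + off_unit j l (q j l 1)"
    unfolding outer_three by (simp add: psi_simps psi_off_unit ij)
  have e: "y $ i * cnj (y $ j) = q i j w" "y $ j * cnj (y $ l) = q j l 1" "y $ i * cnj (y $ l) = q i l w"
    "y $ j * cnj (y $ j) = 1"
    using arg_cong[OF y, of "\<lambda>A. A $ i $ j"] arg_cong[OF y, of "\<lambda>A. A $ j $ l"]
      arg_cong[OF y, of "\<lambda>A. A $ i $ l"] arg_cong[OF y, of "\<lambda>A. A $ j $ j"] ij
    by (simp_all add: outer_nth[of y] outer_axis_nth off_unit_nth)
  have "q i j w * q j l 1 = (y $ j * cnj (y $ j)) * (y $ i * cnj (y $ l))"
    by (simp only: e(1,2)[symmetric] mult_ac)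
  then show ?thesis by (simp only: e(3,4) mult_1_left)
qed

text \<open>Off the diagonal, \<open>q i j\<close> is either complex linear or conjugate linear; the
  value at \<open>i\<close> distinguishes the two.\<close>

definition clin :: "'n \<Rightarrow> 'n \<Rightarrow> bool" where "clin i j \<longleftrightarrow> q i j \<i> = \<i> * q i j 1"

lemma q1_nonzero: "i \<noteq> j \<Longrightarrow> q i j 1 \<noteq> 0"
  by (simp add: norm_q flip: zero_less_norm_iff)

lemma q_cases:
  assumes "i \<noteq> j"
  shows "q i j w = q i j 1 * (if clin i j then w else cnj w)"
  using real_isometry_complex[OF linear_q norm_q[OF assms]]
proof (elim disjE conjE)
  assume c: "q i j \<i> = \<i> * q i j 1" and w: "\<forall>w. q i j w = q i j 1 * w"
  from c have "clin i j" by (simp only: clin_def)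
  then have "(if clin i j then w else cnj w) = w" by simp
  then show ?thesis by (simp only: w[rule_format, of w])
next
  assume c: "q i j \<i> = - \<i> * q i j 1" and w: "\<forall>w. q i j w = q i j 1 * cnj w"
  have "- \<i> * q i j 1 \<noteq> \<i> * q i j 1"
    using q1_nonzero[OF assms] by (simp add: neg_eq_iff_add_eq_0 flip: mult_2)
  with c have "\<not> clin i j" by (simp only: clin_def) simp
  then have "(if clin i j then w else cnj w) = cnj w" by simp
  then show ?thesis by (simp only: w[rule_format, of w])
qed

lemma clin_commute:
  assumes "i \<noteq> j" shows "clin j i \<longleftrightarrow> clin i j"
proof -
  have "- q j i \<i> = cnj (q i j \<i>)"
    using q_commute[OF assms, of \<i>] linear_neg[OF linear_q, of j i \<i>] by simp
  from arg_cong[OF this, of uminus] have "q j i \<i> = - cnj (q i j \<i>)" by simp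
  moreover have "q j i 1 = cnj (q i j 1)" using q_commute[OF assms, of 1] by simp
  ultimately have "clin j i \<longleftrightarrow> - cnj (q i j \<i>) = - cnj (\<i> * q i j 1)"
    by (simp add: clin_def)
  then show ?thesis by (simp only: neg_equal_iff_equal complex_cnj_cancel_iff clin_def)
qed

text \<open>In the cocycle relation the factor \<open>q j l 1\<close> is a nonzero constant, so
  \<open>q i j\<close> and \<open>q i l\<close> are of the same type. This excludes a map that
  transposes only some entries.\<close>

lemma clin_share:
  assumes "i \<noteq> j" "i \<noteq> l" shows "clin i j \<longleftrightarrow> clin i l"
proof (cases "j = l")
  case False
  have "clin i l \<longleftrightarrow> q i j \<i> * q j l 1 = \<i> * q i j 1 * q j l 1"
    using q_triple[OF assms False] by (simp add: clin_def mult.assoc)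
  then show ?thesis
    using q1_nonzero[OF False] by (simp add: clin_def)
qed simp

lemma clin_all:
  assumes "i \<noteq> j" "a \<noteq> b" shows "clin i j \<longleftrightarrow> clin a b"
proof (cases "b = i")
  case True
  then show ?thesis using clin_share[of i j a] clin_commute[of i a] assms by auto
next
  case False
  then show ?thesis
    using clin_share[of i j b] clin_commute[of i b] clin_share[of b i a] clin_commute[of a b] assms by auto
qed

lemma diagonal_form:
  obtains D where "unitary_mat D"
    "(\<forall>A\<in>herm. \<psi> A = D ** A ** cadj D) \<or> (\<forall>A\<in>herm. \<psi> A = D ** transpose A ** cadj D)"
proof -
  obtain i0 :: 'n where True by simp
  \<comment> \<open>The cocycle \<open>q i j 1\<close> is a coboundary: relative to the base index
    \<open>i0\<close> it is \<open>d i\<close> times the conjugate of \<open>d j\<close>. These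
    phases form the diagonal unitary.\<close>
  define d where "d i = (if i = i0 then 1 else q i i0 1)" for i
  have nd: "cmod (d i) = 1" for i by (simp add: d_def norm_q)
  then have dd: "d i * cnj (d i) = 1" for i by (simp flip: complex_norm_square)
  have u: "q i j 1 = d i * cnj (d j)" if "i \<noteq> j" for i j
  proof (cases "i = i0 \<or> j = i0")
    case True
    then show ?thesis using that q_commute[of j i 1] by (auto simp: d_def)
  next
    case False
    then show ?thesis using q_triple[of i i0 j 1] that q_commute[of j i0 1] by (auto simp: d_def)
  qed
  define D where "D = (\<chi> i j. if i = j then d i else 0)"
  have D: "(D ** A ** cadj D) $ a $ b = d a * A $ a $ b * cnj (d b)" for A a b
  proof -
    have "(\<Sum>j\<in>UNIV. D $ a $ j * A $ j $ l) = (\<Sum>j\<in>UNIV. if j = a then d a * A $ a $ l else 0)" for l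
      by (rule sum.cong) (auto simp: D_def)
    then have 1: "(D ** A) $ a $ l = d a * A $ a $ l" for l by (simp add: matrix_matrix_mult_def)
    have 2: "cadj D $ l $ b = (if l = b then cnj (d b) else 0)" for l by (auto simp: D_def)
    have "(\<Sum>l\<in>UNIV. (D ** A) $ a $ l * cadj D $ l $ b) = (\<Sum>l\<in>UNIV. if l = b then d a * A $ a $ b * cnj (d b) else 0)"
      by (rule sum.cong) (simp_all add: 1 2 del: cadj_nth)
    then show ?thesis by (simp add: matrix_matrix_mult_def[of "D ** A"])
  qed
  have Doff: "D ** off_unit i j w ** cadj D = off_unit i j (d i * cnj (d j) * w)" for i j w
  proof -
    have "d a * off_unit i j w $ a $ b * cnj (d b) = off_unit i j (d i * cnj (d j) * w) $ a $ b" for a b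
      by (cases "a = i"; cases "b = j"; cases "a = j"; cases "b = i") (simp_all add: off_unit_nth algebra_simps)
    then show ?thesis by (simp add: vec_eq_iff D)
  qed
  have "D ** cadj D = mat 1"
  proof -
    have "(D ** cadj D) $ a $ b = mat 1 $ a $ b" for a b
      using D[of "mat 1" a b, unfolded matrix_mul_rid] by (simp add: mat_def dd)
    then show ?thesis by (simp add: vec_eq_iff)
  qed
  then have U: "unitary_mat D" by (simp add: unitary_mat_def matrix_left_right_inverse)
  have diag: "\<psi> (off_unit i i w) = D ** off_unit i i v ** cadj D" if "Re v = Re w" for i v w
    unfolding Doff dd using that by (simp add: off_unit_diag psi_simps)
  show ?thesis
  proof (cases "\<forall>i j. i \<noteq> j \<longrightarrow> clin i j")
    case True
    have l: "linear (\<lambda>A. D ** A ** cadj D)" by (rule linearI) (simp_all add: mm_simps)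
    have "\<psi> (off_unit i j w) = D ** off_unit i j w ** cadj D" for i j w
    proof (cases "i = j")
      case True
      then show ?thesis using diag[of w w i] by simp
    next
      case False
      then show ?thesis using True by (simp add: psi_off_unit Doff q_cases[of i j w] u)
    qed
    then have "\<forall>A\<in>herm. \<psi> A = D ** A ** cadj D"
      using linear_eq_on_off_unit[OF lin l] by blast
    then show ?thesis using that U by blast
  next
    case False
    then have nl: "\<not> clin i j" if "i \<noteq> j" for i j using clin_all that by blast
    have l: "linear (\<lambda>A. D ** transpose A ** cadj D)"
    proof (rule linearI)
      fix A B :: "complex^'n^'n" and r :: real
      have "transpose (A + B) = transpose A + transpose B" by (simp add: transpose_def vec_eq_iff)
      then show "D ** transpose (A + B) ** cadj D = D ** transpose A ** cadj D + D ** transpose B ** cadj D"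
        by (simp add: mm_simps)
      show "D ** transpose (r *\<^sub>R A) ** cadj D = r *\<^sub>R (D ** transpose A ** cadj D)"
        by (simp add: transpose_scalar mm_simps)
    qed
    have "\<psi> (off_unit i j w) = D ** transpose (off_unit i j w) ** cadj D" for i j w
    proof (cases "i = j")
      case True
      then show ?thesis using diag[of "cnj w" w i] by (simp add: transpose_off_unit)
    next
      case False
      then show ?thesis using nl[OF False] by (simp add: transpose_off_unit psi_off_unit Doff q_cases[of i j w] u)
    qed
    then have "\<forall>A\<in>herm. \<psi> A = D ** transpose A ** cadj D"
      using linear_eq_on_off_unit[OF lin l] by blast
    then show ?thesis using that U by blast
  qed
qed

end

text \<open>The vectors representing the images of the standard rank-one projections form an
  orthonormal basis. Conjugating with the unitary \<open>V\<close> having these columns makes every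
  diagonal matrix unit fixed and leaves only phases and a possible transposition.\<close>

theorem rank_one_preserver_form:
  fixes \<psi> :: "complex^'n^'n \<Rightarrow> complex^'n^'n"
  assumes lin: "linear \<psi>"
    and rank: "\<And>x. norm x = 1 \<Longrightarrow> \<exists>y. norm y = 1 \<and> \<psi> (outer x) = outer y"
    and onb: "\<And>u y. onb u \<Longrightarrow> \<forall>i. norm (y i) = 1 \<and> \<psi> (outer (u i)) = outer (y i) \<Longrightarrow> onb y"
  obtains U where "unitary_mat U"
    "(\<forall>A\<in>herm. \<psi> A = cadj U ** A ** U) \<or> (\<forall>A\<in>herm. \<psi> A = cadj U ** transpose A ** U)"
proof -
  have e: "norm (axis i 1 :: complex^'n) = 1" for i by simp
  have "\<forall>i. \<exists>y. norm y = 1 \<and> \<psi> (outer (axis i 1)) = outer y" using rank e by blast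
  then obtain y where y: "\<And>i. norm (y i) = 1 \<and> \<psi> (outer (axis i 1)) = outer (y i)" by metis
  have "onb (\<lambda>i. axis i 1 :: complex^'n)" by (auto simp: onb_def cip_axis axis_nth)
  from onb[OF this] y have "onb y" by blast
  define V where "V = colmat y"
  have V: "unitary_mat V" by (simp add: V_def colmat_unitary \<open>onb y\<close>)
  have Vy: "cadj V *v y i = axis i 1" for i
  proof -
    have "cadj V *v (V *v axis i 1) = axis i 1"
      by (simp only: matrix_vector_mul_assoc unitary_matD[OF V]) simp
    then show ?thesis by (simp add: V_def colmat_axis)
  qed
  define \<phi> where "\<phi> A = cadj V ** \<psi> A ** V" for A
  have \<phi>_outer: "\<phi> (outer x) = outer (cadj V *v z)" if "\<psi> (outer x) = outer z" for x z
    using conj_outer[of "cadj V" z] that by (simp add: \<phi>_def)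
  have 1: "linear \<phi>"
    by (rule linearI) (simp_all add: \<phi>_def linear_add[OF lin] linear_scale[OF lin] mm_simps)
  have 2: "\<phi> (outer (axis i 1)) = outer (axis i 1)" for i
    using \<phi>_outer[of "axis i 1" "y i"] y by (simp add: Vy)
  have 3: "\<exists>y. \<phi> (outer x) = outer y" for x
    proof (cases "x = 0")
      case True
      then show ?thesis by (intro exI[of _ 0]) (simp add: \<phi>_def linear_0[OF lin] mm_simps)
    next
      case False
      then obtain r where r: "norm (r *\<^sub>R x) = 1" "r > 0" using cip_nonzero_normalize by blast
      obtain z where z: "\<psi> (outer (r *\<^sub>R x)) = outer z" using rank[OF r(1)] by blast
      have "outer x = outer ((1 / r) *\<^sub>R (r *\<^sub>R x))" using r by simp
      also have "\<psi> \<dots> = outer ((1 / r) *\<^sub>R z)"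
        by (simp only: outer_scaleR[of "1 / r"] linear_scale[OF lin] z)
      finally show ?thesis using \<phi>_outer by blast
  qed
  interpret rank_one_preserver \<phi>
    by (intro rank_one_preserver.intro 1 2 3)
  obtain D where D: "unitary_mat D"
    "(\<forall>A\<in>herm. \<phi> A = D ** A ** cadj D) \<or> (\<forall>A\<in>herm. \<phi> A = D ** transpose A ** cadj D)"
    using diagonal_form by blast
  define U where "U = cadj (V ** D)"
  have "\<psi> A = V ** \<phi> A ** cadj V" for A
  proof -
    have "V ** \<phi> A ** cadj V = (V ** cadj V) ** \<psi> A ** (V ** cadj V)"
      by (simp add: \<phi>_def matrix_mul_assoc)
    then show ?thesis by (simp add: unitary_matD[OF V])
  qed
  then have "(\<forall>A\<in>herm. \<psi> A = cadj U ** A ** U) \<or> (\<forall>A\<in>herm. \<psi> A = cadj U ** transpose A ** U)"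
    using D(2) by (auto simp: U_def cadj_mult matrix_mul_assoc)
  then show ?thesis using that unitary_cadj[OF unitary_mult[OF V D(1)]] U_def by blast
qed

section \<open>Balanced matrices\<close>

definition balanced :: "nat \<Rightarrow> complex^'n^'n \<Rightarrow> bool" where
  "balanced k B \<longleftrightarrow> (\<exists>P\<in>proj k. \<exists>R\<in>proj k. B \<bullet> P = kradius k B \<and> B \<bullet> R = - kradius k B)"

text \<open>The shift translates every value by \<open>f * k\<close>, and an interval symmetric
  about 0 remains symmetric only under the zero translation.\<close>

lemma balanced_shift_eq_0:
  fixes X :: "complex^'n^'n"
  assumes X: "X \<in> herm" and k: "1 \<le> k" "k \<le> CARD('n)"
    and b: "balanced k X" "balanced k (X + f *\<^sub>R mat 1)"
  shows "f = 0"
proof -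
  obtain P R where P: "P \<in> proj k" "R \<in> proj k" "X \<bullet> P = kradius k X" "X \<bullet> R = - kradius k X"
    using b(1) by (auto simp: balanced_def)
  obtain P' R' where P': "P' \<in> proj k" "R' \<in> proj k"
      "(X + f *\<^sub>R mat 1) \<bullet> P' = kradius k (X + f *\<^sub>R mat 1)" "(X + f *\<^sub>R mat 1) \<bullet> R' = - kradius k (X + f *\<^sub>R mat 1)"
    using b(2) unfolding balanced_def by blast
  have sh: "(X + f *\<^sub>R mat 1) \<bullet> S = X \<bullet> S + f * k" if "S \<in> proj k" for S
    by (simp add: inner_add_left mat1_inner_proj[OF that])
  have h: "X + f *\<^sub>R mat 1 \<in> herm" by (simp add: herm_intros X)
  have "\<bar>X \<bullet> P'\<bar> \<le> kradius k X" "\<bar>X \<bullet> R'\<bar> \<le> kradius k X"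
    "\<bar>(X + f *\<^sub>R mat 1) \<bullet> P\<bar> \<le> kradius k (X + f *\<^sub>R mat 1)"
    "\<bar>(X + f *\<^sub>R mat 1) \<bullet> R\<bar> \<le> kradius k (X + f *\<^sub>R mat 1)"
    using kradius_ge[OF X k(2)] kradius_ge[OF h k(2)] P P' by blast+
  then have "f * k = 0"
    using P(3,4) P'(3,4) unfolding sh[OF P(1)] sh[OF P(2)] sh[OF P'(1)] sh[OF P'(2)] by linarith
  then show ?thesis using k by simp
qed

lemma balanced_shift_exists:
  fixes X :: "complex^'n^'n"
  assumes X: "X \<in> herm" and k: "1 \<le> k" "k \<le> CARD('n)"
  obtains h where "balanced k (X - h *\<^sub>R mat 1)"
proof -
  have c: "continuous_on (proj k) (\<lambda>P. X \<bullet> P)" by (intro continuous_intros)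
  obtain P where P: "P \<in> proj k" "\<forall>S\<in>proj k. X \<bullet> S \<le> X \<bullet> P"
    using continuous_attains_sup[OF compact_proj proj_nonempty[OF k(2)] c] by blast
  obtain R where R: "R \<in> proj k" "\<forall>S\<in>proj k. X \<bullet> R \<le> X \<bullet> S"
    using continuous_attains_inf[OF compact_proj proj_nonempty[OF k(2)] c] by blast
  define h where "h = (X \<bullet> P + X \<bullet> R) / 2 / k"
  have hk: "h * k = (X \<bullet> P + X \<bullet> R) / 2" using k by (simp add: h_def)
  have sh: "(X - h *\<^sub>R mat 1) \<bullet> S = X \<bullet> S - (X \<bullet> P + X \<bullet> R) / 2" if "S \<in> proj k" for S
    by (simp add: inner_diff_left mat1_inner_proj[OF that] hk)
  have RP: "X \<bullet> R \<le> X \<bullet> P" using P R by blast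
  have "kradius k (X - h *\<^sub>R mat 1) = (X \<bullet> P - X \<bullet> R) / 2"
  proof (rule kradius_eqI[OF _ k(2) P(1)])
    show "X - h *\<^sub>R mat 1 \<in> herm" by (simp add: herm_intros X)
    show "\<bar>(X - h *\<^sub>R mat 1) \<bullet> P\<bar> = (X \<bullet> P - X \<bullet> R) / 2"
      unfolding sh[OF P(1)] using RP by (simp add: abs_if field_simps)
    fix S :: "complex^'n^'n" assume S: "S \<in> proj k"
    show "\<bar>(X - h *\<^sub>R mat 1) \<bullet> S\<bar> \<le> (X \<bullet> P - X \<bullet> R) / 2"
      unfolding sh[OF S] using P(2)[rule_format, OF S] R(2)[rule_format, OF S] by (simp add: abs_le_iff field_simps)
  qed
  then have "balanced k (X - h *\<^sub>R mat 1)"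
    unfolding balanced_def using sh[OF P(1)] sh[OF R(1)] P(1) R(1)
    by (intro bexI[of _ P] bexI[of _ R] conjI) (simp_all add: field_simps)
  then show ?thesis by (rule that)
qed

text \<open>For n = 2k the complement of \<open>P\<close> again has rank \<open>k\<close>, and
  tracelessness reverses the sign of the value.\<close>

lemma balanced_half_dim:
  fixes X :: "complex^'n^'n"
  assumes X: "X \<in> herm0" and k: "CARD('n) = 2 * k"
  shows "balanced k X"
proof -
  have h: "X \<in> herm" "trace X = 0" using X by (auto simp: herm0_def)
  have k': "k \<le> CARD('n)" using k by simp
  have X1: "X \<bullet> mat 1 = 0" by (simp add: inner_mat1 h)
  obtain P where P: "P \<in> proj k" "\<bar>X \<bullet> P\<bar> = kradius k X" using kradius_attained[OF h(1) k'] by blast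
  have R: "mat 1 - P \<in> proj k" using proj_compl[OF P(1) k'] k by simp
  have "X \<bullet> (mat 1 - P) = - (X \<bullet> P)" by (simp add: inner_diff_right X1)
  then show ?thesis
    unfolding balanced_def using P R
    by (cases "X \<bullet> P \<ge> 0") (auto intro: bexI[of _ P] bexI[of _ "mat 1 - P"])
qed

text \<open>Traceless matrices attain both signs of their radius, so a shift in either direction
  adds its full size \<open>k * \<bar>a\<bar>\<close>.\<close>

lemma kradius_half_dim:
  fixes X :: "complex^'n^'n"
  assumes X: "X \<in> herm0" and k: "CARD('n) = 2 * k"
  shows "kradius k (a *\<^sub>R mat 1 + X) = k * \<bar>a\<bar> + kradius k X"
proof -
  have h: "X \<in> herm" using X by (auto simp: herm0_def)
  have k': "k \<le> CARD('n)" using k by simp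
  obtain P R where P: "P \<in> proj k" "R \<in> proj k" "X \<bullet> P = kradius k X" "X \<bullet> R = - kradius k X"
    using balanced_half_dim[OF assms] by (auto simp: balanced_def)
  have sh: "(a *\<^sub>R mat 1 + X) \<bullet> S = a * k + X \<bullet> S" if "S \<in> proj k" for S
    by (simp add: inner_add_left mat1_inner_proj[OF that])
  have nn: "0 \<le> kradius k X" by (rule kradius_nonneg[OF h k'])
  define S where "S = (if 0 \<le> a then P else R)"
  have S: "S \<in> proj k" using P by (simp add: S_def)
  have "X \<bullet> S = (if 0 \<le> a then kradius k X else - kradius k X)" using P by (simp add: S_def)
  then have "\<bar>a * k + X \<bullet> S\<bar> = k * \<bar>a\<bar> + kradius k X"
  proof -
    have "0 \<le> a \<Longrightarrow> 0 \<le> a * k" "\<not> 0 \<le> a \<Longrightarrow> a * k \<le> 0" by (simp_all add: mult_nonpos_nonneg)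
    moreover have "k * \<bar>a\<bar> = \<bar>a * k\<bar>" by (simp add: abs_mult)
    ultimately show ?thesis using nn \<open>X \<bullet> S = _\<close> by (cases "0 \<le> a") auto
  qed
  then show ?thesis
  proof (intro kradius_eqI[OF _ k' S])
    show "a *\<^sub>R mat 1 + X \<in> herm" by (simp add: herm_intros h)
    fix Z :: "complex^'n^'n" assume Z: "Z \<in> proj k"
    have "\<bar>a * k + X \<bullet> Z\<bar> \<le> \<bar>a * k\<bar> + \<bar>X \<bullet> Z\<bar>" by (rule abs_triangle_ineq)
    then show "\<bar>(a *\<^sub>R mat 1 + X) \<bullet> Z\<bar> \<le> k * \<bar>a\<bar> + kradius k X"
      unfolding sh[OF Z] using kradius_ge[OF h k' Z] by (simp add: abs_mult mult.commute)
  qed (simp add: sh[OF S])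
qed

context unital_parallel_preserver
begin

text \<open>\<open>B\<close> is parallel to \<open>B + t I\<close> for every real \<open>t\<close>:
  the top projection serves \<open>t \<ge> 0\<close>, the bottom one \<open>t < 0\<close>. This
  passes to \<open>L B\<close>, and shifts by plus and minus its radius yield a top and a bottom
  projection of equal absolute value. If the two values coincide, \<open>L B\<close> is scalar and
  equal to \<open>B\<close>.\<close>

lemma balanced_image:
  assumes B: "B \<in> herm" and b: "balanced k B"
  shows "balanced k (L B)"
proof -
  let ?X = "L B" and ?w = "kradius k (L B)"
  have hX: "?X \<in> herm" by (rule L_herm[OF B])
  obtain P R where P: "P \<in> proj k" "R \<in> proj k" "B \<bullet> P = kradius k B" "B \<bullet> R = - kradius k B"
    using b by (auto simp: balanced_def)
  have nn: "0 \<le> kradius k B" "0 \<le> ?w" using kradius_nonneg[OF _ k'] B hX by blast+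
  have sh: "(Y + t *\<^sub>R mat 1) \<bullet> S = Y \<bullet> S + t * k" if "S \<in> proj k" for S Y and t :: real
    by (simp add: inner_add_left mat1_inner_proj[OF that])
  have par_shift: "\<exists>S\<in>proj k. \<bar>?X \<bullet> S\<bar> = ?w \<and> \<bar>?X \<bullet> S + t * k\<bar> = kradius k (?X + t *\<^sub>R mat 1)" for t :: real
  proof -
    define S where "S = (if 0 \<le> t then P else R)"
    have S: "S \<in> proj k" using P by (simp add: S_def)
    have hBt: "B + t *\<^sub>R mat 1 \<in> herm" by (simp add: herm_intros B)
    have tk: "0 \<le> t \<Longrightarrow> 0 \<le> t * k" "\<not> 0 \<le> t \<Longrightarrow> t * k \<le> 0"
      by (simp_all add: mult_nonpos_nonneg)
    have e: "\<bar>B \<bullet> S + t * k\<bar> = kradius k B + \<bar>t * k\<bar>"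
    proof (cases "0 \<le> t")
      case True
      then show ?thesis using nn(1) tk(1) P(3) by (simp add: S_def)
    next
      case False
      then show ?thesis using nn(1) tk(2) P(4) by (simp add: S_def)
    qed
    have "kradius k (B + t *\<^sub>R mat 1) = kradius k B + \<bar>t * k\<bar>"
    proof (rule kradius_eqI[OF hBt k' S])
      show "\<bar>(B + t *\<^sub>R mat 1) \<bullet> S\<bar> = kradius k B + \<bar>t * k\<bar>" unfolding sh[OF S] by (rule e)
      fix Z :: "complex^'n^'n" assume Z: "Z \<in> proj k"
      show "\<bar>(B + t *\<^sub>R mat 1) \<bullet> Z\<bar> \<le> kradius k B + \<bar>t * k\<bar>"
        unfolding sh[OF Z] using kradius_ge[OF B k' Z] by linarith
    qed
    moreover have "\<bar>B \<bullet> S\<bar> = kradius k B" using P nn by (simp add: S_def)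
    ultimately have "kparallel k B (B + t *\<^sub>R mat 1)"
      unfolding kparallel_iff[OF B hBt k'] using S e sh[OF S] by auto
    then have "kparallel k ?X (L (B + t *\<^sub>R mat 1))" by (rule par[OF B hBt])
    then have "kparallel k ?X (?X + t *\<^sub>R mat 1)" by (simp add: L_add L_scaleR unital)
    then obtain Z where Z: "Z \<in> proj k" "\<bar>?X \<bullet> Z\<bar> = ?w"
        "\<bar>(?X + t *\<^sub>R mat 1) \<bullet> Z\<bar> = kradius k (?X + t *\<^sub>R mat 1)"
      using kparallel_iff[OF hX _ k', of "?X + t *\<^sub>R mat 1"] by (auto simp: herm_intros hX)
    then show ?thesis by (intro bexI[of _ Z]) (simp_all only: sh[OF Z(1)] simp_thms)
  qed
  have ge: "\<bar>?X \<bullet> S + t * k\<bar> \<le> kradius k (?X + t *\<^sub>R mat 1)" if "S \<in> proj k" for S and t :: real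
    using kradius_ge[OF _ k' that, of "?X + t *\<^sub>R mat 1"] sh[OF that] by (simp add: herm_intros hX)
  note le = kradius_ge[OF hX k']
  \<comment> \<open>As \<open>k \<ge> 1\<close>, a shift by plus or minus the radius gives all
    values one sign, so absolute maximisers become genuine maximisers or minimisers.\<close>
  have wk: "?w \<le> ?w * k" using nn k mult_left_mono[of 1 k ?w] by simp
  obtain S where S: "S \<in> proj k" "\<bar>?X \<bullet> S\<bar> = ?w" "\<bar>?X \<bullet> S + ?w * k\<bar> = kradius k (?X + ?w *\<^sub>R mat 1)"
    using par_shift[of ?w] by blast
  obtain Z where Z: "Z \<in> proj k" "\<bar>?X \<bullet> Z\<bar> = ?w" "\<bar>?X \<bullet> Z + (- ?w) * k\<bar> = kradius k (?X + (- ?w) *\<^sub>R mat 1)"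
    using par_shift[of "- ?w"] by blast
  have top: "?X \<bullet> Y \<le> ?X \<bullet> S" if Y: "Y \<in> proj k" for Y
    using ge[OF Y, of ?w] S le[OF Y] le[OF S(1)] wk by linarith
  have bot: "?X \<bullet> Z \<le> ?X \<bullet> Y" if Y: "Y \<in> proj k" for Y
    using ge[OF Y, of "- ?w"] Z le[OF Y] le[OF Z(1)] wk by linarith
  show ?thesis
  proof (cases "?X \<bullet> S = ?X \<bullet> Z")
    case False
    then have "?X \<bullet> S = ?w" "?X \<bullet> Z = - ?w" using S(2) Z(2) top[OF Z(1)] nn by linarith+
    then show ?thesis using S(1) Z(1) by (auto simp: balanced_def)
  next
    case True
    have "\<bar>?X \<bullet> Y\<bar> = ?w" if "Y \<in> proj k" for Y
      using top[OF that] bot[OF that] True S(2) by simp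
    then obtain c where c: "?X = c *\<^sub>R mat 1" using abs_const_scalar[OF hX k] by blast
    then have "L B = L (c *\<^sub>R mat 1)" by (simp add: L_scaleR unital)
    then have Bc: "B = c *\<^sub>R mat 1" by (rule L_inj[OF B herm_scaleR[OF herm_mat1]])
    have "?X = B" using c Bc by simp
    then show ?thesis using b by simp
  qed
qed

text \<open>For traceless \<open>C\<close>, both \<open>L C\<close> and its traceless part are
  balanced; they differ by a scalar shift, which must then vanish.\<close>

lemma half_dim_trace:
  assumes n: "CARD('n) = 2 * k" and B: "B \<in> herm"
  shows "trace (L B) = trace B"
proof -
  have kp: "0 < real k" using k by simp
  have tn: "trace (C - (Re (trace C) / CARD('n)) *\<^sub>R mat 1) = 0" if "C \<in> herm" for C :: "complex^'n^'n"
    using trace_herm_real[OF that] by (simp add: trace_sub trace_scaleR trace_mat1)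
  have z: "trace (L C) = 0" if C: "C \<in> herm0" for C
  proof -
    have hC: "C \<in> herm" using C by (simp add: herm0_def)
    let ?x = "Re (trace (L C)) / CARD('n)"
    have "L C - ?x *\<^sub>R mat 1 \<in> herm0"
      using tn[OF L_herm[OF hC]] by (simp add: herm0_def herm_intros L_herm hC)
    then have "balanced k (L C - ?x *\<^sub>R mat 1)" by (rule balanced_half_dim[OF _ n])
    moreover have "balanced k (L C - ?x *\<^sub>R mat 1 + ?x *\<^sub>R mat 1)"
      using balanced_image[OF hC balanced_half_dim[OF C n]] by simp
    ultimately have "?x = 0"
      by (rule balanced_shift_eq_0[OF herm_diff[OF L_herm[OF hC] herm_scaleR[OF herm_mat1]] k(1) k'])
    then have "Re (trace (L C)) = 0" by simp
    then show ?thesis using trace_herm_real[OF L_herm[OF hC]] by simp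
  qed
  let ?b = "Re (trace B) / CARD('n)"
  have "B - ?b *\<^sub>R mat 1 \<in> herm0" using tn[OF B] by (simp add: herm0_def herm_intros B)
  from z[OF this] have "trace (L B) = trace (?b *\<^sub>R (mat 1 :: complex^'n^'n))"
    by (simp add: L_diff L_scaleR unital trace_sub)
  also have "\<dots> = trace B" using trace_herm_real[OF B] by (simp add: trace_scaleR trace_mat1)
  finally show ?thesis .
qed

end

section \<open>Unitary similarities and transposition\<close>

lemma transpose_trace_mult: "trace (transpose A ** transpose B) = trace (A ** (B :: complex^'n^'n))"
proof -
  have "trace (transpose C) = trace C" for C :: "complex^'n^'n" by (simp add: trace_def transpose_def)
  moreover have "transpose A ** transpose B = transpose (B ** A)" by (simp add: matrix_transpose_mul)
  ultimately show ?thesis by (simp add: trace_mul_sym[of B A])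
qed

lemma cadj_transpose: "cadj (transpose A) = transpose (cadj A)"
  by (simp add: vec_eq_iff transpose_def)

lemma herm_transpose: "A \<in> herm \<Longrightarrow> transpose A \<in> herm"
  by (simp add: herm_def cadj_transpose)

lemma proj_transpose: "P \<in> proj k \<Longrightarrow> transpose P \<in> proj k"
proof -
  assume P: "P \<in> proj k"
  have "transpose P ** transpose P = transpose P" using projD(3)[OF P] by (simp flip: matrix_transpose_mul)
  moreover have "trace (transpose P) = trace P" by (simp add: trace_def transpose_def)
  ultimately show ?thesis using P by (simp add: proj_def cadj_transpose)
qed

lemma transpose_inner: "transpose A \<bullet> transpose B = A \<bullet> (B :: complex^'n^'n)"
proof -
  have "trace (transpose (cadj A) ** transpose B) = trace (cadj A ** B)" by (rule transpose_trace_mult)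
  then show ?thesis by (simp add: inner_eq_trace cadj_transpose)
qed

lemma unitary_conj_inner:
  assumes "unitary_mat U"
  shows "(cadj U ** A ** U) \<bullet> (cadj U ** B ** U) = A \<bullet> (B :: complex^'n^'n)"
proof -
  have "cadj (cadj U ** A ** U) ** (cadj U ** B ** U) = cadj U ** cadj A ** (U ** cadj U) ** B ** U"
    by (simp add: cadj_mult matrix_mul_assoc)
  also have "\<dots> = cadj U ** (cadj A ** B ** U)" by (simp add: unitary_matD[OF assms] matrix_mul_assoc)
  also have "trace \<dots> = trace (cadj A ** B ** (U ** cadj U))"
    by (subst trace_mul_sym) (simp add: matrix_mul_assoc)
  finally show ?thesis by (simp add: inner_eq_trace unitary_matD[OF assms])
qed

text \<open>Both shapes in (c.1) are treated as one map \<open>\<Psi>\<close>, an isometry for the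
  inner product that permutes the projections and so preserves the radius.\<close>

definition standard_form :: "complex^'n^'n \<Rightarrow> (complex^'n^'n \<Rightarrow> complex^'n^'n) \<Rightarrow> bool" where
  "standard_form U \<Psi> \<longleftrightarrow> unitary_mat U \<and> (\<Psi> = (\<lambda>A. cadj U ** A ** U) \<or> \<Psi> = (\<lambda>A. cadj U ** transpose A ** U))"

lemma standard_form_herm: "standard_form U \<Psi> \<Longrightarrow> A \<in> herm \<Longrightarrow> \<Psi> A \<in> herm"
  using herm_conj[of _ "cadj U"] herm_transpose by (auto simp: standard_form_def)

lemma standard_form_inner: "standard_form U \<Psi> \<Longrightarrow> \<Psi> A \<bullet> \<Psi> B = A \<bullet> B"
  by (auto simp: standard_form_def unitary_conj_inner transpose_inner)

lemma standard_form_mat1: "standard_form U \<Psi> \<Longrightarrow> \<Psi> (mat 1) = mat 1"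
  by (auto simp: standard_form_def unitary_matD)

lemma standard_form_trace: "standard_form U \<Psi> \<Longrightarrow> A \<in> herm \<Longrightarrow> trace (\<Psi> A) = trace A"
  using standard_form_inner[of U \<Psi> A "mat 1"] standard_form_mat1[of U \<Psi>] standard_form_herm[of U \<Psi> A]
    trace_herm_real[of A] trace_herm_real[of "\<Psi> A"]
  by (simp add: inner_mat1)

lemma standard_form_add: "standard_form U \<Psi> \<Longrightarrow> \<Psi> (A + B) = \<Psi> A + \<Psi> B"
proof -
  have "transpose (A + B) = transpose A + transpose B" by (simp add: transpose_def vec_eq_iff)
  then show "standard_form U \<Psi> \<Longrightarrow> ?thesis" by (auto simp: standard_form_def mm_simps)
qed

lemma standard_form_proj:
  assumes s: "standard_form U \<Psi>"
  shows "\<Psi> ` proj k = proj k"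
proof -
  have U: "unitary_mat U" using s by (simp add: standard_form_def)
  have c: "cadj U ** P ** U \<in> proj k" if "P \<in> proj k" for P
    using proj_unitary[OF unitary_cadj[OF U] that] by simp
  have inv: "cadj U ** (U ** P ** cadj U) ** U = P" for P
  proof -
    have "cadj U ** (U ** P ** cadj U) ** U = (cadj U ** U) ** P ** (cadj U ** U)" by (simp add: matrix_mul_assoc)
    then show ?thesis by (simp add: unitary_matD[OF U])
  qed
  have "\<exists>R\<in>proj k. \<Psi> R = P" if P: "P \<in> proj k" for P
  proof (cases "\<Psi> = (\<lambda>A. cadj U ** A ** U)")
    case True
    then show ?thesis using proj_unitary[OF U P] inv by auto
  next
    case False
    then have "\<Psi> = (\<lambda>A. cadj U ** transpose A ** U)" using s by (auto simp: standard_form_def)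
    then show ?thesis
      using proj_transpose[OF proj_unitary[OF U P]] inv by (intro bexI[of _ "transpose (U ** P ** cadj U)"]) auto
  qed
  moreover have "\<Psi> P \<in> proj k" if "P \<in> proj k" for P
    using s c[OF that] c[OF proj_transpose[OF that]] by (auto simp: standard_form_def)
  ultimately show ?thesis by blast
qed

lemma standard_form_kradius:
  assumes s: "standard_form U \<Psi>" and A: "A \<in> herm"
  shows "kradius k (\<Psi> A) = kradius k A"
proof -
  have "(\<lambda>P. \<bar>\<Psi> A \<bullet> P\<bar>) ` proj k = (\<lambda>P. \<bar>A \<bullet> P\<bar>) ` proj k"
    by (subst standard_form_proj[OF s, symmetric]) (simp add: image_image standard_form_inner[OF s])
  then show ?thesis by (simp add: kradius_def knr_herm A standard_form_herm[OF s A])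
qed

lemma kradius_scaleR:
  fixes A :: "complex^'n^'n"
  assumes A: "A \<in> herm" and k: "k \<le> CARD('n)"
  shows "kradius k (r *\<^sub>R A) = \<bar>r\<bar> * kradius k A"
proof -
  obtain P where P: "P \<in> proj k" "\<bar>A \<bullet> P\<bar> = kradius k A" using kradius_attained[OF A k] by blast
  show ?thesis
    by (rule kradius_eqI[OF herm_scaleR[OF A] k P(1)])
      (simp_all add: abs_mult P(2) kradius_ge[OF A k] mult_left_mono)
qed

lemma balanced_scaleR:
  fixes A :: "complex^'n^'n"
  assumes A: "A \<in> herm" and k: "k \<le> CARD('n)" and b: "balanced k A"
  shows "balanced k (r *\<^sub>R A)"
proof -
  obtain P R where P: "P \<in> proj k" "R \<in> proj k" "A \<bullet> P = kradius k A" "A \<bullet> R = - kradius k A"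
    using b by (auto simp: balanced_def)
  show ?thesis
  proof (cases "0 \<le> r")
    case True
    then show ?thesis unfolding balanced_def kradius_scaleR[OF A k]
      using P by (intro bexI[of _ P] bexI[of _ R] conjI) simp_all
  next
    case False
    then show ?thesis unfolding balanced_def kradius_scaleR[OF A k]
      using P by (intro bexI[of _ R] bexI[of _ P] conjI) simp_all
  qed
qed

lemma standard_form_balanced:
  assumes s: "standard_form U \<Psi>" and A: "A \<in> herm" and b: "balanced k A"
  shows "balanced k (\<Psi> A)"
proof -
  obtain P R where P: "P \<in> proj k" "R \<in> proj k" "A \<bullet> P = kradius k A" "A \<bullet> R = - kradius k A"
    using b by (auto simp: balanced_def)
  have "\<Psi> P \<in> proj k" "\<Psi> R \<in> proj k" using standard_form_proj[OF s] P by blast+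
  moreover have "\<Psi> A \<bullet> \<Psi> P = kradius k (\<Psi> A)" "\<Psi> A \<bullet> \<Psi> R = - kradius k (\<Psi> A)"
    using P by (simp_all add: standard_form_inner[OF s] standard_form_kradius[OF s A])
  ultimately show ?thesis unfolding balanced_def by blast
qed

text \<open>The value of \<open>outer x\<close> at \<open>S\<close> is the squared norm of
  \<open>S *v x\<close>, with extremes 0 and 1. The constant lowers every value by
  \<open>k / (2 k) = 1 / 2\<close>, centring this interval.\<close>

lemma balanced_outer:
  fixes x :: "complex^'n"
  assumes x: "norm x = 1" and k: "1 \<le> k" "k < CARD('n)"
  shows "balanced k (outer x - (1 / (2 * real k)) *\<^sub>R mat 1)"
proof -
  have k': "k \<le> CARD('n)" using k by simp
  obtain P where P: "P \<in> proj k" "P *v x = x" using proj_contains[OF x k(1) k'] by blast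
  obtain R' :: "complex^'n^'n" where R': "R' \<in> proj (CARD('n) - k)" "R' *v x = x"
  proof -
    have "1 \<le> CARD('n) - k" using k by linarith
    then show ?thesis using proj_contains[OF x _ diff_le_self] that by blast
  qed
  define R where "R = mat 1 - R'"
  have R: "R \<in> proj k" "R *v x = 0"
    using proj_compl[OF R'(1)] R'(2) k by (simp_all add: R_def mv_simps)
  let ?X = "outer x - (1 / (2 * real k)) *\<^sub>R mat 1 :: complex^'n^'n"
  have v: "?X \<bullet> S = (norm (S *v x))\<^sup>2 - 1 / 2" if S: "S \<in> proj k" for S
  proof -
    have "outer x \<bullet> S = (norm (S *v x))\<^sup>2"
      using inner_outer[OF projD(1)[OF S], of x] by (simp add: inner_commute qf_proj[OF S])
    then show ?thesis using k by (simp add: inner_diff_left mat1_inner_proj[OF S])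
  qed
  have "kradius k ?X = 1 / 2"
  proof (rule kradius_eqI[OF _ k' P(1)])
    show "?X \<in> herm" by (simp add: herm_intros)
    show "\<bar>?X \<bullet> P\<bar> = 1 / 2" unfolding v[OF P(1)] P(2) by (simp add: x)
    fix S :: "complex^'n^'n" assume S: "S \<in> proj k"
    have "0 \<le> qf (mat 1 - S) x" using psd_proj[OF proj_compl[OF S k']] by (simp add: psd_def)
    then have "(norm (S *v x))\<^sup>2 \<le> 1" by (simp add: qf_simps qf_proj[OF S] x)
    moreover have "0 \<le> (norm (S *v x))\<^sup>2" by simp
    ultimately show "\<bar>?X \<bullet> S\<bar> \<le> 1 / 2" unfolding v[OF S] by linarith
  qed
  moreover have "?X \<bullet> P = 1 / 2" unfolding v[OF P(1)] P(2) by (simp add: x)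
  moreover have "?X \<bullet> R = - (1 / 2)" unfolding v[OF R(1)] R(2) by simp
  ultimately show ?thesis unfolding balanced_def using P(1) R(1) by (simp only:) blast
qed

context unital_parallel_preserver
begin

text \<open>For \<open>k = 1\<close> the cones of rank n - 1 are used; since n is at least 3, that
  rank is at least 2.\<close>

lemma affine_form:
  assumes n3: "3 \<le> CARD('n)"
  obtains c f U \<Psi> where "c \<noteq> (0 :: real)" "linear f" "standard_form U \<Psi>"
    "\<And>A. A \<in> herm \<Longrightarrow> L A = c *\<^sub>R \<Psi> A + f A *\<^sub>R mat 1"
proof -
  have "\<exists>m. cone_preserver L m"
  proof (cases "2 \<le> k")
    case True
    have "cone_preserver L k"
    proof (rule cone_preserver.intro[OF lin bij True k(2) unital])
      fix P :: "complex^'n^'n" assume "P \<in> proj k"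
      then show "\<exists>Q\<in>proj k. L ` opt_cone k P = opt_cone k Q" using cone_image_eq by blast
    qed
    then show ?thesis by blast
  next
    case False
    let ?m = "CARD('n) - k"
    have "\<exists>Q\<in>proj ?m. L ` opt_cone ?m P = opt_cone ?m Q" if P: "P \<in> proj ?m" for P
    proof -
      have P': "mat 1 - P \<in> proj k" using proj_compl[OF P] k' by simp
      obtain Q where Q: "Q \<in> proj k" "L ` opt_cone k (mat 1 - P) = opt_cone k Q"
        using cone_image_eq[OF P'] by blast
      have "opt_cone ?m P = uminus ` opt_cone k (mat 1 - P)"
        using opt_cone_compl[OF P' k'] by simp
      then have "L ` opt_cone ?m P = uminus ` (L ` opt_cone k (mat 1 - P))"
        by (simp add: image_image L_minus)
      also have "\<dots> = opt_cone ?m (mat 1 - Q)" using opt_cone_compl[OF Q(1) k'] Q(2) by simp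
      finally show ?thesis using proj_compl[OF Q(1) k'] by blast
    qed
    moreover have "2 \<le> ?m" "?m < CARD('n)" using False k n3 by linarith+
    ultimately have "cone_preserver L ?m"
      by (intro cone_preserver.intro[OF lin bij _ _ unital])
    then show ?thesis by blast
  qed
  then obtain m where "cone_preserver L m" by blast
  from cone_preserver.rank_one_form[OF this]
  obtain c f \<psi> where c: "c \<noteq> (0 :: real)" "linear f" "linear \<psi>" "\<And>A. L A = c *\<^sub>R \<psi> A + f A *\<^sub>R mat 1"
    "\<And>x. norm x = 1 \<Longrightarrow> \<exists>y. norm y = 1 \<and> \<psi> (outer x) = outer y"
    "\<And>u y. onb u \<Longrightarrow> \<forall>i. norm (y i) = 1 \<and> \<psi> (outer (u i)) = outer (y i) \<Longrightarrow> onb y"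
    by blast
  obtain U where U: "unitary_mat U"
    "(\<forall>A\<in>herm. \<psi> A = cadj U ** A ** U) \<or> (\<forall>A\<in>herm. \<psi> A = cadj U ** transpose A ** U)"
  proof (rule rank_one_preserver_form[OF c(3)])
    show "\<exists>y. norm y = 1 \<and> \<psi> (outer x) = outer y" if "norm x = 1" for x by (rule c(5)[OF that])
    show "onb y" if "onb u" "\<forall>i. norm (y i) = 1 \<and> \<psi> (outer (u i)) = outer (y i)" for u y
      by (rule c(6)[OF that])
  qed (rule that)
  from U(2) obtain \<Psi> where "\<Psi> = (\<lambda>A. cadj U ** A ** U) \<or> \<Psi> = (\<lambda>A. cadj U ** transpose A ** U)"
    "\<forall>A\<in>herm. \<psi> A = \<Psi> A" by blast
  with U(1) have "standard_form U \<Psi>" "\<And>A. A \<in> herm \<Longrightarrow> L A = c *\<^sub>R \<Psi> A + f A *\<^sub>R mat 1"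
    using c(4) by (auto simp: standard_form_def)
  then show ?thesis using that c(1,2) by blast
qed

text \<open>The functional \<open>f\<close> vanishes on balanced matrices. If n = 2k, these include
  all traceless ones, and \<open>c\<close> stays free. Otherwise the balanced shift of
  \<open>outer x\<close> gives \<open>f (outer x) = f I / (2k)\<close>; summing over a basis yields
  \<open>f I = n f I / (2k)\<close>, so \<open>f I = 0\<close> and \<open>c = 1\<close>. Every
  Hermitian matrix is balanced up to a scalar, hence \<open>f = 0\<close>.\<close>

lemma standard_cases:
  assumes n3: "3 \<le> CARD('n)"
  obtains U \<Psi> where "standard_form U \<Psi>" "\<And>A. A \<in> herm \<Longrightarrow> L A = \<Psi> A"
  | U \<Psi> c where "CARD('n) = 2 * k" "standard_form U \<Psi>" "c \<noteq> (0 :: real)"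
      "\<And>A. A \<in> herm0 \<Longrightarrow> L A = c *\<^sub>R \<Psi> A"
proof -
  obtain c f U \<Psi> where c: "c \<noteq> (0 :: real)" and f: "linear f" and s: "standard_form U \<Psi>"
    and form: "\<And>A. A \<in> herm \<Longrightarrow> L A = c *\<^sub>R \<Psi> A + f A *\<^sub>R mat 1"
    using affine_form[OF n3] by blast
  have f0: "f B = 0" if B: "B \<in> herm" "balanced k B" for B
  proof -
    have "balanced k (c *\<^sub>R \<Psi> B)"
      by (rule balanced_scaleR[OF standard_form_herm[OF s B(1)] k' standard_form_balanced[OF s B]])
    moreover have "balanced k (c *\<^sub>R \<Psi> B + f B *\<^sub>R mat 1)"
      using balanced_image[OF B] form[OF B(1)] by simp
    ultimately show ?thesis
      by (rule balanced_shift_eq_0[OF herm_scaleR[OF standard_form_herm[OF s B(1)]] k(1) k'])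
  qed
  show ?thesis
  proof (cases "CARD('n) = 2 * k")
    case True
    have "L A = c *\<^sub>R \<Psi> A" if A: "A \<in> herm0" for A
    proof -
      have h: "A \<in> herm" using A by (simp add: herm0_def)
      show ?thesis using form[OF h] f0[OF h balanced_half_dim[OF A True]] by simp
    qed
    then show ?thesis using that(2) True s c by blast
  next
    case False
    have fo: "f (outer x) = f (mat 1) / (2 * real k)" if x: "norm x = 1" for x
    proof -
      have "f (outer x - (1 / (2 * real k)) *\<^sub>R mat 1) = 0"
        by (rule f0[OF _ balanced_outer[OF x k]]) (simp add: herm_intros)
      then show ?thesis by (simp add: linear_diff[OF f] linear_scale[OF f])
    qed
    have "f (mat 1) = (\<Sum>i\<in>(UNIV :: 'n set). f (outer (axis i 1)))"
      using linear_sum[OF f, of "\<lambda>i. outer (axis i 1)" "UNIV :: 'n set"] by (simp add: sum_outer_axis)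
    also have "\<dots> = CARD('n) * (f (mat 1) / (2 * real k))" by (simp add: fo)
    finally have "f (mat 1) * (2 * real k) = f (mat 1) * CARD('n)" using k by (simp add: field_simps)
    then have "f (mat 1) * (2 * real k - real CARD('n)) = 0" by (simp add: algebra_simps)
    moreover have "2 * real k - real CARD('n) \<noteq> 0"
    proof
      assume "2 * real k - real CARD('n) = 0"
      then have "real (2 * k) = real CARD('n)" by simp
      then show False using False by (simp only: of_nat_eq_iff)
    qed
    ultimately have fI: "f (mat 1) = 0" by simp
    have "c *\<^sub>R mat 1 = (mat 1 :: complex^'n^'n)"
      using form[OF herm_mat1] by (simp add: fI unital standard_form_mat1[OF s])
    then have "trace (c *\<^sub>R mat 1 :: complex^'n^'n) = trace (mat 1 :: complex^'n^'n)" by simp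
    then have "c = 1" by (simp add: trace_scaleR trace_mat1)
    have "L A = \<Psi> A" if A: "A \<in> herm" for A
    proof -
      obtain h where "balanced k (A - h *\<^sub>R mat 1)" using balanced_shift_exists[OF A k(1) k'] by blast
      then have "f (A - h *\<^sub>R mat 1) = 0" by (intro f0) (simp_all add: herm_intros A)
      then have "f A = 0" by (simp add: linear_diff[OF f] linear_scale[OF f] fI)
      then show ?thesis using form[OF A] \<open>c = 1\<close> by simp
    qed
    then show ?thesis using that(1) s by blast
  qed
qed

end

section \<open>Preservers of TEA pairs\<close>

lemma TEA_pair_scaleR:
  fixes A B :: "complex^'n^'n"
  assumes "A \<in> herm" "B \<in> herm" "k \<le> CARD('n)" "r \<noteq> 0"
  shows "TEA_pair k (r *\<^sub>R A) (r *\<^sub>R B) \<longleftrightarrow> TEA_pair k A B"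
proof -
  have "r *\<^sub>R A + r *\<^sub>R B = r *\<^sub>R (A + B)" by (simp add: scaleR_add_right)
  then have "TEA_pair k (r *\<^sub>R A) (r *\<^sub>R B) \<longleftrightarrow>
      \<bar>r\<bar> * kradius k (A + B) = \<bar>r\<bar> * (kradius k A + kradius k B)"
    using assms by (simp add: TEA_pair_def kradius_scaleR herm_add distrib_left)
  then show ?thesis using assms(4) by (simp add: TEA_pair_def)
qed

definition trace_part :: "complex^'n^'n \<Rightarrow> real" where
  "trace_part A = Re (trace A) / CARD('n)"

definition traceless_part :: "complex^'n^'n \<Rightarrow> complex^'n^'n" where
  "traceless_part A = A - trace_part A *\<^sub>R mat 1"

lemma trace_decomp: "A = trace_part A *\<^sub>R mat 1 + traceless_part A"
  by (simp add: traceless_part_def)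

lemma traceless_part_herm0:
  assumes "A \<in> herm" shows "traceless_part A \<in> herm0"
  using trace_herm_real[OF assms]
  by (simp add: herm0_def traceless_part_def trace_part_def herm_intros assms trace_sub trace_scaleR trace_mat1)

text \<open>The radius is additive over the scalar and traceless parts, each of which satisfies a
  triangle inequality. The sum is an equality exactly when both are.\<close>

lemma half_dim_TEA_pair:
  fixes A B :: "complex^'n^'n"
  assumes X: "X \<in> herm0" and Y: "Y \<in> herm0" and k: "CARD('n) = 2 * k"
  shows "TEA_pair k (a *\<^sub>R mat 1 + X) (b *\<^sub>R mat 1 + Y) \<longleftrightarrow> \<bar>a + b\<bar> = \<bar>a\<bar> + \<bar>b\<bar> \<and> TEA_pair k X (Y :: complex^'n^'n)"
proof -
  have h: "X \<in> herm" "Y \<in> herm" using X Y by (auto simp: herm0_def)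
  have k': "k \<le> CARD('n)" using k by simp
  have "0 < CARD('n)" by simp
  then have k0: "0 < real k" using k by linarith
  have XY: "X + Y \<in> herm0" using X Y by (simp add: herm0_def herm_intros trace_add)
  have "(a *\<^sub>R mat 1 + X) + (b *\<^sub>R mat 1 + Y) = (a + b) *\<^sub>R mat 1 + (X + Y)" by (simp add: algebra_simps)
  then have "TEA_pair k (a *\<^sub>R mat 1 + X) (b *\<^sub>R mat 1 + Y) \<longleftrightarrow>
      k * \<bar>a + b\<bar> + kradius k (X + Y) = k * \<bar>a\<bar> + kradius k X + (k * \<bar>b\<bar> + kradius k Y)"
    by (simp only: TEA_pair_def kradius_half_dim[OF X k] kradius_half_dim[OF Y k] kradius_half_dim[OF XY k])
  also have "\<dots> \<longleftrightarrow> k * \<bar>a + b\<bar> = k * (\<bar>a\<bar> + \<bar>b\<bar>) \<and> kradius k (X + Y) = kradius k X + kradius k Y"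
  proof -
    have "k * \<bar>a + b\<bar> \<le> k * (\<bar>a\<bar> + \<bar>b\<bar>)" by (intro mult_left_mono abs_triangle_ineq) simp
    moreover have "kradius k (X + Y) \<le> kradius k X + kradius k Y"
    proof -
      obtain P where P: "P \<in> proj k" "\<bar>(X + Y) \<bullet> P\<bar> = kradius k (X + Y)"
        using kradius_attained[OF herm_add[OF h] k'] by blast
      then show ?thesis
        using kradius_ge[OF h(1) k' P(1)] kradius_ge[OF h(2) k' P(1)] by (simp add: inner_add_left)
    qed
    ultimately show ?thesis by (auto simp: distrib_left)
  qed
  also have "\<dots> \<longleftrightarrow> \<bar>a + b\<bar> = \<bar>a\<bar> + \<bar>b\<bar> \<and> TEA_pair k X Y" using k0 by (simp add: TEA_pair_def)
  finally show ?thesis .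
qed

text \<open>A unital linear map keeping tracelessness leaves the scalar part unchanged, so the TEA
  condition has to be checked on traceless matrices only.\<close>

lemma half_dim_TEA_preserver:
  fixes S :: "complex^'n^'n \<Rightarrow> complex^'n^'n"
  assumes lin: "real_linear_on_herm S" and unital: "S (mat 1) = mat 1" and k: "CARD('n) = 2 * k"
    and herm0: "\<And>X. X \<in> herm0 \<Longrightarrow> S X \<in> herm0"
    and TEA: "\<And>X Y. X \<in> herm0 \<Longrightarrow> Y \<in> herm0 \<Longrightarrow> TEA_pair k X Y \<Longrightarrow> TEA_pair k (S X) (S Y)"
    and A: "A \<in> herm" and B: "B \<in> herm" and AB: "TEA_pair k A B"
  shows "TEA_pair k (S A) (S B)"
proof -
  have add: "S (C + D) = S C + S D" if "C \<in> herm" "D \<in> herm" for C D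
    using lin that by (simp add: real_linear_on_herm_def)
  have S: "S C = trace_part C *\<^sub>R mat 1 + S (traceless_part C)" if C: "C \<in> herm" for C
  proof -
    have "S C = S (trace_part C *\<^sub>R mat 1 + traceless_part C)" by (simp flip: trace_decomp)
    also have "\<dots> = S (trace_part C *\<^sub>R mat 1) + S (traceless_part C)"
      using traceless_part_herm0[OF C] by (intro add) (simp_all add: herm0_def herm_intros)
    also have "S (trace_part C *\<^sub>R mat 1) = trace_part C *\<^sub>R mat 1"
      using lin herm_mat1 unital by (auto simp: real_linear_on_herm_def)
    finally show ?thesis .
  qed
  note hA = traceless_part_herm0[OF A] and hB = traceless_part_herm0[OF B]
  have "TEA_pair k (trace_part A *\<^sub>R mat 1 + traceless_part A) (trace_part B *\<^sub>R mat 1 + traceless_part B)"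
    using AB by (simp flip: trace_decomp)
  then have "\<bar>trace_part A + trace_part B\<bar> = \<bar>trace_part A\<bar> + \<bar>trace_part B\<bar>"
    "TEA_pair k (traceless_part A) (traceless_part B)"
    by (simp_all only: half_dim_TEA_pair[OF hA hB k])
  then show ?thesis
    unfolding S[OF A] S[OF B] half_dim_TEA_pair[OF herm0[OF hA] herm0[OF hB] k]
    using TEA[OF hA hB] by blast
qed

section \<open>Traceless matrices in dimension two\<close>

lemma outer_sandwich: "A \<in> herm \<Longrightarrow> outer x ** A ** outer x = qf A x *\<^sub>R outer x"
  by (intro matrix_eq_matvec)
    (simp add: outer_matvec matvec_smult_right cip_smult_right qf_of_real matvec_scaleR_left scaleR_eq_smult
      vector_smult_assoc mult.commute flip: matrix_vector_mul_assoc)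

lemma proj_1_outer:
  assumes "P \<in> proj 1" obtains x where "norm x = 1" "P = outer x"
proof -
  obtain u S where u: "onb u" "card S = 1" "P = (\<Sum>i\<in>S. outer (u i))"
    using proj_structure[OF assms] by blast
  then obtain i where "S = {i}" using card_1_singletonE by blast
  then show ?thesis using that[of "u i"] onb_norm[OF u(1)] u(3) by simp
qed

text \<open>Both \<open>P\<close> and its complement have rank one, so the two blocks are
  nonnegative multiples of them. The trace condition fixes the scalar part, leaving the single ray
  through \<open>2 P - I\<close>.\<close>

lemma opt_cone_dim_2:
  fixes P :: "complex^'n^'n"
  assumes n: "CARD('n) = 2" and X: "X \<in> herm0" "X \<in> opt_cone 1 P" and P: "P \<in> proj 1"
  obtains r where "0 \<le> r" "X = r *\<^sub>R (2 *\<^sub>R P - mat 1)"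
proof -
  obtain l U V where d: "psd U" "psd V" "P ** U ** P = U" "(mat 1 - P) ** V ** (mat 1 - P) = V"
      "X = l *\<^sub>R mat 1 + U - V"
  proof -
    have "1 < CARD('n)" using n by simp
    from opt_cone_decomp[OF X(2) P order_refl this] show ?thesis using that by blast
  qed
  have "mat 1 - P \<in> proj 1" using proj_compl[OF P] n by simp
  then obtain z where z: "norm z = 1" "mat 1 - P = outer z" using proj_1_outer by blast
  obtain x where x: "norm x = 1" "P = outer x" using proj_1_outer[OF P] by blast
  have U: "U = qf U x *\<^sub>R P" using d(1,3) outer_sandwich[of U x] by (simp add: x(2) psd_def)
  have V: "V = qf V z *\<^sub>R (mat 1 - P)" using d(2,4) outer_sandwich[of V z] by (simp add: z(2) psd_def)
  have p: "0 \<le> qf U x" "0 \<le> qf V z" using d(1,2) by (simp_all add: psd_def)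
  define p q where "p = qf U x" and "q = qf V z"
  have Xe: "X = l *\<^sub>R mat 1 + p *\<^sub>R P - q *\<^sub>R (mat 1 - P)" using d(5) U V by (simp add: p_def q_def)
  have "trace X = 0" using X(1) by (simp add: herm0_def)
  then have "complex_of_real (2 * l + p - q) = 0"
    using projD(4)[OF P] by (simp add: Xe trace_add trace_sub trace_scaleR trace_mat1 n algebra_simps)
  then have "2 * l + p - q = 0" by (simp only: of_real_eq_0_iff)
  then have l: "l = (q - p) / 2" by simp
  have "X = ((p + q) / 2) *\<^sub>R (2 *\<^sub>R P - mat 1)"
  proof -
    have "X = (l - q) *\<^sub>R mat 1 + (p + q) *\<^sub>R P"
      unfolding Xe scaleR_diff_right scaleR_diff_left scaleR_add_left by simp
    also have "l - q = - ((p + q) / 2)" by (simp add: l field_simps)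
    also have "(p + q) *\<^sub>R P = ((p + q) / 2) *\<^sub>R (2 *\<^sub>R P)" by simp
    finally show ?thesis by (simp only: scaleR_diff_right scaleR_minus_left) simp
  qed
  moreover have "0 \<le> (p + q) / 2" using p by (simp add: p_def q_def)
  ultimately show ?thesis using that by blast
qed

text \<open>A common maximiser puts both matrices on one ray, with \<open>Z = 2 P - I\<close> and
  coefficients carrying the common sign \<open>s\<close>. Any real linear map preserves this
  relation, which explains the freedom in (c.3).\<close>

lemma TEA_pair_dim_2:
  fixes X Y :: "complex^'n^'n"
  assumes n: "CARD('n) = 2" and X: "X \<in> herm0" and Y: "Y \<in> herm0" and T: "TEA_pair 1 X Y"
  obtains Z a b where "Z \<in> herm" "X = a *\<^sub>R Z" "Y = b *\<^sub>R Z" "\<bar>a + b\<bar> = \<bar>a\<bar> + \<bar>b :: real\<bar>"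
proof -
  have h: "X \<in> herm" "Y \<in> herm" using X Y by (auto simp: herm0_def)
  have k: "1 \<le> CARD('n)" using n by simp
  obtain P s where P: "P \<in> proj 1" and s: "s \<in> {1, -1 :: real}"
    and eq: "s * (X \<bullet> P) = kradius 1 X" "s * (Y \<bullet> P) = kradius 1 Y"
    using T unfolding TEA_pair_iff[OF h k] by blast
  have "\<exists>r\<ge>0. W = (s * r) *\<^sub>R (2 *\<^sub>R P - mat 1)" if W: "W \<in> herm0" "s * (W \<bullet> P) = kradius 1 W" for W
  proof -
    have hW: "W \<in> herm" using W(1) by (simp add: herm0_def)
    have 1: "s *\<^sub>R W \<in> herm0" using W(1) by (simp add: herm0_def herm_intros trace_scaleR)
    have "s * (W \<bullet> R) \<le> s * (W \<bullet> P)" if R: "R \<in> proj 1" for R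
      using kradius_ge[OF hW k R] W(2) s by auto
    then have "s *\<^sub>R W \<in> opt_cone 1 P" by (simp add: opt_cone_def herm_intros hW)
    from opt_cone_dim_2[OF n 1 this P] obtain r where r: "0 \<le> r" "s *\<^sub>R W = r *\<^sub>R (2 *\<^sub>R P - mat 1)" by blast
    have "W = s *\<^sub>R (s *\<^sub>R W)" using s by auto
    also have "\<dots> = (s * r) *\<^sub>R (2 *\<^sub>R P - mat 1)" by (simp only: r(2) scaleR_scaleR)
    finally show ?thesis using r(1) by blast
  qed
  from this[OF X eq(1)] this[OF Y eq(2)] obtain p q where
    p: "0 \<le> p" "X = (s * p) *\<^sub>R (2 *\<^sub>R P - mat 1)" and q: "0 \<le> q" "Y = (s * q) *\<^sub>R (2 *\<^sub>R P - mat 1)"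
    by blast
  have "2 *\<^sub>R P - mat 1 \<in> herm" by (simp add: herm_intros projD[OF P])
  moreover have "\<bar>s * p + s * q\<bar> = \<bar>s * p\<bar> + \<bar>s * q\<bar>" using p(1) q(1) s by auto
  ultimately show ?thesis using p q that by blast
qed

section \<open>Normal form of the preserver \<open>T\<close>, and the converse for each form\<close>

context
  fixes T :: "complex^'n^'n \<Rightarrow> complex^'n^'n" and k :: nat
  assumes k: "1 \<le> k" "k < CARD('n)"
    and bij: "bij_betw T herm herm"
    and lin: "real_linear_on_herm T"
begin

private lemma T_herm: "A \<in> herm \<Longrightarrow> T A \<in> herm"
  using bij by (auto simp: bij_betw_def)

private lemma T_inj: "A \<in> herm \<Longrightarrow> B \<in> herm \<Longrightarrow> T A = T B \<Longrightarrow> A = B"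
  using bij unfolding bij_betw_def by (metis inj_onD)

private lemma T_add: "A \<in> herm \<Longrightarrow> B \<in> herm \<Longrightarrow> T (A + B) = T A + T B"
  and T_scaleR: "A \<in> herm \<Longrightarrow> T (r *\<^sub>R A) = r *\<^sub>R T A"
  using lin by (auto simp: real_linear_on_herm_def)

lemma scaled_preserver_linear: "real_linear_on_herm (\<lambda>A. \<mu> *\<^sub>R T A)"
  using lin by (simp add: real_linear_on_herm_def scaleR_add_right)

lemma scaled_preserver_bij:
  assumes "\<mu> \<noteq> 0" shows "bij_betw (\<lambda>A. \<mu> *\<^sub>R T A) herm herm"
proof (rule bij_betw_imageI)
  show "inj_on (\<lambda>A. \<mu> *\<^sub>R T A) herm"
    using T_inj assms by (auto simp: inj_on_def)
  have "\<exists>A\<in>herm. \<mu> *\<^sub>R T A = B" if B: "B \<in> herm" for B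
  proof -
    have "(1 / \<mu>) *\<^sub>R B \<in> T ` herm" using bij B by (simp add: bij_betw_def herm_intros)
    then obtain A where "A \<in> herm" "T A = (1 / \<mu>) *\<^sub>R B" by auto
    then show ?thesis using assms by (intro bexI[of _ A]) simp_all
  qed
  then show "(\<lambda>A. \<mu> *\<^sub>R T A) ` herm = herm"
    using T_herm by (force simp: herm_intros)
qed

lemma TEA_scaled_imp:
  assumes m: "\<mu> \<noteq> 0" and S: "\<And>A. A \<in> herm \<Longrightarrow> \<mu> *\<^sub>R T A = S A"
    and TEA: "\<And>A B. A \<in> herm \<Longrightarrow> B \<in> herm \<Longrightarrow> TEA_pair k A B \<Longrightarrow> TEA_pair k (S A) (S B)"
    and A: "A \<in> herm" "B \<in> herm" "TEA_pair k A B"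
  shows "TEA_pair k (T A) (T B)"
  using TEA[OF A] TEA_pair_scaleR[OF T_herm[OF A(1)] T_herm[OF A(2)] _ m, of k] k
  by (simp flip: S add: A)

lemma preserver_form:
  assumes n2: "2 \<le> CARD('n)"
    and par: "\<And>A B. A \<in> herm \<Longrightarrow> B \<in> herm \<Longrightarrow> kparallel k A B \<Longrightarrow> kparallel k (T A) (T B)"
  obtains \<mu> where "\<mu> \<noteq> 0" "\<mu> *\<^sub>R T (mat 1) = mat 1" "CARD('n) = 2"
      "\<And>A. A \<in> herm \<Longrightarrow> trace (\<mu> *\<^sub>R T A) = trace A"
  | \<mu> U \<Psi> where "\<mu> \<noteq> 0" "standard_form U \<Psi>" "\<And>A. A \<in> herm \<Longrightarrow> \<mu> *\<^sub>R T A = \<Psi> A"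
  | \<mu> U \<Psi> c where "\<mu> \<noteq> 0" "\<mu> *\<^sub>R T (mat 1) = mat 1" "CARD('n) = 2 * k" "CARD('n) > 2"
      "standard_form U \<Psi>" "c \<noteq> (0 :: real)" "\<And>A. A \<in> herm0 \<Longrightarrow> \<mu> *\<^sub>R T A = c *\<^sub>R \<Psi> A"
proof -
  have k': "k \<le> CARD('n)" using k by simp
  obtain c0 where c0: "T (mat 1) = c0 *\<^sub>R mat 1" using parallel_preserver_mat1[OF bij k par] by blast
  have "c0 \<noteq> 0"
  proof
    assume "c0 = 0"
    then have "T (mat 1) = T 0" using c0 T_scaleR[OF herm_0, of 0] by simp
    then have "(mat 1 :: complex^'n^'n) = 0" by (rule T_inj[OF herm_mat1 herm_0])
    then have "trace (mat 1 :: complex^'n^'n) = 0" by (simp add: trace_0[unfolded mat_0])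
    then show False by (simp add: trace_mat1)
  qed
  define \<mu> where "\<mu> = 1 / c0"
  have m: "\<mu> \<noteq> 0" using \<open>c0 \<noteq> 0\<close> by (simp add: \<mu>_def)
  have mI: "\<mu> *\<^sub>R T (mat 1) = mat 1" using \<open>c0 \<noteq> 0\<close> by (simp add: \<mu>_def c0)
  \<comment> \<open>The Hermitian part is a real linear retraction onto \<open>herm\<close>;
    composing with it extends \<open>T\<close> to a linear map on all matrices.\<close>
  define H where "H A = (1 / 2) *\<^sub>R (A + cadj A)" for A :: "complex^'n^'n"
  have H: "H A \<in> herm" for A
    by (simp add: H_def herm_def cadj_scaleR cadj_add add.commute)
  have Hh: "H A = A" if "A \<in> herm" for A
    by (simp add: H_def hermD[OF that] flip: scaleR_2)
  define L where "L A = \<mu> *\<^sub>R T (H A)" for A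
  have Lh: "L A = \<mu> *\<^sub>R T A" if "A \<in> herm" for A by (simp add: L_def Hh[OF that])
  interpret unital_parallel_preserver L k
  proof (rule unital_parallel_preserver.intro)
    show "linear L"
    proof (rule linearI)
      fix A B :: "complex^'n^'n" and r :: real
      have "H (A + B) = H A + H B" by (simp add: H_def cadj_add algebra_simps)
      then show "L (A + B) = L A + L B" by (simp add: L_def T_add[OF H H] scaleR_add_right)
      have "H (r *\<^sub>R A) = r *\<^sub>R H A" by (simp add: H_def cadj_scaleR algebra_simps)
      then show "L (r *\<^sub>R A) = r *\<^sub>R L A" by (simp add: L_def T_scaleR[OF H])
    qed
    show "bij_betw L herm herm"
      using scaled_preserver_bij[OF m] by (simp add: Lh cong: bij_betw_cong)
    show "L (mat 1) = mat 1" by (simp add: Lh herm_mat1 mI)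
    show "kparallel k (L A) (L B)" if A: "A \<in> herm" "B \<in> herm" "kparallel k A B" for A B
    proof -
      have t: "T A \<in> herm" "T B \<in> herm" using A T_herm by blast+
      obtain P where P: "P \<in> proj k" "\<bar>T A \<bullet> P\<bar> = kradius k (T A)" "\<bar>T B \<bullet> P\<bar> = kradius k (T B)"
        using par[OF A] unfolding kparallel_iff[OF t k'] by blast
      show ?thesis
        unfolding Lh[OF A(1)] Lh[OF A(2)] kparallel_iff[OF herm_scaleR[OF t(1)] herm_scaleR[OF t(2)] k']
        using P by (intro bexI[of _ P]) (simp_all add: kradius_scaleR t k' abs_mult)
    qed
  qed (fact k)+
  show ?thesis
  proof (cases "CARD('n) = 2")
    case True
    \<comment> \<open>Here \<open>k = 1\<close> is forced, so the half-dimensional trace result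
      applies.\<close>
    then have "CARD('n) = 2 * k" using k by simp
    from half_dim_trace[OF this] show ?thesis
      using that(1)[OF m mI True] by (simp add: Lh)
  next
    case False
    then have n3: "3 \<le> CARD('n)" using n2 by simp
    show ?thesis
    proof (rule standard_cases[OF n3])
      fix U \<Psi> assume "standard_form U \<Psi>" "\<And>A. A \<in> herm \<Longrightarrow> L A = \<Psi> A"
      then show ?thesis using that(2)[OF m] Lh by metis
    next
      fix U \<Psi> c assume a: "CARD('n) = 2 * k" "standard_form U \<Psi>" "c \<noteq> (0 :: real)"
        and f: "\<And>A. A \<in> herm0 \<Longrightarrow> L A = c *\<^sub>R \<Psi> A"
      have "\<mu> *\<^sub>R T A = c *\<^sub>R \<Psi> A" if "A \<in> herm0" for A
        using f[OF that] Lh[of A] that by (simp add: herm0_def)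
      then show ?thesis using that(3)[OF m mI a(1) _ a(2,3)] n3 by simp
    qed
  qed
qed

lemma TEA_preserver_half_dim:
  assumes m: "\<mu> \<noteq> 0" and mI: "\<mu> *\<^sub>R T (mat 1) = mat 1" and n: "CARD('n) = 2 * k"
    and s: "standard_form U \<Psi>" and c: "c \<noteq> 0" and form: "\<And>A. A \<in> herm0 \<Longrightarrow> \<mu> *\<^sub>R T A = c *\<^sub>R \<Psi> A"
    and A: "A \<in> herm" "B \<in> herm" "TEA_pair k A B"
  shows "TEA_pair k (T A) (T B)"
proof (rule TEA_scaled_imp[OF m refl _ A])
  fix A B :: "complex^'n^'n" assume AB: "A \<in> herm" "B \<in> herm" "TEA_pair k A B"
  show "TEA_pair k (\<mu> *\<^sub>R T A) (\<mu> *\<^sub>R T B)"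
  proof (rule half_dim_TEA_preserver[OF scaled_preserver_linear mI n _ _ AB])
    fix X assume "X \<in> (herm0 :: (complex^'n^'n) set)"
    then show "\<mu> *\<^sub>R T X \<in> herm0"
      using standard_form_herm[OF s, of X] standard_form_trace[OF s, of X]
      by (simp add: form) (simp add: herm0_def herm_intros trace_scaleR)
  next
    fix X Y assume X: "X \<in> (herm0 :: (complex^'n^'n) set)" and Y: "Y \<in> (herm0 :: (complex^'n^'n) set)" and T: "TEA_pair k X Y"
    have h: "X \<in> herm" "Y \<in> herm" using X Y by (simp_all add: herm0_def)
    have "TEA_pair k (\<Psi> X) (\<Psi> Y)"
      using T by (simp add: TEA_pair_def standard_form_kradius[OF s] h herm_add flip: standard_form_add[OF s])
    then show "TEA_pair k (\<mu> *\<^sub>R T X) (\<mu> *\<^sub>R T Y)"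
      unfolding form[OF X] form[OF Y]
      using TEA_pair_scaleR[OF standard_form_herm[OF s h(1)] standard_form_herm[OF s h(2)] _ c] k by simp
  qed
qed

lemma TEA_preserver_standard:
  assumes m: "\<mu> \<noteq> 0" and s: "standard_form U \<Psi>" and form: "\<And>A. A \<in> herm \<Longrightarrow> \<mu> *\<^sub>R T A = \<Psi> A"
    and A: "A \<in> herm" "B \<in> herm" "TEA_pair k A B"
  shows "TEA_pair k (T A) (T B)"
proof (rule TEA_scaled_imp[OF m form _ A])
  fix A B :: "complex^'n^'n" assume AB: "A \<in> herm" "B \<in> herm" "TEA_pair k A B"
  then show "TEA_pair k (\<Psi> A) (\<Psi> B)"
    by (simp add: TEA_pair_def standard_form_kradius[OF s] herm_add flip: standard_form_add[OF s])
qed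

lemma TEA_preserver_dim_2:
  assumes m: "\<mu> \<noteq> 0" and mI: "\<mu> *\<^sub>R T (mat 1) = mat 1" and n: "CARD('n) = 2"
    and tr: "\<And>A. A \<in> herm \<Longrightarrow> trace (\<mu> *\<^sub>R T A) = trace A"
    and A: "A \<in> herm" "B \<in> herm" "TEA_pair k A B"
  shows "TEA_pair k (T A) (T B)"
proof (rule TEA_scaled_imp[OF m refl _ A])
  have k1: "k = 1" using n k by simp
  then have nk: "CARD('n) = 2 * k" using n by simp
  fix A B :: "complex^'n^'n" assume AB: "A \<in> herm" "B \<in> herm" "TEA_pair k A B"
  show "TEA_pair k (\<mu> *\<^sub>R T A) (\<mu> *\<^sub>R T B)"
  proof (rule half_dim_TEA_preserver[OF scaled_preserver_linear mI nk _ _ AB])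
    fix X assume "X \<in> (herm0 :: (complex^'n^'n) set)"
    then show "\<mu> *\<^sub>R T X \<in> herm0"
      using tr[of X] T_herm[of X] by (simp add: herm0_def herm_intros)
  next
    fix X Y assume X: "X \<in> (herm0 :: (complex^'n^'n) set)" and Y: "Y \<in> (herm0 :: (complex^'n^'n) set)" and T: "TEA_pair k X Y"
    obtain Z a b where Z: "Z \<in> herm" "X = a *\<^sub>R Z" "Y = b *\<^sub>R Z" "\<bar>a + b\<bar> = \<bar>a\<bar> + \<bar>b\<bar>"
      using TEA_pair_dim_2[OF n X Y] T k1 by blast
    define W where "W = \<mu> *\<^sub>R T Z"
    have W: "W \<in> herm" by (simp add: W_def herm_intros T_herm Z(1))
    have e: "\<mu> *\<^sub>R T X = a *\<^sub>R W" "\<mu> *\<^sub>R T Y = b *\<^sub>R W"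
      by (simp_all add: Z(2,3) T_scaleR[OF Z(1)] W_def mult.commute)
    show "TEA_pair k (\<mu> *\<^sub>R T X) (\<mu> *\<^sub>R T Y)"
      unfolding e TEA_pair_def scaleR_add_left[symmetric] using Z(4) k W
      by (simp add: kradius_scaleR distrib_right)
  qed
qed

end

theorem theorem1p2:
  fixes T :: "complex^'n^'n \<Rightarrow> complex^'n^'n" and k :: nat
  assumes n2: "CARD('n) \<ge> 2"
    and k1: "1 \<le> k" and kn: "k < CARD('n)"
    and bij: "bij_betw T herm herm"
    and lin: "real_linear_on_herm T"
  shows "((\<forall>A\<in>herm. \<forall>B\<in>herm. kparallel k A B \<longrightarrow> kparallel k (T A) (T B))
          \<longleftrightarrow> (\<forall>A\<in>herm. \<forall>B\<in>herm. TEA_pair k A B \<longrightarrow> TEA_pair k (T A) (T B)))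
       \<and> ((\<forall>A\<in>herm. \<forall>B\<in>herm. TEA_pair k A B \<longrightarrow> TEA_pair k (T A) (T B))
          \<longleftrightarrow> (\<exists>\<mu>::real. \<mu> \<noteq> 0 \<and> (\<exists>U. unitary_mat U \<and>
               ( (\<forall>A\<in>herm. \<mu> *\<^sub>R T A = cadj U ** A ** U)
               \<or> (\<forall>A\<in>herm. \<mu> *\<^sub>R T A = cadj U ** transpose A ** U)
               \<or> (CARD('n) = 2 * k \<and> CARD('n) > 2 \<and> \<mu> *\<^sub>R T (mat 1) = mat 1 \<and>
                   (\<exists>c::real. c \<noteq> 0 \<and>
                      ((\<forall>A\<in>herm0. \<mu> *\<^sub>R T A = c *\<^sub>R (cadj U ** A ** U))
                     \<or> (\<forall>A\<in>herm0. \<mu> *\<^sub>R T A = c *\<^sub>R (cadj U ** transpose A ** U)))))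
               \<or> (CARD('n) = 2 \<and> bij_betw (\<lambda>A. \<mu> *\<^sub>R T A) herm herm
                   \<and> real_linear_on_herm (\<lambda>A. \<mu> *\<^sub>R T A)
                   \<and> \<mu> *\<^sub>R T (mat 1) = mat 1
                   \<and> (\<forall>A\<in>herm. trace (\<mu> *\<^sub>R T A) = trace A))))))"
    (is "(?a \<longleftrightarrow> ?b) \<and> (?b \<longleftrightarrow> ?c)")
proof -
  note ctx = k1 kn bij lin
  have "?c" if ?a
  proof -
    have par: "\<And>A B. A \<in> herm \<Longrightarrow> B \<in> herm \<Longrightarrow> kparallel k A B \<Longrightarrow> kparallel k (T A) (T B)"
      using that by blast
    show ?thesis
    proof (rule preserver_form[OF ctx n2 par])
      fix \<mu> :: real
      assume a: "\<mu> \<noteq> 0" "\<mu> *\<^sub>R T (mat 1) = mat 1" "CARD('n) = 2" "\<And>A. A \<in> herm \<Longrightarrow> trace (\<mu> *\<^sub>R T A) = trace A"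
      have "unitary_mat (mat 1 :: complex^'n^'n)" by (simp add: unitary_mat_def cadj_mat1)
      then show ?c
        using a scaled_preserver_bij[OF ctx a(1)] scaled_preserver_linear[OF ctx]
        by (intro exI[of _ \<mu>] conjI exI[of _ "mat 1"]) auto
    next
      fix \<mu> :: real and U \<Psi>
      assume a: "\<mu> \<noteq> 0" "standard_form U \<Psi>" "\<And>A. A \<in> herm \<Longrightarrow> \<mu> *\<^sub>R T A = \<Psi> A"
      then show ?c
        by (intro exI[of _ \<mu>] conjI exI[of _ U]) (auto simp: standard_form_def)
    next
      fix \<mu> c :: real and U \<Psi>
      assume a: "\<mu> \<noteq> 0" "\<mu> *\<^sub>R T (mat 1) = mat 1" "CARD('n) = 2 * k" "CARD('n) > 2"
        "standard_form U \<Psi>" "c \<noteq> 0" "\<And>A. A \<in> herm0 \<Longrightarrow> \<mu> *\<^sub>R T A = c *\<^sub>R \<Psi> A"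
      have "\<exists>c::real. c \<noteq> 0 \<and> ((\<forall>A\<in>herm0. \<mu> *\<^sub>R T A = c *\<^sub>R (cadj U ** A ** U))
                     \<or> (\<forall>A\<in>herm0. \<mu> *\<^sub>R T A = c *\<^sub>R (cadj U ** transpose A ** U)))"
        using a(5-7) by (intro exI[of _ c]) (auto simp: standard_form_def)
      moreover have "unitary_mat U" using a(5) by (simp add: standard_form_def)
      ultimately show ?c using a(1-4) by blast
    qed
  qed
  moreover have "?b" if ?c
  proof -
    from that obtain \<mu> U where m: "\<mu> \<noteq> 0" and U: "unitary_mat U"
      and cases: "(\<forall>A\<in>herm. \<mu> *\<^sub>R T A = cadj U ** A ** U)
               \<or> (\<forall>A\<in>herm. \<mu> *\<^sub>R T A = cadj U ** transpose A ** U)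
               \<or> (CARD('n) = 2 * k \<and> CARD('n) > 2 \<and> \<mu> *\<^sub>R T (mat 1) = mat 1 \<and>
                   (\<exists>c::real. c \<noteq> 0 \<and>
                      ((\<forall>A\<in>herm0. \<mu> *\<^sub>R T A = c *\<^sub>R (cadj U ** A ** U))
                     \<or> (\<forall>A\<in>herm0. \<mu> *\<^sub>R T A = c *\<^sub>R (cadj U ** transpose A ** U)))))
               \<or> (CARD('n) = 2 \<and> \<mu> *\<^sub>R T (mat 1) = mat 1 \<and> (\<forall>A\<in>herm. trace (\<mu> *\<^sub>R T A) = trace A))"
      by blast
    have s: "standard_form U (\<lambda>A. cadj U ** A ** U)" "standard_form U (\<lambda>A. cadj U ** transpose A ** U)"
      using U by (simp_all add: standard_form_def)
    show ?b
      using cases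
    proof (elim disjE conjE exE)
      assume "\<forall>A\<in>herm. \<mu> *\<^sub>R T A = cadj U ** A ** U"
      then show ?b using TEA_preserver_standard[OF ctx m s(1)] by blast
    next
      assume "\<forall>A\<in>herm. \<mu> *\<^sub>R T A = cadj U ** transpose A ** U"
      then show ?b using TEA_preserver_standard[OF ctx m s(2)] by blast
    next
      fix c :: real
      assume "CARD('n) = 2 * k" "\<mu> *\<^sub>R T (mat 1) = mat 1" "c \<noteq> 0"
        "\<forall>A\<in>herm0. \<mu> *\<^sub>R T A = c *\<^sub>R (cadj U ** A ** U)"
      then show ?b using TEA_preserver_half_dim[OF ctx m _ _ s(1)] by blast
    next
      fix c :: real
      assume "CARD('n) = 2 * k" "\<mu> *\<^sub>R T (mat 1) = mat 1" "c \<noteq> 0"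
        "\<forall>A\<in>herm0. \<mu> *\<^sub>R T A = c *\<^sub>R (cadj U ** transpose A ** U)"
      then show ?b using TEA_preserver_half_dim[OF ctx m _ _ s(2)] by blast
    next
      assume "CARD('n) = 2" "\<mu> *\<^sub>R T (mat 1) = mat 1" "\<forall>A\<in>herm. trace (\<mu> *\<^sub>R T A) = trace A"
      then show ?b using TEA_preserver_dim_2[OF ctx m] by blast
    qed
  qed
  \<comment> \<open>A parallel pair becomes a TEA pair after possibly replacing \<open>B\<close> by
    \<open>- B\<close>, and \<open>T\<close> commutes with this sign.\<close>
  moreover have "?a" if ?b
  proof (intro ballI impI)
    fix A B :: "complex^'n^'n" assume AB: "A \<in> herm" "B \<in> herm" and p: "kparallel k A B"
    have h: "T A \<in> herm" "T B \<in> herm" using bij AB by (auto simp: bij_betw_def)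
    have "T (- B) = - T B" using lin AB(2) unfolding real_linear_on_herm_def by (metis scaleR_minus1_left)
    then show "kparallel k (T A) (T B)"
      using p that AB herm_minus[OF AB(2)] unfolding kparallel_TEA[OF AB(2)] kparallel_TEA[OF h(2)] by metis
  qed
  ultimately show ?thesis by blast
qed

end
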